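(* The eigenvalues $\lambda_n$ ($n\in\mathbb{Z}$) of the boundary value problem $By'+\Omega(x)y=\lambda\rho(x)y$, $0<x<\pi$, $U_1(y)=0$, $U_2(y)=0$ described in the context are of the form $$\lambda_n=\tilde\lambda_n+\epsilon_n,$$ where $$\tilde\lambda_n=\left[n+\frac1\pi\arctan\left(\frac{c_3b_4-c_4b_3}{b_3c_3+c_4b_4}\right)\right]\frac{\pi}{\mu(\pi)}$$ and $\{\epsilon_n\}\in\ell_2$. Moreover, for large $n$ the eigenvalues are simple.
   Context: Let $0<a<\pi$, $\alpha>0$, $\alpha\neq1$, $\rho(x)=1$ for $0\le x\le a$ and $\rho(x)=\alpha$ for $a<x\le\pi$, and let $\mu(x)=x$ for $0\le x\le a$, $\mu(x)=\alpha x-\alpha a+a$ for $a<x\le\pi$. Let $p,q\in L_2(0,\pi)$ be real-valued, and $$B=\begin{pmatrix}0&1\\ -1&0\end{pmatrix},\quad \Omega(x)=\begin{pmatrix}p(x)&q(x)\\ q(x)&-p(x)\end{pmatrix},\quad y(x)=\begin{pmatrix}y_1(x)\\ y_2(x)\end{pmatrix}.$$ Let $b_1,\dots,b_4,c_1,\dots,c_4$ be real numbers with $k_1:=b_1b_4-b_2b_3>0$ and $k_2:=c_1c_4-c_2c_3>0$; the formula for $\tilde\lambda_n$ presupposes $b_3c_3+b_4c_4\ne0$. Consider the boundary value problem consisting of the system $By'+\Omega(x)y=\lambda\rho(x)y$, $0<x<\pi$ ($\lambda\in\mathbb{C}$ the spectral parameter), and the boundary conditions $$U_1(y):=b_1y_2(0)+b_2y_1(0)-\lambda(b_3y_2(0)+b_4y_1(0))=0,$$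 $$U_2(y):=c_1y_2(\pi)+c_2y_1(\pi)+\lambda(c_3y_2(\pi)+c_4y_1(\pi))=0.$$ Let $\varphi(x,\lambda)=(\varphi_1,\varphi_2)^T$ and $\psi(x,\lambda)=(\psi_1,\psi_2)^T$ be the solutions of the system with $$\varphi(0,\lambda)=\begin{pmatrix}\lambda b_3-b_1\\ b_2-\lambda b_4\end{pmatrix},\qquad \psi(\pi,\lambda)=\begin{pmatrix}-c_1-\lambda c_3\\ c_2+\lambda c_4\end{pmatrix}.$$ The characteristic function is $\Delta(\lambda)=\varphi_2(x,\lambda)\psi_1(x,\lambda)-\varphi_1(x,\lambda)\psi_2(x,\lambda)$, which does not depend on $x$. The eigenvalues of the problem coincide with the zeros of $\Delta$; an eigenvalue is simple if it is a simple zero of $\Delta$.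
   Formalization: The family λ_n (n∈ℤ) lists the eigenvalues, counted with multiplicity, up to finitely many omissions, since the spectral parameter in both boundary conditions yields surplus eigenvalues and a listing of all of them with ℓ₂ errors is impossible. *)

theory Defs
  imports "HOL-Analysis.Analysis" "HOL-Complex_Analysis.Complex_Analysis"
begin

definition square_integrable_on :: "(real \<Rightarrow> real) \<Rightarrow> real set \<Rightarrow> bool" where
  "square_integrable_on f S \<longleftrightarrow>
     f \<in> borel_measurable (lebesgue_on S) \<and> integrable (lebesgue_on S) (\<lambda>x. (f x)\<^sup>2)"

definition rho :: "real \<Rightarrow> real \<Rightarrow> real \<Rightarrow> real" where
  "rho a \<alpha> x = (if x \<le> a then 1 else \<alpha>)"

definition mu :: "real \<Rightarrow> real \<Rightarrow> real \<Rightarrow> real" where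
  "mu a \<alpha> x = (if x \<le> a then x else \<alpha> * x - \<alpha> * a + a)"

definition matB :: "complex^2^2" where
  "matB = vector [vector [0, 1], vector [-1, 0]]"

definition Omega :: "(real \<Rightarrow> real) \<Rightarrow> (real \<Rightarrow> real) \<Rightarrow> real \<Rightarrow> complex^2^2" where
  "Omega p q x =
     vector [vector [of_real (p x), of_real (q x)],
             vector [of_real (q x), - of_real (p x)]]"

(* Since p and q are only square integrable, solutions are understood in the usual
   (Caratheodory) sense: y is absolutely continuous on [0, pi], i.e. an indefinite integral
   of a Lebesgue integrable function y', and the system holds almost everywhere. *)
definition dirac_solution ::
  "real \<Rightarrow> real \<Rightarrow> (real \<Rightarrow> real) \<Rightarrow> (real \<Rightarrow> real) \<Rightarrow> complex \<Rightarrow> (real \<Rightarrow> complex^2) \<Rightarrow> bool" where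
  "dirac_solution a \<alpha> p q lam y \<longleftrightarrow>
     (\<exists>y'. y' absolutely_integrable_on {0..pi} \<and>
           (\<forall>x\<in>{0..pi}. y x = y 0 + integral {0..x} y') \<and>
           (AE x in lebesgue_on {0<..<pi}.
              matB *v y' x + Omega p q x *v y x = (lam * of_real (rho a \<alpha> x)) *s y x))"

definition U1 ::
  "real \<Rightarrow> real \<Rightarrow> real \<Rightarrow> real \<Rightarrow> complex \<Rightarrow> (real \<Rightarrow> complex^2) \<Rightarrow> complex" where
  "U1 b1 b2 b3 b4 lam y =
     b1 * y 0 $ 2 + b2 * y 0 $ 1 - lam * (b3 * y 0 $ 2 + b4 * y 0 $ 1)"

definition U2 ::
  "real \<Rightarrow> real \<Rightarrow> real \<Rightarrow> real \<Rightarrow> complex \<Rightarrow> (real \<Rightarrow> complex^2) \<Rightarrow> complex" where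
  "U2 c1 c2 c3 c4 lam y =
     c1 * y pi $ 2 + c2 * y pi $ 1 + lam * (c3 * y pi $ 2 + c4 * y pi $ 1)"

definition is_eigenvalue ::
  "real \<Rightarrow> real \<Rightarrow> (real \<Rightarrow> real) \<Rightarrow> (real \<Rightarrow> real) \<Rightarrow>
   real \<Rightarrow> real \<Rightarrow> real \<Rightarrow> real \<Rightarrow> real \<Rightarrow> real \<Rightarrow> real \<Rightarrow> real \<Rightarrow> complex \<Rightarrow> bool" where
  "is_eigenvalue a \<alpha> p q b1 b2 b3 b4 c1 c2 c3 c4 lam \<longleftrightarrow>
     (\<exists>y. dirac_solution a \<alpha> p q lam y \<and> (\<exists>x\<in>{0..pi}. y x \<noteq> 0) \<and>
          U1 b1 b2 b3 b4 lam y = 0 \<and> U2 c1 c2 c3 c4 lam y = 0)"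

definition is_phi ::
  "real \<Rightarrow> real \<Rightarrow> (real \<Rightarrow> real) \<Rightarrow> (real \<Rightarrow> real) \<Rightarrow> real \<Rightarrow> real \<Rightarrow> real \<Rightarrow> real \<Rightarrow>
   (real \<Rightarrow> complex \<Rightarrow> complex^2) \<Rightarrow> bool" where
  "is_phi a \<alpha> p q b1 b2 b3 b4 \<phi> \<longleftrightarrow>
     (\<forall>lam. dirac_solution a \<alpha> p q lam (\<lambda>x. \<phi> x lam) \<and>
          \<phi> 0 lam = vector [lam * b3 - b1, b2 - lam * b4])"

definition is_psi ::
  "real \<Rightarrow> real \<Rightarrow> (real \<Rightarrow> real) \<Rightarrow> (real \<Rightarrow> real) \<Rightarrow> real \<Rightarrow> real \<Rightarrow> real \<Rightarrow> real \<Rightarrow>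
   (real \<Rightarrow> complex \<Rightarrow> complex^2) \<Rightarrow> bool" where
  "is_psi a \<alpha> p q c1 c2 c3 c4 \<psi> \<longleftrightarrow>
     (\<forall>lam. dirac_solution a \<alpha> p q lam (\<lambda>x. \<psi> x lam) \<and>
          \<psi> pi lam = vector [- c1 - lam * c3, c2 + lam * c4])"

(* The value does not depend on x in [0, pi]; statements about the characteristic function
   are therefore made for an arbitrary fixed x. *)
definition char_fun ::
  "(real \<Rightarrow> complex \<Rightarrow> complex^2) \<Rightarrow> (real \<Rightarrow> complex \<Rightarrow> complex^2) \<Rightarrow> real \<Rightarrow> complex \<Rightarrow> complex"
  where
  "char_fun \<phi> \<psi> x lam = \<phi> x lam $ 2 * \<psi> x lam $ 1 - \<phi> x lam $ 1 * \<psi> x lam $ 2"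

definition simple_zero :: "(complex \<Rightarrow> complex) \<Rightarrow> complex \<Rightarrow> bool" where
  "simple_zero f z \<longleftrightarrow> f z = 0 \<and> zorder f z = 1"

definition lambda_tilde ::
  "real \<Rightarrow> real \<Rightarrow> real \<Rightarrow> real \<Rightarrow> real \<Rightarrow> real \<Rightarrow> int \<Rightarrow> real" where
  "lambda_tilde a \<alpha> b3 b4 c3 c4 n =
     (n + 1 / pi * arctan ((c3 * b4 - c4 * b3) / (b3 * c3 + c4 * b4))) * (pi / mu a \<alpha> pi)"

(* A family of points indexed by the integers lists the eigenvalues, counted with multiplicity
   (the order as a zero of D), up to finitely many omissions: no eigenvalue is listed more often
   than its multiplicity, and only finitely many are listed less often. One cannot ask that nothing
   be omitted, because the two boundary conditions containing the spectral parameter contribute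
   two eigenvalues in excess of the points lambda_tilde n.  Example: p = q = 0, b3 = c3 = 1,
   b2 = c2 = -1, all other coefficients 0.  Then D(z) is, up to sign,
   (z^2 - 1) sin (m z) - 2 z cos (m z) with m = mu(pi), whose real zeros are all simple and are
   the solutions of m z + 2 arctan z = k pi, one for each integer k, whereas lambda_tilde n
   = n pi / m. *)
definition lists_almost_all_eigenvalues ::
  "(complex \<Rightarrow> bool) \<Rightarrow> (complex \<Rightarrow> complex) \<Rightarrow> (int \<Rightarrow> complex) \<Rightarrow> bool" where
  "lists_almost_all_eigenvalues is_ev D ev \<longleftrightarrow>
     (\<forall>n. is_ev (ev n)) \<and>
     (\<forall>z. is_ev z \<longrightarrow> finite {n. ev n = z} \<and> int (card {n. ev n = z}) \<le> zorder D z) \<and>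
     finite {z. is_ev z \<and> int (card {n. ev n = z}) < zorder D z}"

end

theory Submission
  imports Defs
begin

text \<open>
  Put \<open>u = y1 + \<i> * y2\<close> and \<open>v = y1 - \<i> * y2\<close>.  The Dirac system becomes \<open>u' = \<i> * lam * \<rho> * u + f * v\<close>,
  \<open>v' = - \<i> * lam * \<rho> * v + g * u\<close> with \<open>f = q - \<i> * p\<close> and \<open>g = q + \<i> * p\<close>.  If the potential vanishes, its
  solutions are multiples of \<open>exp (\<plusminus> \<i> * lam * \<mu> x)\<close>, and the characteristic function is, up to terms of
  lower degree in \<open>lam\<close>, a constant times \<open>lam\<^sup>2 * sin (m * (lam - t0))\<close>, where \<open>m = \<mu> pi\<close> and \<open>t0\<close> is chosen
  such that the zeros of the sine are the points \<open>lambda_tilde n\<close>.  The theorem says that this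
  picture persists for a square integrable potential, and there are two things to prove.

  The first is an estimate of the characteristic function (\<open>characteristic_asymptotics\<close>).
  After the growth \<open>exp (\<bar>Im lam\<bar> * \<mu>)\<close> has been split off, solutions are bounded
  (\<open>gauged_growth\<close>), and an integration by parts expresses the
  influence of the potential by Fourier integrals of \<open>f\<close> and \<open>g\<close> in the phase variable \<open>\<mu>\<close>
  (\<open>upper_half_plane_estimate\<close>).  These integrals are square summable over the arithmetic progression of
  the points \<open>lambda_tilde n\<close>, by Bessel's inequality (\<open>defect_square_summable\<close>), and they
  tend to zero as \<open>\<bar>lam\<bar>\<close> grows, uniformly in all directions: near the real axis because they are
  controlled by their values on such a progression, far from it because of the exponential decay
  of their kernels (\<open>defect_vanishes\<close>).  The characteristic function is entire since the solutions are
  locally uniform limits of Picard iterates (\<open>solution_holomorphic\<close>).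

  The second is a statement about entire functions \<open>D\<close> that are close to \<open>\<kappa> * z\<^sup>2 * sin (m * (z - t0))\<close> in this sense
  (locale \<open>sine_type\<close>).  Away from the zeros of the sine \<open>D\<close> has no zeros of large modulus.  Near a
  zero \<open>T n\<close> of the sine, with \<open>\<bar>n\<bar>\<close> large, a contraction argument yields exactly one zero of \<open>D\<close>, which is
  simple and whose distance from \<open>T n\<close> is at most a constant times \<open>\<bar>D (T n)\<bar> / \<bar>T n\<bar>\<^sup>2\<close>; this makes
  the distances square summable (\<open>local_zeros\<close>).  Finally, Rouche's theorem on large circles
  shows that sufficiently many zeros are left over for the remaining finitely many
  indices (\<open>zeros_listed\<close>).
\<close>

section \<open>Indefinite Lebesgue integrals\<close>

text \<open>Integration by parts for indefinite Lebesgue integrals.  The right-hand side integrates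
  \<open>f s * g t\<close> over a square, and the two terms on the left are its two triangles, so that Fubini's
  theorem gives the identity and no pointwise derivative is involved.\<close>

lemma lebesgue_triangle_swap:
  fixes f g :: "real \<Rightarrow> 'a :: {euclidean_space, real_normed_field}"
  assumes f: "f absolutely_integrable_on {0..x}" and g: "g absolutely_integrable_on {0..x}"
  shows "integral {0..x} (\<lambda>s. f s * integral {0..s} g) + integral {0..x} (\<lambda>t. integral {0..t} f * g t)
       = integral {0..x} f * integral {0..x} g"
proof -
  define M where "M = lebesgue_on {0..x}"
  interpret finite_measure M
    unfolding M_def by (rule finite_measure_lebesgue_on) simp
  interpret pair_sigma_finite M M ..
  have fM: "integrable M f" and gM: "integrable M g"
    using f g by (simp_all add: M_def set_integrable_def integrable_restrict_space)
  note [measurable] = borel_measurable_integrable[OF fM] borel_measurable_integrable[OF gM]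
  have id[measurable]: "(\<lambda>s. s) \<in> borel_measurable M"
    by (auto simp: M_def intro!: measurable_restrict_space1 measurable_completion)
  have fg: "integrable (M \<Otimes>\<^sub>M M) (\<lambda>(s, t). f s * g t)"
  proof (rule Fubini_integrable)
    have "integrable M (\<lambda>s. norm (f s) * (\<integral>t. norm (g t) \<partial>M))"
      using fM by (intro integrable_mult_left) auto
    then show "integrable M (\<lambda>s. \<integral>t. norm (case (s, t) of (s, t) \<Rightarrow> f s * g t) \<partial>M)"
      by (simp add: norm_mult)
  qed (use gM in auto)
  define A where "A = (\<lambda>s t. if t \<le> s then f s * g t else 0)"
  define B where "B = (\<lambda>s t. if t \<le> s then 0 else f s * g t)"
  have A: "integrable (M \<Otimes>\<^sub>M M) (case_prod A)"
    by (rule Bochner_Integration.integrable_bound[OF fg]) (auto simp: A_def)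
  have B: "integrable (M \<Otimes>\<^sub>M M) (case_prod B)"
    by (rule Bochner_Integration.integrable_bound[OF fg]) (auto simp: B_def)
  have sub: "f absolutely_integrable_on {0..s}" "g absolutely_integrable_on {0..s}"
    if "s \<in> {0..x}" for s
    using that f g by (auto intro: absolutely_integrable_on_subinterval)
  have conv: "(\<integral>t. h t \<partial>M) = integral {0..x} h" if "integrable M h" for h :: "real \<Rightarrow> 'a"
    using that unfolding M_def by (rule lebesgue_integral_eq_integral) simp
  have cut: "(\<integral>t. (if t \<le> s then h t else 0) \<partial>M) = integral {0..s} h"
    if h: "integrable M h" and s: "s \<in> {0..x}" for h :: "real \<Rightarrow> 'a" and s
  proof -
    note [measurable] = borel_measurable_integrable[OF h]
    have "integrable M (\<lambda>t. if t \<le> s then h t else 0)"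
      by (rule Bochner_Integration.integrable_bound[OF h]) auto
    then have "(\<integral>t. (if t \<le> s then h t else 0) \<partial>M) = integral {0..x} (\<lambda>t. if t \<le> s then h t else 0)"
      by (rule conv)
    also have "\<dots> = integral {0..x} (\<lambda>t. if t \<in> {0..s} then h t else 0)"
      by (rule integral_cong) auto
    also have "\<dots> = integral ({0..s} \<inter> {0..x}) h"
      by (metis Int_commute integral_restrict_Int)
    also have "{0..s} \<inter> {0..x} = {0..s}" using s by auto
    finally show ?thesis .
  qed
  have null: "AE t in M. t \<noteq> s" for s
  proof -
    have "{s} \<in> null_sets lebesgue"
      by (rule null_sets_completionI) (auto intro: finite_imp_null_set_lborel)
    then have "AE t in lebesgue. t \<in> {0..x} \<longrightarrow> t \<noteq> s"
      by (rule AE_I') auto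
    then show ?thesis
      by (subst M_def, subst AE_restrict_space_iff) auto
  qed
  have intA: "(\<integral>s. (\<integral>t. A s t \<partial>M) \<partial>M) = integral {0..x} (\<lambda>s. f s * integral {0..s} g)"
  proof -
    have eq: "(\<integral>t. A s t \<partial>M) = f s * integral {0..s} g" if "s \<in> {0..x}" for s
    proof -
      have "(\<integral>t. A s t \<partial>M) = (\<integral>t. f s * (if t \<le> s then g t else 0) \<partial>M)"
        by (intro Bochner_Integration.integral_cong) (auto simp: A_def)
      also have "\<dots> = f s * (\<integral>t. (if t \<le> s then g t else 0) \<partial>M)"
        by (rule integral_mult_right_zero)
      finally show ?thesis using cut[OF gM that] by simp
    qed
    have "integrable M (\<lambda>s. \<integral>t. A s t \<partial>M)" by (rule integrable_fst[OF A])
    then have "(\<integral>s. (\<integral>t. A s t \<partial>M) \<partial>M) = integral {0..x} (\<lambda>s. \<integral>t. A s t \<partial>M)" by (rule conv)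
    also have "\<dots> = integral {0..x} (\<lambda>s. f s * integral {0..s} g)"
      by (rule integral_cong) (use eq in auto)
    finally show ?thesis .
  qed
  have intB: "(\<integral>t. (\<integral>s. B s t \<partial>M) \<partial>M) = integral {0..x} (\<lambda>t. integral {0..t} f * g t)"
  proof -
    have eq: "(\<integral>s. B s t \<partial>M) = integral {0..t} f * g t" if "t \<in> {0..x}" for t
    proof -
      have "(\<integral>s. B s t \<partial>M) = (\<integral>s. (if s \<le> t then f s else 0) * g t \<partial>M)"
      proof (rule integral_cong_AE)
        show "AE s in M. B s t = (if s \<le> t then f s else 0) * g t"
          using null[of t] by eventually_elim (auto simp: B_def)
      qed (auto simp: B_def)
      also have "\<dots> = (\<integral>s. (if s \<le> t then f s else 0) \<partial>M) * g t"
        by (rule integral_mult_left_zero)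
      finally show ?thesis using cut[OF fM that] by simp
    qed
    have "integrable M (\<lambda>t. \<integral>s. B s t \<partial>M)" by (rule integrable_snd[OF B])
    then have "(\<integral>t. (\<integral>s. B s t \<partial>M) \<partial>M) = integral {0..x} (\<lambda>t. \<integral>s. B s t \<partial>M)" by (rule conv)
    also have "\<dots> = integral {0..x} (\<lambda>t. integral {0..t} f * g t)"
      by (rule integral_cong) (use eq in auto)
    finally show ?thesis .
  qed
  have "integral\<^sup>L (M \<Otimes>\<^sub>M M) (case_prod A) + integral\<^sup>L (M \<Otimes>\<^sub>M M) (case_prod B)
     = integral\<^sup>L (M \<Otimes>\<^sub>M M) (\<lambda>(s, t). f s * g t)"
    by (subst Bochner_Integration.integral_add[OF A B, symmetric])
       (auto simp: A_def B_def intro!: Bochner_Integration.integral_cong)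
  also have "\<dots> = (\<integral>s. (\<integral>t. f s * g t \<partial>M) \<partial>M)"
    by (rule integral_fst[OF fg, symmetric])
  also have "\<dots> = integral {0..x} f * integral {0..x} g"
    using conv[OF fM] conv[OF gM] by simp
  finally show ?thesis
    using intA intB integral_fst[OF A] integral_snd[OF B] by simp
qed

text \<open>Absolute continuity in the sense of Caratheodory solutions: \<open>F\<close> is an indefinite integral of \<open>f\<close>,
  and \<open>f\<close> is determined only almost everywhere.\<close>

definition primitive_on :: "real \<Rightarrow> (real \<Rightarrow> 'a::euclidean_space) \<Rightarrow> (real \<Rightarrow> 'a) \<Rightarrow> bool" where
  "primitive_on L F f \<longleftrightarrow>
     f absolutely_integrable_on {0..L} \<and> (\<forall>x\<in>{0..L}. F x = F 0 + integral {0..x} f)"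

lemma primitive_onD:
  assumes "primitive_on L F f" "x \<in> {0..L}"
  shows "F x = F 0 + integral {0..x} f"
  using assms unfolding primitive_on_def by blast

lemma absolutely_integrable_mult_continuous:
  fixes f :: "real \<Rightarrow> 'a :: {euclidean_space, real_normed_field}"
  assumes "f absolutely_integrable_on {a..b}" "continuous_on {a..b} k"
  shows "(\<lambda>x. f x * k x) absolutely_integrable_on {a..b}" "(\<lambda>x. k x * f x) absolutely_integrable_on {a..b}"
proof -
  have "bounded (k ` {a..b})"
    using assms(2) compact_continuous_image compact_imp_bounded by blast
  moreover have "bilinear (\<lambda>(x::'a) y. x * y)"
    by (simp add: bilinear_conv_bounded_bilinear bounded_bilinear_mult)
  ultimately show "(\<lambda>x. k x * f x) absolutely_integrable_on {a..b}"
    using absolutely_integrable_bounded_measurable_product[of "(\<lambda>x y. x * y)" k "{a..b}" f] assms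
    by (simp add: continuous_imp_measurable_on_sets_lebesgue)
  then show "(\<lambda>x. f x * k x) absolutely_integrable_on {a..b}"
    by (simp add: mult.commute)
qed

lemmas integrable_if_absolutely = set_lebesgue_integral_eq_integral(1)

lemmas integrable_mult_continuous = integrable_if_absolutely[OF absolutely_integrable_mult_continuous(1)]

lemma primitive_on_continuous:
  assumes "primitive_on L F f"
  shows "continuous_on {0..L} F"
proof -
  have "f integrable_on {0..L}"
    using assms unfolding primitive_on_def by (blast dest: integrable_if_absolutely)
  then have "continuous_on {0..L} (\<lambda>x. F 0 + integral {0..x} f)"
    by (intro continuous_intros indefinite_integral_continuous_1)
  then show ?thesis
    by (rule continuous_on_eq) (rule primitive_onD[OF assms, symmetric])
qed

lemma primitive_on_integrable:
  fixes F f :: "real \<Rightarrow> 'a::euclidean_space"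
  assumes "primitive_on L F f" "x \<le> L"
  shows "f absolutely_integrable_on {0..x}" "f integrable_on {0..x}"
proof -
  show "f absolutely_integrable_on {0..x}"
    using assms absolutely_integrable_on_subinterval[where f = f and S = "{0..L}"]
    unfolding primitive_on_def by auto
  then show "f integrable_on {0..x}" by (rule integrable_if_absolutely)
qed

lemma primitive_on_mult:
  fixes f g :: "real \<Rightarrow> 'a :: {euclidean_space, real_normed_field}"
  assumes F: "primitive_on L F f" and G: "primitive_on L G g"
  shows "primitive_on L (\<lambda>x. F x * G x) (\<lambda>x. f x * G x + F x * g x)"
  unfolding primitive_on_def
proof (intro conjI ballI)
  have c: "continuous_on {0..L} F" "continuous_on {0..L} G"
    using F G by (auto intro: primitive_on_continuous)
  show "(\<lambda>x. f x * G x + F x * g x) absolutely_integrable_on {0..L}"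
    using F G c by (intro set_integral_add absolutely_integrable_mult_continuous)
      (unfold primitive_on_def, blast+)
  fix x assume x: "x \<in> {0..L}"
  then have "x \<le> L" by simp
  note fi = primitive_on_integrable[OF F this] and gi = primitive_on_integrable[OF G this]
  have cx: "continuous_on {0..x} (\<lambda>s. integral {0..s} f)" "continuous_on {0..x} (\<lambda>s. integral {0..s} g)"
    by (rule indefinite_integral_continuous_1[OF fi(2)], rule indefinite_integral_continuous_1[OF gi(2)])
  have eqF: "F s = F 0 + integral {0..s} f" and eqG: "G s = G 0 + integral {0..s} g" if "s \<in> {0..x}" for s
    using primitive_onD[OF F, of s] primitive_onD[OF G, of s] x that by auto
  have i1: "(\<lambda>s. f s * integral {0..s} g) integrable_on {0..x}" "(\<lambda>s. integral {0..s} f * g s) integrable_on {0..x}"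
    by (rule integrable_if_absolutely absolutely_integrable_mult_continuous fi gi cx)+
  have "integral {0..x} (\<lambda>s. f s * G s + F s * g s)
      = integral {0..x} (\<lambda>s. (f s * G 0 + F 0 * g s) + (f s * integral {0..s} g + integral {0..s} f * g s))"
  proof (rule integral_cong)
    fix s assume s: "s \<in> {0..x}"
    have "f s * (G 0 + integral {0..s} g) + (F 0 + integral {0..s} f) * g s
      = (f s * G 0 + F 0 * g s) + (f s * integral {0..s} g + integral {0..s} f * g s)"
      by (simp only: algebra_simps)
    then show "f s * G s + F s * g s
      = (f s * G 0 + F 0 * g s) + (f s * integral {0..s} g + integral {0..s} f * g s)"
      unfolding eqF[OF s, symmetric] eqG[OF s, symmetric] .
  qed
  also have "\<dots> = integral {0..x} f * G 0 + F 0 * integral {0..x} g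
      + (integral {0..x} (\<lambda>s. f s * integral {0..s} g) + integral {0..x} (\<lambda>s. integral {0..s} f * g s))"
    by (simp only: integral_add integrable_add integrable_on_mult_right
        integrable_on_mult_left fi(2) gi(2) i1 integral_mult_left integral_mult_right)
  also have "\<dots> = integral {0..x} f * G 0 + F 0 * integral {0..x} g + integral {0..x} f * integral {0..x} g"
    using lebesgue_triangle_swap[OF fi(1) gi(1)] by simp
  finally have int: "integral {0..x} (\<lambda>s. f s * G s + F s * g s) = integral {0..x} f * G 0 +
     F 0 * integral {0..x} g + integral {0..x} f * integral {0..x} g" .
  have "(F 0 + integral {0..x} f) * (G 0 + integral {0..x} g)
     = F 0 * G 0 + integral {0..x} (\<lambda>x. f x * G x + F x * g x)"
    unfolding int by (simp only: algebra_simps)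
  then show "F x * G x = F 0 * G 0 + integral {0..x} (\<lambda>x. f x * G x + F x * g x)"
    unfolding primitive_onD[OF F x, symmetric] primitive_onD[OF G x, symmetric] .
qed

lemma primitive_on_cong:
  assumes "primitive_on L F f" "\<And>x. x \<in> {0..L} \<Longrightarrow> F x = G x" "\<And>x. x \<in> {0..L} \<Longrightarrow> f x = g x" "0 \<le> L"
  shows "primitive_on L G g"
  unfolding primitive_on_def
proof (intro conjI ballI)
  show "g absolutely_integrable_on {0..L}"
    using assms(1,3) absolutely_integrable_spike[where f=f and g=g and S="{}" and T="{0..L}"] by (auto simp: primitive_on_def)
  fix x assume x: "x \<in> {0..L}"
  have "integral {0..x} g = integral {0..x} f"
    by (rule integral_cong) (use assms(3) x in auto)
  then show "G x = G 0 + integral {0..x} g"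
    using primitive_onD[OF assms(1) x] assms(2)[OF x] assms(2)[of 0] assms(4) by simp
qed

text \<open>Derivatives may be altered on null sets; this is how an equation that holds almost everywhere
  becomes a statement about primitives.\<close>

lemma primitive_on_spike:
  assumes "primitive_on L F f" "negligible N" "\<And>x. x \<in> {0..L} - N \<Longrightarrow> g x = f x"
  shows "primitive_on L F g"
  unfolding primitive_on_def
proof (intro conjI ballI)
  show "g absolutely_integrable_on {0..L}"
    using assms absolutely_integrable_spike[where f=f and g=g and S=N and T="{0..L}"] by (auto simp: primitive_on_def)
  fix x assume x: "x \<in> {0..L}"
  have "integral {0..x} f = integral {0..x} g"
    by (rule integral_spike[OF assms(2)]) (use assms(3) x in auto)
  then show "F x = F 0 + integral {0..x} g"
    using primitive_onD[OF assms(1) x] by simp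
qed

lemma primitive_on_const: "primitive_on L (\<lambda>x. c) (\<lambda>x. 0)"
  by (simp add: primitive_on_def set_integrable_def)

lemma primitive_on_indefinite_integral:
  fixes f :: "real \<Rightarrow> 'a::euclidean_space"
  assumes "f absolutely_integrable_on {0..L}"
  shows "primitive_on L (\<lambda>x. integral {0..x} f) f"
  using assms by (simp add: primitive_on_def)

lemma primitive_on_bounded_linear:
  fixes f :: "real \<Rightarrow> 'a::euclidean_space" and h :: "'a \<Rightarrow> 'b::euclidean_space"
  assumes "primitive_on L F f" "bounded_linear h"
  shows "primitive_on L (\<lambda>x. h (F x)) (\<lambda>x. h (f x))"
  unfolding primitive_on_def
proof (intro conjI ballI)
  show "(\<lambda>x. h (f x)) absolutely_integrable_on {0..L}"
    using absolutely_integrable_linear[OF _ assms(2)] assms(1) unfolding primitive_on_def o_def by blast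
  fix x assume x: "x \<in> {0..L}"
  have "integral {0..x} (\<lambda>x. h (f x)) = h (integral {0..x} f)"
    using integral_linear[OF primitive_on_integrable(2)[OF assms(1)] assms(2), of x] x by (simp add: o_def)
  then show "h (F x) = h (F 0) + integral {0..x} (\<lambda>x. h (f x))"
    using arg_cong[OF primitive_onD[OF assms(1) x], of h] by (simp add: linear_add[OF bounded_linear.linear[OF assms(2)]])
qed

lemma primitive_on_add:
  assumes "primitive_on L F f" "primitive_on L G g"
  shows "primitive_on L (\<lambda>x. F x + G x) (\<lambda>x. f x + g x)"
  unfolding primitive_on_def
proof (intro conjI ballI)
  show "(\<lambda>x. f x + g x) absolutely_integrable_on {0..L}"
    using assms unfolding primitive_on_def by (blast intro: set_integral_add)
  fix x assume x: "x \<in> {0..L}"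
  have "integral {0..x} (\<lambda>x. f x + g x) = integral {0..x} f + integral {0..x} g"
    using primitive_on_integrable(2)[OF assms(1)] primitive_on_integrable(2)[OF assms(2)] x
    by (intro integral_add) auto
  then show "F x + G x = F 0 + G 0 + integral {0..x} (\<lambda>x. f x + g x)"
    using primitive_onD[OF assms(1) x] primitive_onD[OF assms(2) x] by simp
qed

lemma primitive_on_cmult:
  fixes f :: "real \<Rightarrow> 'a :: {euclidean_space, real_normed_field}"
  assumes "primitive_on L F f"
  shows "primitive_on L (\<lambda>x. c * F x) (\<lambda>x. c * f x)"
  using primitive_on_bounded_linear[OF assms bounded_linear_mult_right] .

lemma primitive_on_diff:
  fixes f :: "real \<Rightarrow> 'a :: {euclidean_space, real_normed_field}"
  assumes "primitive_on L F f" "primitive_on L G g"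
  shows "primitive_on L (\<lambda>x. F x - G x) (\<lambda>x. f x - g x)"
  using primitive_on_add[OF assms(1) primitive_on_cmult[OF assms(2), of "-1"]] by simp

lemma primitive_on_norm_le:
  assumes "primitive_on L F f" "x \<in> {0..L}" "g integrable_on {0..x}"
    "\<And>t. t \<in> {0..x} \<Longrightarrow> norm (f t) \<le> g t"
  shows "norm (F x) \<le> norm (F 0) + integral {0..x} g" "norm (F x - F 0) \<le> integral {0..x} g"
proof -
  have i: "norm (integral {0..x} f) \<le> integral {0..x} g"
    using assms primitive_on_integrable(2)[OF assms(1), of x]
    by (intro integral_norm_bound_integral) auto
  moreover have "norm (F x) = norm (F 0 + integral {0..x} f)"
    by (rule arg_cong[OF primitive_onD[OF assms(1,2)]])
  ultimately show "norm (F x) \<le> norm (F 0) + integral {0..x} g"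
    using norm_triangle_ineq[of "F 0" "integral {0..x} f"] by linarith
  have "F x - F 0 = integral {0..x} f"
    using primitive_onD[OF assms(1,2)] by (metis add_diff_cancel_left')
  with i show "norm (F x - F 0) \<le> integral {0..x} g" by simp
qed

section \<open>Iterated integrals and Gronwall's inequality\<close>

text \<open>The derivative of \<open>W ^ (k + 1) / (k + 1)!\<close> is \<open>w * W ^ k / k!\<close>, although \<open>W\<close> is only absolutely
  continuous: by induction with the product rule.  Iterated integrals against an integrable weight
  therefore gain the same factorials as those against a constant.\<close>

lemma primitive_on_power_fact:
  fixes w :: "real \<Rightarrow> real"
  assumes "w absolutely_integrable_on {0..L}" "0 \<le> L"
  defines "W \<equiv> \<lambda>x. integral {0..x} w"
  shows "primitive_on L (\<lambda>x. W x ^ Suc k / fact (Suc k)) (\<lambda>x. w x * (W x ^ k / fact k))"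
proof (induction k)
  case 0
  then show ?case using primitive_on_indefinite_integral[OF assms(1)] by (simp add: W_def)
next
  case (Suc k)
  have "primitive_on L W w"
    using primitive_on_indefinite_integral[OF assms(1)] by (simp add: W_def)
  from primitive_on_cmult[OF primitive_on_mult[OF Suc this], of "1 / real (Suc (Suc k))"]
  show ?case
  proof (rule primitive_on_cong)
    fix x
    show "1 / real (Suc (Suc k)) * (W x ^ Suc k / fact (Suc k) * W x) = W x ^ Suc (Suc k) / fact (Suc (Suc k))"
      by (simp add: field_simps)
    have "W x ^ k / fact k * W x = real (Suc k) * (W x ^ Suc k / fact (Suc k))"
      by (simp del: of_nat_Suc)
    moreover have "w x * A * W x + Q * w x = real (Suc (Suc k)) * (w x * Q)"
      if "A * W x = real (Suc k) * Q" for A Q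
      using that by (simp add: mult.assoc) (simp add: algebra_simps)
    ultimately have "w x * (W x ^ k / fact k) * W x + W x ^ Suc k / fact (Suc k) * w x
       = real (Suc (Suc k)) * (w x * (W x ^ Suc k / fact (Suc k)))"
      by blast
    then show "1 / real (Suc (Suc k)) * (w x * (W x ^ k / fact k) * W x + W x ^ Suc k / fact (Suc k) * w x)
       = w x * (W x ^ Suc k / fact (Suc k))"
      by simp
  qed (use assms in auto)
qed

lemma integral_power_fact:
  fixes w :: "real \<Rightarrow> real"
  assumes "w absolutely_integrable_on {0..L}" "x \<in> {0..L}"
  shows "((\<lambda>t. w t * (integral {0..t} w ^ k / fact k)) has_integral integral {0..x} w ^ Suc k / fact (Suc k)) {0..x}"
proof -
  have P: "primitive_on L (\<lambda>x. integral {0..x} w ^ Suc k / fact (Suc k)) (\<lambda>x. w x * (integral {0..x} w ^ k / fact k))"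
    using assms by (intro primitive_on_power_fact) auto
  show ?thesis
    using primitive_onD[OF P assms(2)] primitive_on_integrable(2)[OF P, of x] assms(2)
    by (simp add: has_integral_integral)
qed

text \<open>The common core of Gronwall's inequality and of the convergence of Picard's iteration.\<close>

lemma iterated_integral_bound:
  fixes w :: "real \<Rightarrow> real" and e :: "nat \<Rightarrow> real \<Rightarrow> real"
  assumes w: "w absolutely_integrable_on {0..L}" "\<And>x. x \<in> {0..L} \<Longrightarrow> 0 \<le> w x"
    and cont: "\<And>k. continuous_on {0..L} (e k)"
    and e0: "\<And>x. x \<in> {0..L} \<Longrightarrow> e 0 x \<le> C"
    and eSuc: "\<And>k x. x \<in> {0..L} \<Longrightarrow> e (Suc k) x \<le> integral {0..x} (\<lambda>t. w t * e k t)"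
    and x: "x \<in> {0..L}"
  shows "e k x \<le> C * (integral {0..x} w ^ k / fact k)"
  using x
proof (induction k arbitrary: x)
  case 0
  then show ?case using e0 by simp
next
  case (Suc k)
  have "e (Suc k) x \<le> integral {0..x} (\<lambda>t. w t * e k t)"
    by (rule eSuc[OF Suc.prems])
  also have "\<dots> \<le> integral {0..x} (\<lambda>t. C * (w t * (integral {0..t} w ^ k / fact k)))"
  proof (rule integral_le)
    have "w absolutely_integrable_on {0..x}" "continuous_on {0..x} (e k)"
      using w(1) cont[of k] Suc.prems absolutely_integrable_on_subinterval[where f = w and S = "{0..L}"]
      by (auto intro: continuous_on_subset)
    then show "(\<lambda>t. w t * e k t) integrable_on {0..x}"
      by (intro integrable_if_absolutely absolutely_integrable_mult_continuous)
    show "(\<lambda>t. C * (w t * (integral {0..t} w ^ k / fact k))) integrable_on {0..x}"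
      using integral_power_fact[OF w(1) Suc.prems, of k] by (intro integrable_on_mult_right) (auto simp: integrable_on_def)
    fix t assume t: "t \<in> {0..x}"
    have "w t * e k t \<le> w t * (C * (integral {0..t} w ^ k / fact k))"
      using t Suc w(2) by (intro mult_left_mono) auto
    then show "w t * e k t \<le> C * (w t * (integral {0..t} w ^ k / fact k))"
      by (simp only: mult_ac)
  qed
  also have "\<dots> = C * (integral {0..x} w ^ Suc k / fact (Suc k))"
    using has_integral_mult_right[OF integral_power_fact[OF w(1) Suc.prems, of k], of C]
    by (rule integral_unique)
  finally show ?case .
qed

lemma power_over_fact_tendsto_0: "(\<lambda>k. C * ((r::real) ^ k / fact k)) \<longlonglongrightarrow> 0"
  using tendsto_mult[OF tendsto_const[of C] summable_LIMSEQ_zero[OF summable_exp[of r]]]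
  by (simp add: field_simps)

lemma continuous_on_upper_bound:
  fixes d :: "real \<Rightarrow> real"
  assumes "continuous_on {a..b} d"
  obtains C where "\<And>x. x \<in> {a..b} \<Longrightarrow> d x \<le> C"
proof -
  have "bounded (d ` {a..b})"
    using assms compact_continuous_image compact_imp_bounded by blast
  then obtain C where "\<forall>y\<in>d ` {a..b}. norm y \<le> C" by (auto simp: bounded_iff)
  then show ?thesis by (intro that[of C]) (fastforce simp: abs_le_iff)
qed

text \<open>Subtracting from \<open>F\<close> the first \<open>k\<close> terms of the series of \<open>A * exp W\<close> leaves a sequence of functions
  each of which is bounded by the integral of \<open>w\<close> times its predecessor, hence by \<open>C * W ^ k / k!\<close>.\<close>

lemma gronwall:
  fixes w :: "real \<Rightarrow> real" and F :: "real \<Rightarrow> real"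
  assumes w: "w absolutely_integrable_on {0..L}" "\<And>x. x \<in> {0..L} \<Longrightarrow> 0 \<le> w x"
    and cont: "continuous_on {0..L} F" and A: "0 \<le> A"
    and le: "\<And>x. x \<in> {0..L} \<Longrightarrow> F x \<le> A + integral {0..x} (\<lambda>t. w t * F t)"
    and x: "x \<in> {0..L}"
  shows "F x \<le> A * exp (integral {0..L} w)"
proof -
  define W where "W = (\<lambda>x. integral {0..x} w)"
  have wsub: "w absolutely_integrable_on {0..y}" if "y \<in> {0..L}" for y
    using that w(1) absolutely_integrable_on_subinterval[where f = w and S = "{0..L}"] by auto
  have W0: "0 \<le> W y" if "y \<in> {0..L}" for y
    unfolding W_def using that w(2) wsub[OF that]
    by (intro integral_nonneg integrable_if_absolutely) auto
  define S where "S = (\<lambda>k y. \<Sum>j<k. W y ^ j / fact j)"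
  define e where "e = (\<lambda>k y. F y - A * S k y)"
  have contW: "continuous_on {0..L} W"
    unfolding W_def by (intro indefinite_integral_continuous_1 integrable_if_absolutely w)
  have cS: "continuous_on {0..L} (S k)" for k
    unfolding S_def by (intro continuous_intros contW) auto
  have cont_e: "continuous_on {0..L} (e k)" for k
    unfolding e_def by (intro continuous_intros cont cS)
  obtain C where C: "\<And>x. x \<in> {0..L} \<Longrightarrow> F x \<le> C"
    using continuous_on_upper_bound[OF cont] by blast
  have hS: "((\<lambda>t. w t * S k t) has_integral (S (Suc k) y - 1)) {0..y}" if y: "y \<in> {0..L}" for k y
  proof -
    have "((\<lambda>t. \<Sum>j<k. w t * (W t ^ j / fact j)) has_integral (\<Sum>j<k. W y ^ Suc j / fact (Suc j))) {0..y}"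
      unfolding W_def by (intro has_integral_sum integral_power_fact[OF w(1) y]) auto
    moreover have "S (Suc k) y - 1 = (\<Sum>j<k. W y ^ Suc j / fact (Suc j))"
      unfolding S_def by (subst sum.lessThan_Suc_shift) simp
    ultimately show ?thesis
      by (simp add: S_def sum_distrib_left)
  qed
  have "e k x \<le> C * (integral {0..x} w ^ k / fact k)" for k
  proof (rule iterated_integral_bound[OF w cont_e])
    fix k y assume y: "y \<in> {0..L}"
    have wF: "(\<lambda>t. w t * F t) integrable_on {0..y}"
      using wsub[OF y] continuous_on_subset[OF cont, of "{0..y}"] y
      by (intro integrable_if_absolutely absolutely_integrable_mult_continuous) auto
    have "e (Suc k) y \<le> integral {0..y} (\<lambda>t. w t * F t) - A * (S (Suc k) y - 1)"
      using le[OF y] by (simp add: e_def algebra_simps)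
    also have "\<dots> = integral {0..y} (\<lambda>t. w t * F t - A * (w t * S k t))"
      using integral_unique[OF has_integral_diff[OF integrable_integral[OF wF] has_integral_mult_right[OF hS[OF y, of k], of A]]]
      by simp
    also have "\<dots> = integral {0..y} (\<lambda>t. w t * e k t)"
      by (rule integral_cong) (simp add: e_def algebra_simps)
    finally show "e (Suc k) y \<le> integral {0..y} (\<lambda>t. w t * e k t)" .
  qed (use C x in \<open>auto simp: e_def S_def\<close>)
  moreover have "A * S k x \<le> A * exp (W x)" for k
  proof -
    have "S k x \<le> (\<Sum>j. W x ^ j / fact j)"
      unfolding S_def using W0[OF x] summable_exp[of "W x"]
      by (intro sum_le_suminf) (auto simp: field_simps)
    also have "\<dots> = exp (W x)" by (simp add: exp_def field_simps)
    finally show ?thesis using A by (rule mult_left_mono)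
  qed
  ultimately have "F x - A * exp (W x) \<le> C * (integral {0..x} w ^ k / fact k)" for k
    unfolding e_def by (smt (verit, ccfv_SIG))
  then have "F x - A * exp (W x) \<le> 0"
    using power_over_fact_tendsto_0[of C "integral {0..x} w"] by (intro LIMSEQ_le_const) auto
  moreover have "W x \<le> W L"
    unfolding W_def using wsub[OF x] w x
    by (intro integral_subset_le integrable_if_absolutely) auto
  then have "A * exp (W x) \<le> A * exp (W L)"
    using A by (intro mult_left_mono) auto
  ultimately show ?thesis by (simp add: W_def)
qed

section \<open>Dirac systems in the upper half-plane\<close>

lemma absolutely_integrable_norm_sub:
  fixes f :: "real \<Rightarrow> 'a::euclidean_space"
  assumes "f absolutely_integrable_on {0..L}" "0 \<le> x" "y \<le> L"
  shows "f absolutely_integrable_on {x..y}" "f integrable_on {x..y}" "(\<lambda>t. norm (f t)) integrable_on {x..y}"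
proof -
  show "f absolutely_integrable_on {x..y}"
    using assms absolutely_integrable_on_subinterval[where f = f and S = "{0..L}"] by auto
  then show "f integrable_on {x..y}" "(\<lambda>t. norm (f t)) integrable_on {x..y}"
    by (auto simp: absolutely_integrable_on_def)
qed

lemma absolutely_integrable_cmod:
  fixes f :: "'b::euclidean_space \<Rightarrow> 'a::euclidean_space"
  assumes "f absolutely_integrable_on A"
  shows "(\<lambda>x. norm (f x)) absolutely_integrable_on A"
  using absolutely_integrable_norm[OF assms] by (simp add: o_def)

text \<open>The integral of \<open>w * (s - k)\<^sup>2\<close> is a quadratic polynomial in \<open>s\<close> without negative values.\<close>

lemma cauchy_schwarz_weighted:
  fixes w k :: "real \<Rightarrow> real"
  assumes w: "w absolutely_integrable_on {a..b}" "\<And>x. x \<in> {a..b} \<Longrightarrow> 0 \<le> w x"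
    and k: "continuous_on {a..b} k"
  shows "(integral {a..b} (\<lambda>x. w x * k x))\<^sup>2 \<le> integral {a..b} w * integral {a..b} (\<lambda>x. w x * (k x)\<^sup>2)"
proof -
  define A B C where "A = integral {a..b} w" and "B = integral {a..b} (\<lambda>x. w x * k x)"
    and "C = integral {a..b} (\<lambda>x. w x * (k x)\<^sup>2)"
  have i: "w integrable_on {a..b}" "(\<lambda>x. w x * k x) integrable_on {a..b}" "(\<lambda>x. w x * (k x)\<^sup>2) integrable_on {a..b}"
    by (intro integrable_if_absolutely[OF w(1)] integrable_mult_continuous[OF w(1)] continuous_intros k)+
  \<comment> \<open>The choice \<open>s = B / A\<close> minimises this; if \<open>A = 0\<close>, the coefficient \<open>B\<close> must vanish as well.\<close>
  have q: "0 \<le> A * s\<^sup>2 - 2 * s * B + C" for s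
  proof -
    have "((\<lambda>x. s\<^sup>2 * w x - 2 * s * (w x * k x) + w x * (k x)\<^sup>2) has_integral (s\<^sup>2 * A - 2 * s * B + C)) {a..b}"
      unfolding A_def B_def C_def
      by (intro has_integral_add has_integral_diff has_integral_mult_right integrable_integral i)
    moreover have "0 \<le> s\<^sup>2 * w x - 2 * s * (w x * k x) + w x * (k x)\<^sup>2" if "x \<in> {a..b}" for x
    proof -
      have "s\<^sup>2 * w x - 2 * s * (w x * k x) + w x * (k x)\<^sup>2 = w x * (s - k x)\<^sup>2"
        by (simp add: power2_eq_square algebra_simps)
      then show ?thesis using w(2)[OF that] by simp
    qed
    ultimately have "0 \<le> s\<^sup>2 * A - 2 * s * B + C" by (rule has_integral_nonneg)
    then show ?thesis by (simp add: mult.commute)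
  qed
  have A0: "0 \<le> A" unfolding A_def using w(2) by (intro integral_nonneg i) auto
  show ?thesis
  proof (cases "A = 0")
    case True
    have "B = 0"
    proof (rule ccontr)
      assume "B \<noteq> 0"
      then show False using q[of "(C + 1) / (2 * B)"] True by (simp add: field_simps)
    qed
    then show ?thesis using True by (simp add: A_def B_def)
  next
    case False
    then have "0 < A" using A0 by simp
    with q[of "B / A"] have "0 \<le> A * (A * (B / A)\<^sup>2 - 2 * (B / A) * B + C)" by simp
    also have "\<dots> = A * C - B\<^sup>2" using \<open>0 < A\<close> by (simp add: field_simps power2_eq_square)
    finally show ?thesis by (simp add: A_def B_def C_def)
  qed
qed

text \<open>The weight \<open>\<rho>\<close> is the derivative of \<open>\<mu>\<close> off a finite set, which admits the jump of a step function.
  The function \<open>\<mu>\<close> is the phase: with zero potential the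
  solutions are multiples of \<open>exp (\<plusminus> \<i> * lam * \<mu> x)\<close>.\<close>

locale phase =
  fixes L :: real and \<rho> \<mu> :: "real \<Rightarrow> real" and S :: "real set" and \<rho>0 :: real
  assumes L_pos: "0 < L" and mu_0: "\<mu> 0 = 0"
    and mu_cont: "continuous_on {0..L} \<mu>" and fin_S: "finite S"
    and mu_deriv: "\<And>x. x \<in> {0<..<L} - S \<Longrightarrow> (\<mu> has_real_derivative \<rho> x) (at x)"
    and rho0_pos: "0 < \<rho>0" and rho_ge: "\<And>x. x \<in> {0..L} \<Longrightarrow> \<rho>0 \<le> \<rho> x"
begin

abbreviation L1 :: "(real \<Rightarrow> 'a::euclidean_space) \<Rightarrow> bool" where
  "L1 h \<equiv> h absolutely_integrable_on {0..L}"

definition E :: "complex \<Rightarrow> real \<Rightarrow> complex" where "E c x = exp (c * of_real (\<mu> x))"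

lemma E_0 [simp]: "E c 0 = 1" by (simp add: E_def mu_0)

lemma E_mult: "E c x * E d x = E (c + d) x"
  by (simp add: E_def exp_add ring_distribs)

lemma E_continuous: "continuous_on {0..L} (E c)"
  unfolding E_def by (intro continuous_intros mu_cont)

lemma norm_E: "cmod (E c x) = exp (Re c * \<mu> x)"
  by (simp add: E_def norm_exp_eq_Re)

lemma rho_pos: "x \<in> {0..L} \<Longrightarrow> 0 < \<rho> x"
  using rho_ge[of x] rho0_pos by linarith

lemma has_integral_rho:
  assumes "0 \<le> x" "x \<le> y" "y \<le> L"
  shows "(\<rho> has_integral (\<mu> y - \<mu> x)) {x..y}"
proof (rule fundamental_theorem_of_calculus_interior_strong[OF fin_S assms(2)])
  show "continuous_on {x..y} \<mu>" using assms by (intro continuous_on_subset[OF mu_cont]) auto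
  show "\<And>t. t \<in> {x<..<y} - S \<Longrightarrow> (\<mu> has_vector_derivative \<rho> t) (at t)"
    using mu_deriv assms by (auto simp: has_real_derivative_iff_has_vector_derivative[symmetric])
qed

lemma rho_absolutely_integrable: "L1 \<rho>"
  using has_integral_rho[of 0 L] L_pos rho_pos
  by (intro nonnegative_absolutely_integrable_1) (auto simp: integrable_on_def less_imp_le)

lemma mu_mono:
  assumes "0 \<le> x" "x \<le> y" "y \<le> L"
  shows "\<mu> x + \<rho>0 * (y - x) \<le> \<mu> y"
proof -
  have "((\<lambda>t. \<rho>0) has_integral \<rho>0 * (y - x)) {x..y}"
    using has_integral_const_real[of \<rho>0 x y] assms by (simp add: mult.commute)
  then have "\<rho>0 * (y - x) \<le> \<mu> y - \<mu> x"
    by (rule has_integral_le[OF _ has_integral_rho[OF assms]]) (use assms rho_ge in auto)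
  then show ?thesis by simp
qed

lemma mu_nonneg: "x \<in> {0..L} \<Longrightarrow> 0 \<le> \<mu> x"
  using mu_mono[of 0 x] mu_0 mult_nonneg_nonneg[OF less_imp_le[OF rho0_pos], of x] by simp

lemma mu_le: "0 \<le> x \<Longrightarrow> x \<le> y \<Longrightarrow> y \<le> L \<Longrightarrow> \<mu> x \<le> \<mu> y"
  using mu_mono[of x y] mult_nonneg_nonneg[OF less_imp_le[OF rho0_pos], of "y - x"] by simp

lemma mu_L_pos: "0 < \<mu> L"
  using mu_mono[of 0 L] L_pos mu_0 mult_pos_pos[OF rho0_pos L_pos] by auto

lemma primitive_on_E: "primitive_on L (E c) (\<lambda>x. c * of_real (\<rho> x) * E c x)"
  unfolding primitive_on_def
proof (intro conjI ballI)
  have "L1 (\<lambda>x. complex_of_real (\<rho> x))"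
    using absolutely_integrable_linear[OF rho_absolutely_integrable bounded_linear_of_real] by (simp add: o_def)
  then have "L1 (\<lambda>x. complex_of_real (\<rho> x) * (c * E c x))"
    by (intro absolutely_integrable_mult_continuous continuous_intros E_continuous)
  then show "L1 (\<lambda>x. c * of_real (\<rho> x) * E c x)"
    by (simp add: ac_simps)
  fix x assume x: "x \<in> {0..L}"
  have "((\<lambda>x. c * of_real (\<rho> x) * E c x) has_integral (E c x - E c 0)) {0..x}"
  proof (rule fundamental_theorem_of_calculus_interior_strong[OF fin_S])
    show "continuous_on {0..x} (E c)" using x by (intro continuous_on_subset[OF E_continuous]) auto
    fix t assume "t \<in> {0<..<x} - S"
    then have "(\<mu> has_vector_derivative \<rho> t) (at t)"
      using mu_deriv x by (auto simp: has_real_derivative_iff_has_vector_derivative[symmetric])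
    then have "((\<lambda>t. c * of_real (\<mu> t)) has_vector_derivative c * of_real (\<rho> t)) (at t)"
      by (auto intro!: derivative_eq_intros simp: has_real_derivative_iff_has_vector_derivative)
    from field_vector_diff_chain_at[OF this DERIV_exp]
    show "(E c has_vector_derivative c * of_real (\<rho> t) * E c t) (at t)"
      by (simp add: E_def[abs_def] o_def)
  qed (use x in auto)
  then show "E c x = E c 0 + integral {0..x} (\<lambda>x. c * of_real (\<rho> x) * E c x)"
    by (metis add.commute diff_add_cancel integral_unique)
qed

text \<open>The Dirac system in the variables \<open>u = y1 + \<i> * y2\<close> and \<open>v = y1 - \<i> * y2\<close>, in which its leading part is
  diagonal; then \<open>f = q - \<i> * p\<close> and \<open>g = q + \<i> * p\<close>.  Leaving \<open>f\<close> and \<open>g\<close> independent of each other makes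
  the system symmetric under exchanging \<open>u\<close> with \<open>v\<close>, \<open>f\<close> with \<open>g\<close> and \<open>lam\<close> with \<open>- lam\<close>, so
  that the lower half-plane need not be treated separately.\<close>

definition dirac_pair :: "(real \<Rightarrow> complex) \<Rightarrow> (real \<Rightarrow> complex) \<Rightarrow> complex \<Rightarrow> (real \<Rightarrow> complex) \<Rightarrow> (real \<Rightarrow> complex) \<Rightarrow> bool" where
  "dirac_pair f g lam u v \<longleftrightarrow>
     primitive_on L u (\<lambda>x. \<i> * lam * of_real (\<rho> x) * u x + f x * v x) \<and>
     primitive_on L v (\<lambda>x. - \<i> * lam * of_real (\<rho> x) * v x + g x * u x)"

lemma dirac_pair_swap: "dirac_pair f g lam u v \<Longrightarrow> dirac_pair g f (- lam) v u"
  by (simp add: dirac_pair_def)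

text \<open>Dividing \<open>u\<close> and \<open>v\<close> by their unperturbed versions cancels the spectral term in the derivatives.\<close>

lemma primitive_on_gauged:
  assumes "dirac_pair f g lam u v"
  shows "primitive_on L (\<lambda>x. E (- \<i> * lam) x * u x) (\<lambda>x. f x * E (- \<i> * lam) x * v x)"
    and "primitive_on L (\<lambda>x. E (\<i> * lam) x * v x) (\<lambda>x. g x * E (\<i> * lam) x * u x)"
proof -
  have u: "primitive_on L u (\<lambda>x. \<i> * lam * of_real (\<rho> x) * u x + f x * v x)"
    and v: "primitive_on L v (\<lambda>x. - \<i> * lam * of_real (\<rho> x) * v x + g x * u x)"
    using assms by (simp_all add: dirac_pair_def)
  show "primitive_on L (\<lambda>x. E (- \<i> * lam) x * u x) (\<lambda>x. f x * E (- \<i> * lam) x * v x)"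
    by (rule primitive_on_cong[OF primitive_on_mult[OF primitive_on_E[of "- \<i> * lam"] u]])
       (use L_pos in \<open>auto simp: algebra_simps\<close>)
  show "primitive_on L (\<lambda>x. E (\<i> * lam) x * v x) (\<lambda>x. g x * E (\<i> * lam) x * u x)"
    by (rule primitive_on_cong[OF primitive_on_mult[OF primitive_on_E[of "\<i> * lam"] v]])
       (use L_pos in \<open>auto simp: algebra_simps\<close>)
qed

text \<open>Fourier integrals over \<open>[0, t]\<close> in the phase variable; all error terms below are built from them.\<close>

definition fourier :: "(real \<Rightarrow> complex) \<Rightarrow> complex \<Rightarrow> real \<Rightarrow> complex" where
  "fourier h lam t = integral {0..t} (\<lambda>s. h s * E (2 * \<i> * lam) s)"

lemma fourier_primitive:
  assumes "L1 h"
  shows "primitive_on L (fourier h lam) (\<lambda>s. h s * E (2 * \<i> * lam) s)"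
  unfolding fourier_def
  by (intro primitive_on_indefinite_integral absolutely_integrable_mult_continuous assms E_continuous)

lemma fourier_0 [simp]: "fourier h lam 0 = 0" by (simp add: fourier_def)

lemma dirac_pair_continuous:
  assumes "dirac_pair f g lam u v"
  shows "continuous_on {0..L} u" "continuous_on {0..L} v"
  using assms by (auto simp: dirac_pair_def intro: primitive_on_continuous)

definition mass :: "(real \<Rightarrow> complex) \<Rightarrow> (real \<Rightarrow> complex) \<Rightarrow> real" where
  "mass f g = integral {0..L} (\<lambda>t. cmod (f t) + cmod (g t))"

text \<open>In the closed upper half-plane the factor \<open>exp (\<i> * lam * \<mu>)\<close> compensates the growth of \<open>v\<close>.  It
  also bounds \<open>u\<close>: the potential feeds \<open>v\<close> into \<open>u\<close> through the kernel
  \<open>exp (2 * \<i> * lam * (\<mu> x - \<mu> t))\<close>, of modulus at most 1 for \<open>t \<le> x\<close>.  Gronwall's inequality then applies.\<close>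

lemma gauged_growth:
  assumes sol: "dirac_pair f g lam u v" and lam: "0 \<le> Im lam"
    and f: "L1 f" and g: "L1 g"
    and x: "x \<in> {0..L}"
  shows "cmod (E (\<i> * lam) x * u x) + cmod (E (\<i> * lam) x * v x)
     \<le> (cmod (u 0) + cmod (v 0)) * exp (mass f g)"
proof -
  define U V where "U = (\<lambda>x. E (\<i> * lam) x * u x)" and "V = (\<lambda>x. E (\<i> * lam) x * v x)"
  have cont: "continuous_on {0..L} U" "continuous_on {0..L} V"
    unfolding U_def V_def by (intro continuous_intros E_continuous dirac_pair_continuous[OF sol])+
  define w where "w = (\<lambda>t. cmod (f t) + cmod (g t))"
  have w: "L1 w"
    unfolding w_def using f g by (intro set_integral_add absolutely_integrable_cmod)
  have fn: "(\<lambda>t. cmod (f t)) absolutely_integrable_on {0..y}" "(\<lambda>t. cmod (g t)) absolutely_integrable_on {0..y}"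
    if "y \<in> {0..L}" for y
    using that absolutely_integrable_norm_sub(1)[OF absolutely_integrable_cmod[OF f], of 0 y]
      absolutely_integrable_norm_sub(1)[OF absolutely_integrable_cmod[OF g], of 0 y] by (simp_all add: o_def)
  have int: "(\<lambda>t. cmod (f t) * cmod (V t)) integrable_on {0..y}" "(\<lambda>t. cmod (g t) * cmod (U t)) integrable_on {0..y}"
     "(\<lambda>t. w t * (cmod (U t) + cmod (V t))) integrable_on {0..y}"
    if y: "y \<in> {0..L}" for y
  proof -
    have c: "continuous_on {0..y} (\<lambda>t. cmod (U t))" "continuous_on {0..y} (\<lambda>t. cmod (V t))"
      using y by (auto intro!: continuous_on_norm continuous_on_subset[OF cont(1)] continuous_on_subset[OF cont(2)])
    show "(\<lambda>t. cmod (f t) * cmod (V t)) integrable_on {0..y}" "(\<lambda>t. cmod (g t) * cmod (U t)) integrable_on {0..y}"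
      by (rule integrable_if_absolutely, rule absolutely_integrable_mult_continuous(1), fact fn[OF y], fact c)+
    have "w absolutely_integrable_on {0..y}"
      unfolding w_def by (intro set_integral_add fn y)
    then show "(\<lambda>t. w t * (cmod (U t) + cmod (V t))) integrable_on {0..y}"
      by (intro integrable_mult_continuous continuous_intros c)
  qed
  have bound: "cmod (U y) + cmod (V y) \<le> (cmod (u 0) + cmod (v 0)) + integral {0..y} (\<lambda>t. w t * (cmod (U t) + cmod (V t)))"
    if y: "y \<in> {0..L}" for y
  proof -
    have "cmod (V y) \<le> cmod (V 0) + integral {0..y} (\<lambda>t. cmod (g t) * cmod (U t))"
      unfolding V_def
      by (rule primitive_on_norm_le(1)[OF primitive_on_gauged(2)[OF sol] y int(2)[OF y]])
         (simp add: norm_mult U_def)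
    moreover have "cmod (U y) \<le> cmod (U 0) + integral {0..y} (\<lambda>t. cmod (f t) * cmod (V t))"
    proof -
      define s where "s = Im lam * \<mu> y"
      have "cmod (E (- \<i> * lam) y * u y) \<le> cmod (E (- \<i> * lam) 0 * u 0)
         + integral {0..y} (\<lambda>t. exp (2 * s) * (cmod (f t) * cmod (V t)))"
      proof (rule primitive_on_norm_le(1)[OF primitive_on_gauged(1)[OF sol] y])
        show "(\<lambda>t. exp (2 * s) * (cmod (f t) * cmod (V t))) integrable_on {0..y}"
          by (intro integrable_on_mult_right int y)
        fix t assume t: "t \<in> {0..y}"
        have "E (- \<i> * lam) t = E (- 2 * \<i> * lam) t * E (\<i> * lam) t"
          by (simp add: E_mult algebra_simps)
        then have "cmod (f t * E (- \<i> * lam) t * v t) = exp (2 * Im lam * \<mu> t) * (cmod (f t) * cmod (V t))"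
          by (simp add: V_def norm_mult norm_E)
        also have "\<dots> \<le> exp (2 * s) * (cmod (f t) * cmod (V t))"
          using mu_le[of t y] t y lam unfolding s_def
          by (intro mult_right_mono) (auto intro!: mult_left_mono)
        finally show "cmod (f t * E (- \<i> * lam) t * v t) \<le> exp (2 * s) * (cmod (f t) * cmod (V t))" .
      qed
      then have le: "cmod (E (- \<i> * lam) y * u y) \<le> cmod (u 0) + exp (2 * s) * integral {0..y} (\<lambda>t. cmod (f t) * cmod (V t))"
        by simp
      have "0 \<le> s" using mu_nonneg[OF y] lam by (simp add: s_def)
      have "E (\<i> * lam) y = E (2 * \<i> * lam) y * E (- \<i> * lam) y"
        by (simp add: E_mult algebra_simps)
      then have "cmod (U y) = exp (- 2 * s) * cmod (E (- \<i> * lam) y * u y)"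
        by (simp add: U_def norm_mult norm_E s_def)
      also have "\<dots> \<le> exp (- 2 * s) * (cmod (u 0) + exp (2 * s) * integral {0..y} (\<lambda>t. cmod (f t) * cmod (V t)))"
        by (intro mult_left_mono le) simp
      also have "\<dots> = exp (- 2 * s) * cmod (u 0) + integral {0..y} (\<lambda>t. cmod (f t) * cmod (V t))"
        by (simp add: distrib_left mult.assoc[symmetric] exp_add[symmetric])
      also have "exp (- 2 * s) * cmod (u 0) \<le> 1 * cmod (u 0)"
        using \<open>0 \<le> s\<close> by (intro mult_right_mono) auto
      finally show ?thesis by (simp add: U_def)
    qed
    moreover have "integral {0..y} (\<lambda>t. cmod (f t) * cmod (V t)) + integral {0..y} (\<lambda>t. cmod (g t) * cmod (U t))
       \<le> integral {0..y} (\<lambda>t. w t * (cmod (U t) + cmod (V t)))"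
      unfolding integral_add[OF int(1,2)[OF y], symmetric]
      by (rule integral_le[OF integrable_add[OF int(1,2)[OF y]] int(3)[OF y]])
         (simp add: w_def algebra_simps)
    ultimately show ?thesis by (simp add: U_def V_def)
  qed
  have "cmod (U x) + cmod (V x) \<le> (cmod (u 0) + cmod (v 0)) * exp (integral {0..L} w)"
    by (rule gronwall[OF w _ _ _ bound x]) (auto simp: w_def intro!: continuous_intros cont)
  then show ?thesis by (simp add: U_def V_def w_def mass_def)
qed

text \<open>The change of \<open>exp (\<i> * lam * \<mu>) * v\<close> is the integral of \<open>g\<close> against
  \<open>exp (\<i> * lam * \<mu>) * u\<close>, which oscillates like \<open>exp (2 * \<i> * lam * \<mu>)\<close>.  Integrating by parts turns this oscillation into a Fourier integral of \<open>g\<close>, and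
  the remaining factors are bounded by \<open>gauged_growth\<close>.  The change of the gauged \<open>u\<close> is treated in
  the same way with Fourier integrals of \<open>f\<close>, taken over initial instead of final segments so that the
  exponential factors stay bounded.\<close>

lemma upper_half_plane_estimate:
  assumes sol: "dirac_pair f g lam u v" and lam: "0 \<le> Im lam"
    and f: "L1 f" and g: "L1 g"
  defines "M \<equiv> (cmod (u 0) + cmod (v 0)) * exp (mass f g)"
  shows "cmod (E (\<i> * lam) L * v L - v 0) \<le> M * (cmod (fourier g lam L) + integral {0..L}
        (\<lambda>t. cmod (f t) * cmod (E (- 2 * \<i> * lam) t * (fourier g lam L - fourier g lam t))))"
    and "cmod (E (\<i> * lam) L * u L - E (2 * \<i> * lam) L * u 0) \<le> M * (cmod (E (2 * \<i> * lam) L * fourier f (- lam) L)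
        + integral {0..L} (\<lambda>t. cmod (g t) * cmod (E (2 * \<i> * lam) L * fourier f (- lam) t)))"
proof -
  have grow: "cmod (E (\<i> * lam) x * u x) \<le> M" "cmod (E (\<i> * lam) x * v x) \<le> M" if "x \<in> {0..L}" for x
    using gauged_growth[OF sol lam f g that] unfolding M_def
    by (smt (verit) norm_ge_zero)+
  have M0: "0 \<le> M" by (simp add: M_def)
  define wp where "wp = (\<lambda>x. E (- \<i> * lam) x * u x)"
  define wm where "wm = (\<lambda>x. E (\<i> * lam) x * v x)"
  define G where "G = fourier g lam"
  define F where "F = fourier f (- lam)"
  note wp = primitive_on_gauged(1)[OF sol, folded wp_def] and wm = primitive_on_gauged(2)[OF sol, folded wm_def]
  note G = fourier_primitive[OF g, of lam, folded G_def] and F = fourier_primitive[OF f, of "- lam", folded F_def]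
  have L: "L \<in> {0..L}" "0 \<in> {0..L}" using L_pos by auto
  have cont: "continuous_on {0..L} G" "continuous_on {0..L} F" "continuous_on {0..L} wp" "continuous_on {0..L} wm"
    by (rule primitive_on_continuous, fact)+
  have cancel: "(0 - a * A) * (B * b) + D * (c * B * d) + a * C * b = D * (c * B * d)"
    if "A * B = C" for a b c d A B C D :: complex
    unfolding that[symmetric] by (simp add: algebra_simps)
  \<comment> \<open>The Fourier integral is normalised to vanish at \<open>L\<close>, where \<open>wp\<close> may be large.\<close>
  have P1: "primitive_on L (\<lambda>x. (G L - G x) * wp x + wm x) (\<lambda>x. (G L - G x) * (f x * E (- \<i> * lam) x * v x))"
  proof (rule primitive_on_cong[OF primitive_on_add[OF primitive_on_mult[OF primitive_on_diff[OF primitive_on_const G] wp] wm]])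
    fix x
    have "E (2 * \<i> * lam) x * E (- \<i> * lam) x = E (\<i> * lam) x" by (simp add: E_mult algebra_simps)
    then show "(0 - g x * E (2 * \<i> * lam) x) * wp x + (G L - G x) * (f x * E (- \<i> * lam) x * v x)
       + g x * E (\<i> * lam) x * u x = (G L - G x) * (f x * E (- \<i> * lam) x * v x)"
      unfolding wp_def
      by (rule cancel)
  qed (use L_pos in auto)
  have P1_le: "cmod (((G L - G L) * wp L + wm L) - ((G L - G 0) * wp 0 + wm 0))
     \<le> integral {0..L} (\<lambda>t. M * (cmod (f t) * cmod (E (- 2 * \<i> * lam) t * (G L - G t))))"
  proof (rule primitive_on_norm_le(2)[OF P1 L(1)])
    show "(\<lambda>t. M * (cmod (f t) * cmod (E (- 2 * \<i> * lam) t * (G L - G t)))) integrable_on {0..L}"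
      by (intro integrable_on_mult_right integrable_mult_continuous
          absolutely_integrable_cmod f continuous_intros E_continuous cont)
    fix t assume t: "t \<in> {0..L}"
    have "E (- \<i> * lam) t = E (- 2 * \<i> * lam) t * E (\<i> * lam) t"
      by (simp add: E_mult algebra_simps)
    then have "cmod ((G L - G t) * (f t * E (- \<i> * lam) t * v t))
      = cmod (f t) * cmod (E (- 2 * \<i> * lam) t * (G L - G t)) * cmod (E (\<i> * lam) t * v t)"
      by (simp add: norm_mult)
    also have "\<dots> \<le> cmod (f t) * cmod (E (- 2 * \<i> * lam) t * (G L - G t)) * M"
      by (intro mult_left_mono grow t) simp
    finally show "cmod ((G L - G t) * (f t * E (- \<i> * lam) t * v t))
      \<le> M * (cmod (f t) * cmod (E (- 2 * \<i> * lam) t * (G L - G t)))" by (simp add: mult_ac)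
  qed
  have "cmod (wm L - wm 0) \<le> cmod (G L * wp 0) + cmod (wm L - (G L * wp 0 + wm 0))"
    using norm_triangle_ineq[of "G L * wp 0" "wm L - (G L * wp 0 + wm 0)"] by simp
  also have "cmod (G L * wp 0) \<le> M * cmod (G L)"
    using grow(1)[of 0] L by (simp add: norm_mult wp_def mult.commute[of M] mult_left_mono)
  finally show "cmod (E (\<i> * lam) L * v L - v 0) \<le> M * (cmod (fourier g lam L) + integral {0..L}
        (\<lambda>t. cmod (f t) * cmod (E (- 2 * \<i> * lam) t * (fourier g lam L - fourier g lam t))))"
    using P1_le by (simp add: wm_def G_def distrib_left)
  have cancel': "a * A * (B * b) + D * (c * B * d) - a * C * b = D * (c * B * d)"
    if "A * B = C" for a b c d A B C D :: complex
    unfolding that[symmetric] by (simp add: algebra_simps)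
  have P2: "primitive_on L (\<lambda>x. F x * wm x - wp x) (\<lambda>x. F x * (g x * E (\<i> * lam) x * u x))"
  proof (rule primitive_on_cong[OF primitive_on_diff[OF primitive_on_mult[OF F wm] wp]])
    fix x
    have "E (2 * \<i> * - lam) x * E (\<i> * lam) x = E (- \<i> * lam) x" by (simp add: E_mult algebra_simps)
    then show "f x * E (2 * \<i> * - lam) x * wm x + F x * (g x * E (\<i> * lam) x * u x)
       - f x * E (- \<i> * lam) x * v x = F x * (g x * E (\<i> * lam) x * u x)"
      unfolding wm_def by (rule cancel')
  qed (use L_pos in auto)
  have P2_le: "cmod (E (2 * \<i> * lam) L * (F L * wm L - wp L) - E (2 * \<i> * lam) L * (F 0 * wm 0 - wp 0))
     \<le> integral {0..L} (\<lambda>t. M * (cmod (g t) * cmod (E (2 * \<i> * lam) L * F t)))"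
  proof (rule primitive_on_norm_le(2)[OF primitive_on_cmult[OF P2] L(1)])
    show "(\<lambda>t. M * (cmod (g t) * cmod (E (2 * \<i> * lam) L * F t))) integrable_on {0..L}"
      by (intro integrable_on_mult_right integrable_mult_continuous
          absolutely_integrable_cmod g continuous_intros cont)
    fix t assume t: "t \<in> {0..L}"
    have "cmod (E (2 * \<i> * lam) L * (F t * (g t * E (\<i> * lam) t * u t)))
      = cmod (g t) * cmod (E (2 * \<i> * lam) L * F t) * cmod (E (\<i> * lam) t * u t)"
      by (simp add: norm_mult)
    also have "\<dots> \<le> cmod (g t) * cmod (E (2 * \<i> * lam) L * F t) * M"
      by (intro mult_left_mono grow t) simp
    finally show "cmod (E (2 * \<i> * lam) L * (F t * (g t * E (\<i> * lam) t * u t)))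
      \<le> M * (cmod (g t) * cmod (E (2 * \<i> * lam) L * F t))" by (simp add: mult_ac)
  qed
  have "E (2 * \<i> * lam) L * E (- \<i> * lam) L = E (\<i> * lam) L"
    by (simp add: E_mult algebra_simps)
  moreover have wp0: "wp 0 = u 0" by (simp add: wp_def)
  ultimately have "E (2 * \<i> * lam) L * wp L = E (\<i> * lam) L * u L"
    unfolding wp_def mult.assoc[symmetric] by simp
  then have eq: "E (\<i> * lam) L * u L - E (2 * \<i> * lam) L * u 0 = E (2 * \<i> * lam) L * F L * wm L
    - (E (2 * \<i> * lam) L * (F L * wm L - wp L) - E (2 * \<i> * lam) L * (F 0 * wm 0 - wp 0))"
    using wp0 by (simp add: F_def right_diff_distrib mult.assoc)
  have "cmod (E (\<i> * lam) L * u L - E (2 * \<i> * lam) L * u 0) \<le> cmod (E (2 * \<i> * lam) L * F L * wm L)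
    + cmod (E (2 * \<i> * lam) L * (F L * wm L - wp L) - E (2 * \<i> * lam) L * (F 0 * wm 0 - wp 0))"
    unfolding eq by (rule norm_triangle_ineq4)
  also have "cmod (E (2 * \<i> * lam) L * F L * wm L) \<le> M * cmod (E (2 * \<i> * lam) L * F L)"
    using mult_right_mono[OF grow(2)[OF L(1)], of "cmod (E (2 * \<i> * lam) L * F L)"]
    by (simp add: norm_mult wm_def mult_ac)
  finally show "cmod (E (\<i> * lam) L * u L - E (2 * \<i> * lam) L * u 0) \<le> M * (cmod (E (2 * \<i> * lam) L * fourier f (- lam) L)
        + integral {0..L} (\<lambda>t. cmod (g t) * cmod (E (2 * \<i> * lam) L * fourier f (- lam) t)))"
    using P2_le by (simp add: F_def distrib_left)
qed

section \<open>Decay of Fourier integrals away from the real axis\<close>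

text \<open>All Fourier integrals of \<open>upper_half_plane_estimate\<close>, with the exponential factors that keep them bounded
  in the upper half-plane.\<close>

definition defect :: "(real \<Rightarrow> complex) \<Rightarrow> (real \<Rightarrow> complex) \<Rightarrow> complex \<Rightarrow> real" where
  "defect f g lam =
     cmod (fourier g lam L)
     + integral {0..L} (\<lambda>t. cmod (f t) * cmod (E (- 2 * \<i> * lam) t * (fourier g lam L - fourier g lam t)))
     + cmod (E (2 * \<i> * lam) L * fourier f (- lam) L)
     + integral {0..L} (\<lambda>t. cmod (g t) * cmod (E (2 * \<i> * lam) L * fourier f (- lam) t))"

lemma integral_mult_le_sup:
  fixes w k :: "real \<Rightarrow> real"
  assumes w: "L1 w" "\<And>x. x \<in> {0..L} \<Longrightarrow> 0 \<le> w x"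
    and k: "continuous_on {0..L} k" "\<And>x. x \<in> {0..L} \<Longrightarrow> k x \<le> b"
  shows "integral {0..L} (\<lambda>x. w x * k x) \<le> integral {0..L} w * b"
proof -
  have "integral {0..L} (\<lambda>x. w x * k x) \<le> integral {0..L} (\<lambda>x. w x * b)"
    by (intro integral_le integrable_mult_continuous w k mult_left_mono)
       auto
  then show ?thesis by simp
qed

definition square_norm :: "(real \<Rightarrow> complex) \<Rightarrow> real" where
  "square_norm h = integral {0..L} (\<lambda>x. (cmod (h x))\<^sup>2)"

definition L2 :: "(real \<Rightarrow> complex) \<Rightarrow> bool" where
  "L2 h \<longleftrightarrow> L1 h \<and> (\<lambda>x. (cmod (h x))\<^sup>2) integrable_on {0..L}"

lemma L2D: "L2 h \<Longrightarrow> L1 h" "L2 h \<Longrightarrow> (\<lambda>x. (cmod (h x))\<^sup>2) integrable_on {0..L}"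
  by (simp_all add: L2_def)

lemma square_norm_sub:
  assumes "L2 h" "0 \<le> x" "y \<le> L"
  shows "(\<lambda>x. (cmod (h x))\<^sup>2) integrable_on {x..y}" "integral {x..y} (\<lambda>x. (cmod (h x))\<^sup>2) \<le> square_norm h"
proof -
  show i: "(\<lambda>x. (cmod (h x))\<^sup>2) integrable_on {x..y}"
    using assms by (intro integrable_subinterval_real[OF L2D(2)[OF assms(1)]]) auto
  show "integral {x..y} (\<lambda>x. (cmod (h x))\<^sup>2) \<le> square_norm h"
    unfolding square_norm_def using assms by (intro integral_subset_le i L2D(2)) auto
qed

lemma integral_exp_decay_le:
  fixes c x y :: real
  assumes "0 < c" "x \<le> y"
  shows "((\<lambda>s. exp (- c * (s - x))) has_integral (1 - exp (- c * (y - x))) / c) {x..y}"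
    and "((\<lambda>s. exp (- c * (y - s))) has_integral (1 - exp (- c * (y - x))) / c) {x..y}"
proof -
  have "((\<lambda>s. exp (- c * (s - x))) has_integral (- exp (- c * (y - x)) / c - (- exp (- c * (x - x)) / c))) {x..y}"
    using assms by (intro fundamental_theorem_of_calculus[where f = "\<lambda>s. - exp (- c * (s - x)) / c"])
      (auto intro!: derivative_eq_intros simp: has_real_derivative_iff_has_vector_derivative[symmetric])
  then show "((\<lambda>s. exp (- c * (s - x))) has_integral (1 - exp (- c * (y - x))) / c) {x..y}"
    by (simp add: diff_divide_distrib)
  have "((\<lambda>s. exp (- c * (y - s))) has_integral (exp (- c * (y - y)) / c - (exp (- c * (y - x)) / c))) {x..y}"
    using assms by (intro fundamental_theorem_of_calculus[where f = "\<lambda>s. exp (- c * (y - s)) / c"])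
      (auto intro!: derivative_eq_intros simp: has_real_derivative_iff_has_vector_derivative[symmetric])
  then show "((\<lambda>s. exp (- c * (y - s))) has_integral (1 - exp (- c * (y - x))) / c) {x..y}"
    by (simp add: diff_divide_distrib)
qed

text \<open>Cauchy--Schwarz in the form \<open>a * b \<le> a\<^sup>2 / s + s * b\<^sup>2\<close> with \<open>s\<close> still to be chosen.\<close>

lemma damped_integral_le:
  fixes k :: "real \<Rightarrow> complex"
  assumes h: "L2 h" and xy: "0 \<le> x" "y \<le> L" and s: "0 < s"
    and k: "k integrable_on {x..y}" "\<And>t. t \<in> {x..y} \<Longrightarrow> cmod (k t) \<le> cmod (h t) * e t"
    and e: "((\<lambda>t. (e t)\<^sup>2) has_integral I) {x..y}" "I \<le> 1 / (s\<^sup>2 * \<rho>0)"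
  shows "cmod (integral {x..y} k) \<le> (square_norm h + 1 / \<rho>0) / s"
proof -
  have i: "((\<lambda>t. (cmod (h t))\<^sup>2 / s + s * (e t)\<^sup>2) has_integral
      (integral {x..y} (\<lambda>t. (cmod (h t))\<^sup>2) / s + s * I)) {x..y}"
    by (intro has_integral_add has_integral_divide has_integral_mult_right e integrable_integral square_norm_sub[OF h xy])
  have "cmod (integral {x..y} k) \<le> integral {x..y} (\<lambda>t. (cmod (h t))\<^sup>2 / s + s * (e t)\<^sup>2)"
  proof (rule integral_norm_bound_integral[OF k(1)])
    show "(\<lambda>t. (cmod (h t))\<^sup>2 / s + s * (e t)\<^sup>2) integrable_on {x..y}"
      using i by (auto simp: integrable_on_def)
    fix t assume "t \<in> {x..y}"
    have "0 \<le> (cmod (h t) - s * e t)\<^sup>2 + (cmod (h t))\<^sup>2 + (s * e t)\<^sup>2" by simp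
    then have "2 * s * (cmod (h t) * e t) \<le> 2 * ((cmod (h t))\<^sup>2 + (s * e t)\<^sup>2)"
      by (simp add: power2_eq_square algebra_simps)
    then have "cmod (h t) * e t \<le> ((cmod (h t))\<^sup>2 + (s * e t)\<^sup>2) / s"
      using s by (simp add: field_simps)
    also have "\<dots> = (cmod (h t))\<^sup>2 / s + s * (e t)\<^sup>2"
      using s by (simp add: field_simps power2_eq_square)
    finally show "cmod (k t) \<le> (cmod (h t))\<^sup>2 / s + s * (e t)\<^sup>2"
      using k(2)[OF \<open>t \<in> {x..y}\<close>] by linarith
  qed
  also have "\<dots> = integral {x..y} (\<lambda>t. (cmod (h t))\<^sup>2) / s + s * I"
    using i by (rule integral_unique)
  also have "\<dots> \<le> square_norm h / s + s * (1 / (s\<^sup>2 * \<rho>0))"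
    using s square_norm_sub[OF h xy] e(2) by (intro add_mono divide_right_mono mult_left_mono) auto
  also have "\<dots> = (square_norm h + 1 / \<rho>0) / s"
    using s by (simp add: field_simps power2_eq_square)
  finally show ?thesis .
qed

lemma fourier_integrand:
  assumes "L1 h" "0 \<le> x" "y \<le> L"
  shows "(\<lambda>s. h s * E c s) integrable_on {x..y}"
  using absolutely_integrable_norm_sub(2)[OF absolutely_integrable_mult_continuous(1)[OF assms(1) E_continuous] assms(2,3)] .

lemma fourier_diff:
  assumes "L1 h" "t \<in> {0..L}"
  shows "fourier h lam L - fourier h lam t = integral {t..L} (\<lambda>s. h s * E (2 * \<i> * lam) s)"
proof -
  have "fourier h lam t + integral {t..L} (\<lambda>s. h s * E (2 * \<i> * lam) s) = fourier h lam L"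
    unfolding fourier_def using assms
    by (intro Henstock_Kurzweil_Integration.integral_combine fourier_integrand) auto
  then show ?thesis by (simp add: algebra_simps)
qed

text \<open>High above the real axis the kernels decay exponentially, at a rate proportional to \<open>Im lam\<close>, so
  that square integrability of \<open>h\<close> makes the integrals small, uniformly in \<open>Re lam\<close>.\<close>

lemma fourier_high:
  assumes h: "L2 h" and t: "t \<in> {0..L}" and lam: "0 < Im lam"
  shows "cmod (E (- 2 * \<i> * lam) t * (fourier h lam L - fourier h lam t)) \<le> (square_norm h + 1 / \<rho>0) / sqrt (Im lam)"
    and "cmod (E (2 * \<i> * lam) L * fourier h (- lam) t) \<le> (square_norm h + 1 / \<rho>0) / sqrt (Im lam)"
proof -
  note ha = L2D(1)[OF h]
  \<comment> \<open>The kernels decay at least like \<open>exp (- c * \<bar>s - t\<bar>)\<close>, because \<open>\<mu>\<close> has slope at least \<open>\<rho>0\<close>.\<close>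
  define c where "c = 2 * (Im lam * \<rho>0)"
  have c: "0 < c" using lam rho0_pos by (simp add: c_def)
  have I: "(1 - exp (- (2 * c) * z)) / (2 * c) \<le> 1 / ((sqrt (Im lam))\<^sup>2 * \<rho>0)" for z
  proof -
    have "(1 - exp (- (2 * c) * z)) / (2 * c) \<le> 1 / (2 * c)"
      using c by (intro divide_right_mono) auto
    also have "\<dots> \<le> 1 / (Im lam * \<rho>0)"
      using lam rho0_pos by (intro divide_left_mono) (auto simp: c_def)
    finally show ?thesis using lam by simp
  qed
  have sq: "(exp (- c * z))\<^sup>2 = exp (- (2 * c) * z)" for z
    by (simp add: exp_double[symmetric] mult.assoc)
  show "cmod (E (- 2 * \<i> * lam) t * (fourier h lam L - fourier h lam t)) \<le> (square_norm h + 1 / \<rho>0) / sqrt (Im lam)"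
  proof -
    have "E (- 2 * \<i> * lam) t * (fourier h lam L - fourier h lam t)
        = integral {t..L} (\<lambda>s. E (- 2 * \<i> * lam) t * (h s * E (2 * \<i> * lam) s))"
      by (simp add: fourier_diff[OF ha t])
    also have "cmod \<dots> \<le> (square_norm h + 1 / \<rho>0) / sqrt (Im lam)"
    proof (rule damped_integral_le[OF h, where e = "\<lambda>s. exp (- c * (s - t))"])
      show "(\<lambda>s. E (- 2 * \<i> * lam) t * (h s * E (2 * \<i> * lam) s)) integrable_on {t..L}"
        using t by (intro integrable_on_mult_right fourier_integrand ha) auto
      fix s assume s: "s \<in> {t..L}"
      have "Im lam * (\<mu> t + \<rho>0 * (s - t)) \<le> Im lam * \<mu> s"
        using mu_mono[of t s] s t lam by (intro mult_left_mono) auto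
      then have "2 * Im lam * \<mu> t - 2 * Im lam * \<mu> s \<le> - c * (s - t)"
        by (simp add: c_def algebra_simps)
      moreover have "cmod (E (- 2 * \<i> * lam) t) * cmod (E (2 * \<i> * lam) s) = exp (2 * Im lam * \<mu> t - 2 * Im lam * \<mu> s)"
        by (simp add: norm_E exp_diff exp_minus field_simps)
      ultimately have "cmod (E (- 2 * \<i> * lam) t) * cmod (E (2 * \<i> * lam) s) \<le> exp (- c * (s - t))" by simp
      then have "cmod (h s) * (cmod (E (- 2 * \<i> * lam) t) * cmod (E (2 * \<i> * lam) s)) \<le> cmod (h s) * exp (- c * (s - t))"
        by (rule mult_left_mono) simp
      then show "cmod (E (- 2 * \<i> * lam) t * (h s * E (2 * \<i> * lam) s)) \<le> cmod (h s) * exp (- c * (s - t))"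
        by (simp add: norm_mult mult_ac)
    next
      show "((\<lambda>s. (exp (- c * (s - t)))\<^sup>2) has_integral (1 - exp (- (2 * c) * (L - t))) / (2 * c)) {t..L}"
        unfolding sq using t c by (intro integral_exp_decay_le) auto
      show "(1 - exp (- (2 * c) * (L - t))) / (2 * c) \<le> 1 / ((sqrt (Im lam))\<^sup>2 * \<rho>0)" by (rule I)
    qed (use t lam in auto)
    finally show ?thesis .
  qed
  show "cmod (E (2 * \<i> * lam) L * fourier h (- lam) t) \<le> (square_norm h + 1 / \<rho>0) / sqrt (Im lam)"
  proof -
    have "E (2 * \<i> * lam) L * fourier h (- lam) t
        = integral {0..t} (\<lambda>s. E (2 * \<i> * lam) L * (h s * E (2 * \<i> * - lam) s))"
      by (simp add: fourier_def)
    also have "cmod \<dots> \<le> (square_norm h + 1 / \<rho>0) / sqrt (Im lam)"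
    proof (rule damped_integral_le[OF h, where e = "\<lambda>s. exp (- c * (t - s))"])
      show "(\<lambda>s. E (2 * \<i> * lam) L * (h s * E (2 * \<i> * - lam) s)) integrable_on {0..t}"
        using t by (intro integrable_on_mult_right fourier_integrand ha) auto
      fix s assume s: "s \<in> {0..t}"
      have "Im lam * (\<mu> s + \<rho>0 * (t - s)) \<le> Im lam * \<mu> L"
        using mu_mono[of s t] mu_le[of t L] s t lam by (intro mult_left_mono) auto
      then have "2 * Im lam * \<mu> s - 2 * Im lam * \<mu> L \<le> - c * (t - s)"
        by (simp add: c_def algebra_simps)
      moreover have "cmod (E (2 * \<i> * lam) L) * cmod (E (2 * \<i> * - lam) s) = exp (2 * Im lam * \<mu> s - 2 * Im lam * \<mu> L)"
        by (simp add: norm_E exp_diff exp_minus field_simps)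
      ultimately have "cmod (E (2 * \<i> * lam) L) * cmod (E (2 * \<i> * - lam) s) \<le> exp (- c * (t - s))" by simp
      then have "cmod (h s) * (cmod (E (2 * \<i> * lam) L) * cmod (E (2 * \<i> * - lam) s)) \<le> cmod (h s) * exp (- c * (t - s))"
        by (rule mult_left_mono) simp
      then show "cmod (E (2 * \<i> * lam) L * (h s * E (2 * \<i> * - lam) s)) \<le> cmod (h s) * exp (- c * (t - s))"
        by (simp add: norm_mult mult_ac)
    next
      show "((\<lambda>s. (exp (- c * (t - s)))\<^sup>2) has_integral (1 - exp (- (2 * c) * (t - 0))) / (2 * c)) {0..t}"
        unfolding sq using t c by (intro integral_exp_decay_le) auto
      show "(1 - exp (- (2 * c) * (t - 0))) / (2 * c) \<le> 1 / ((sqrt (Im lam))\<^sup>2 * \<rho>0)" by (rule I)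
    qed (use t lam in auto)
    finally show ?thesis .
  qed
qed

lemma defect_high:
  assumes f: "L2 f" and g: "L2 g"
  obtains C where "\<And>lam. 0 < Im lam \<Longrightarrow> defect f g lam \<le> C / sqrt (Im lam)"
proof
  define Bf Bg where "Bf = square_norm f + 1 / \<rho>0" and "Bg = square_norm g + 1 / \<rho>0"
  note B = Bf_def[symmetric] Bg_def[symmetric]
  let ?s = "\<lambda>lam. sqrt (Im lam)"
  fix lam assume lam: "0 < Im lam"
  have cont: "continuous_on {0..L} (fourier g lam)" "continuous_on {0..L} (fourier f (- lam))"
    using fourier_primitive[OF L2D(1)] f g primitive_on_continuous by blast+
  have L: "L \<in> {0..L}" "0 \<in> {0..L}" using L_pos by auto
  have "cmod (fourier g lam L) \<le> Bg / ?s lam"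
    using fourier_high(1)[OF g L(2) lam, unfolded B] by simp
  moreover have "cmod (E (2 * \<i> * lam) L * fourier f (- lam) L) \<le> Bf / ?s lam"
    by (rule fourier_high(2)[OF f L(1) lam, unfolded B])
  moreover have "integral {0..L} (\<lambda>t. cmod (f t) * cmod (E (- 2 * \<i> * lam) t * (fourier g lam L - fourier g lam t)))
     \<le> integral {0..L} (\<lambda>t. cmod (f t)) * (Bg / ?s lam)"
    by (intro integral_mult_le_sup absolutely_integrable_cmod L2D f fourier_high(1)[OF g _ lam, unfolded B] continuous_intros E_continuous cont) auto
  moreover have "integral {0..L} (\<lambda>t. cmod (g t) * cmod (E (2 * \<i> * lam) L * fourier f (- lam) t))
     \<le> integral {0..L} (\<lambda>t. cmod (g t)) * (Bf / ?s lam)"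
    by (intro integral_mult_le_sup absolutely_integrable_cmod L2D g fourier_high(2)[OF f _ lam, unfolded B] continuous_intros cont) auto
  ultimately have "defect f g lam \<le> Bg / ?s lam + integral {0..L} (\<lambda>t. cmod (f t)) * (Bg / ?s lam)
      + Bf / ?s lam + integral {0..L} (\<lambda>t. cmod (g t)) * (Bf / ?s lam)"
    unfolding defect_def by linarith
  then show "defect f g lam \<le> (Bg + integral {0..L} (\<lambda>t. cmod (f t)) * Bg
      + Bf + integral {0..L} (\<lambda>t. cmod (g t)) * Bf) / ?s lam"
    by (simp add: add_divide_distrib)
qed

section \<open>Fourier integrals in a horizontal strip\<close>

text \<open>The size of the Fourier integrals of \<open>h\<close> at a frequency: the full integral and a weighted mean over
  the truncation points.  A supremum over the truncation points would be easier to use, but it is for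
  the mean that Bessel's inequality gives square summability over an arithmetic progression of
  frequencies.\<close>

definition amplitude :: "(real \<Rightarrow> real) \<Rightarrow> (real \<Rightarrow> complex) \<Rightarrow> complex \<Rightarrow> real" where
  "amplitude w h \<nu> = cmod (fourier h \<nu> L) + integral {0..L} (\<lambda>t. w t * cmod (fourier h \<nu> t))"

lemma fourier_continuous: "L1 h \<Longrightarrow> continuous_on {0..L} (fourier h \<nu>)"
  by (rule primitive_on_continuous[OF fourier_primitive])

lemma weighted_fourier_integrable:
  assumes "L1 w" "L1 h" "x \<in> {0..L}"
  shows "(\<lambda>t. w t * cmod (fourier h \<nu> t)) integrable_on {0..x}"
proof -
  have "L1 (\<lambda>t. w t * cmod (fourier h \<nu> t))"
    by (intro absolutely_integrable_mult_continuous(1) continuous_intros fourier_continuous assms)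
  from absolutely_integrable_norm_sub(2)[OF this, of 0 x] show ?thesis using assms(3) by simp
qed

lemma weighted_fourier_le_amplitude:
  assumes "L1 w" "L1 h"
    and "L1 v" "\<And>t. t \<in> {0..L} \<Longrightarrow> 0 \<le> v t" "\<And>t. t \<in> {0..L} \<Longrightarrow> v t \<le> w t"
    and "x \<in> {0..L}"
  shows "integral {0..x} (\<lambda>t. v t * cmod (fourier h \<nu> t)) \<le> amplitude w h \<nu>"
proof -
  have L: "L \<in> {0..L}" using L_pos by simp
  have "integral {0..x} (\<lambda>t. v t * cmod (fourier h \<nu> t)) \<le> integral {0..L} (\<lambda>t. v t * cmod (fourier h \<nu> t))"
    using assms by (intro integral_subset_le weighted_fourier_integrable L) auto
  also have "\<dots> \<le> integral {0..L} (\<lambda>t. w t * cmod (fourier h \<nu> t))"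
    using assms by (intro integral_le weighted_fourier_integrable L mult_right_mono) auto
  finally show ?thesis using norm_ge_zero[of "fourier h \<nu> L"] unfolding amplitude_def by linarith
qed

lemma amplitude_nonneg:
  assumes "L1 w" "L1 h" "\<And>t. t \<in> {0..L} \<Longrightarrow> 0 \<le> w t"
  shows "0 \<le> amplitude w h \<nu>"
  unfolding amplitude_def using assms L_pos
  by (intro add_nonneg_nonneg integral_nonneg weighted_fourier_integrable) auto

lemma norm_E_le:
  assumes "x \<in> {0..L}" "\<bar>Re c\<bar> \<le> r"
  shows "cmod (E c x) \<le> exp (r * \<mu> L)"
proof -
  have "Re c * \<mu> x \<le> r * \<mu> x"
    using assms mu_nonneg[of x] by (intro mult_right_mono) auto
  also have "\<dots> \<le> r * \<mu> L"
    using assms mu_le[of x L] by (intro mult_left_mono) auto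
  finally show ?thesis by (simp add: norm_E)
qed

text \<open>Integration by parts against the slowly varying \<open>exp (2 * \<i> * \<epsilon> * \<mu>)\<close>.  A Fourier integral at a complex
  frequency is thus controlled by those at any frequency within bounded distance, and a real one may be chosen.\<close>

lemma fourier_shift:
  assumes h: "L1 h" and \<epsilon>: "cmod \<epsilon> \<le> r" and t: "t \<in> {0..L}"
    and w: "L1 w" "\<And>t. t \<in> {0..L} \<Longrightarrow> \<rho> t \<le> w t"
  shows "cmod (fourier h (\<nu> + \<epsilon>) t) \<le> exp (2 * r * \<mu> L) * (1 + 2 * r) * (cmod (fourier h \<nu> t) + amplitude w h \<nu>)"
proof -
  define F where "F = fourier h \<nu>"
  note F = fourier_primitive[OF h, of \<nu>, folded F_def]
  have r: "0 \<le> r" using \<epsilon> norm_ge_zero[of \<epsilon>] by linarith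
  have Re: "\<bar>Re (2 * \<i> * \<epsilon>)\<bar> \<le> 2 * r" using \<epsilon> abs_Im_le_cmod[of \<epsilon>] by simp
  have E_le: "cmod (E (2 * \<i> * \<epsilon>) x) \<le> exp (2 * r * \<mu> L)" if "x \<in> {0..L}" for x
    by (rule norm_E_le[OF that Re])
  have P: "primitive_on L (\<lambda>x. fourier h (\<nu> + \<epsilon>) x - E (2 * \<i> * \<epsilon>) x * F x)
     (\<lambda>x. - (2 * \<i> * \<epsilon> * of_real (\<rho> x) * E (2 * \<i> * \<epsilon>) x * F x))"
  proof (rule primitive_on_cong[OF primitive_on_diff[OF fourier_primitive[OF h] primitive_on_mult[OF primitive_on_E F]]])
    fix x
    have "E (2 * \<i> * (\<nu> + \<epsilon>)) x = E (2 * \<i> * \<epsilon>) x * E (2 * \<i> * \<nu>) x"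
      by (simp add: E_mult algebra_simps)
    then show "h x * E (2 * \<i> * (\<nu> + \<epsilon>)) x - (2 * \<i> * \<epsilon> * of_real (\<rho> x) * E (2 * \<i> * \<epsilon>) x * F x
         + E (2 * \<i> * \<epsilon>) x * (h x * E (2 * \<i> * \<nu>) x)) = - (2 * \<i> * \<epsilon> * of_real (\<rho> x) * E (2 * \<i> * \<epsilon>) x * F x)"
      by simp
  qed (use L_pos in auto)
  have "cmod (fourier h (\<nu> + \<epsilon>) t - E (2 * \<i> * \<epsilon>) t * F t) \<le> cmod (fourier h (\<nu> + \<epsilon>) 0 - E (2 * \<i> * \<epsilon>) 0 * F 0)
     + integral {0..t} (\<lambda>x. (2 * r * exp (2 * r * \<mu> L)) * (\<rho> x * cmod (F x)))"
  proof (rule primitive_on_norm_le(1)[OF P t])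
    show "(\<lambda>x. (2 * r * exp (2 * r * \<mu> L)) * (\<rho> x * cmod (F x))) integrable_on {0..t}"
      unfolding F_def by (intro integrable_on_mult_right weighted_fourier_integrable rho_absolutely_integrable h t)
    fix x assume x: "x \<in> {0..t}"
    then have xL: "x \<in> {0..L}" using t by auto
    have "cmod (- (2 * \<i> * \<epsilon> * of_real (\<rho> x) * E (2 * \<i> * \<epsilon>) x * F x))
       = 2 * cmod \<epsilon> * cmod (E (2 * \<i> * \<epsilon>) x) * (\<rho> x * cmod (F x))"
      using rho_pos[OF xL] by (simp add: norm_mult)
    also have "\<dots> \<le> (2 * r * exp (2 * r * \<mu> L)) * (\<rho> x * cmod (F x))"
      using rho_pos[OF xL] r by (intro mult_right_mono mult_mono E_le xL) (auto simp: \<epsilon>)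
    finally show "cmod (- (2 * \<i> * \<epsilon> * of_real (\<rho> x) * E (2 * \<i> * \<epsilon>) x * F x))
       \<le> (2 * r * exp (2 * r * \<mu> L)) * (\<rho> x * cmod (F x))" .
  qed
  also have "\<dots> = (2 * r * exp (2 * r * \<mu> L)) * integral {0..t} (\<lambda>x. \<rho> x * cmod (F x))"
    by (simp add: F_def)
  also have "\<dots> \<le> (2 * r * exp (2 * r * \<mu> L)) * amplitude w h \<nu>"
    unfolding F_def using r
    by (intro mult_left_mono weighted_fourier_le_amplitude w h rho_absolutely_integrable t) (auto intro!: less_imp_le[OF rho_pos])
  finally have 1: "cmod (fourier h (\<nu> + \<epsilon>) t - E (2 * \<i> * \<epsilon>) t * F t) \<le> (2 * r * exp (2 * r * \<mu> L)) * amplitude w h \<nu>" .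
  have 2: "cmod (E (2 * \<i> * \<epsilon>) t * F t) \<le> exp (2 * r * \<mu> L) * cmod (F t)"
    unfolding norm_mult by (intro mult_right_mono E_le t) simp
  have o: "0 \<le> amplitude w h \<nu>"
    using w rho_pos by (intro amplitude_nonneg w h) (meson less_imp_le order_trans)
  have "cmod (fourier h (\<nu> + \<epsilon>) t) \<le> exp (2 * r * \<mu> L) * cmod (F t) + (2 * r * exp (2 * r * \<mu> L)) * amplitude w h \<nu>"
    using norm_triangle_sub[of "fourier h (\<nu> + \<epsilon>) t" "E (2 * \<i> * \<epsilon>) t * F t"] 1 2 by linarith
  also have "\<dots> = exp (2 * r * \<mu> L) * (cmod (F t) + 2 * r * amplitude w h \<nu>)"
    by (simp add: algebra_simps)
  also have "\<dots> \<le> exp (2 * r * \<mu> L) * ((1 + 2 * r) * (cmod (F t) + amplitude w h \<nu>))"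
  proof (intro mult_left_mono)
    have "0 \<le> 2 * r * cmod (F t)" using r by simp
    then show "cmod (F t) + 2 * r * amplitude w h \<nu> \<le> (1 + 2 * r) * (cmod (F t) + amplitude w h \<nu>)"
      using o by (simp add: algebra_simps)
  qed simp
  finally show ?thesis by (simp add: F_def mult.assoc)
qed

text \<open>In a strip the exponential factors of the defect are bounded, and \<open>fourier_shift\<close> reduces what is left to
  the amplitudes at \<open>\<nu>\<close>.\<close>

lemma defect_strip:
  assumes f: "L1 f" and g: "L1 g"
  defines "w \<equiv> \<lambda>t. cmod (f t) + cmod (g t) + \<rho> t"
  obtains C where "0 < C" "\<And>lam \<nu>. Im \<nu> = 0 \<Longrightarrow> cmod (lam - \<nu>) \<le> r \<Longrightarrow> defect f g lam \<le> C * (amplitude w g \<nu> + amplitude w f (- \<nu>))"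
proof -
  have fc: "L1 (\<lambda>t. cmod (f t))" and gc: "L1 (\<lambda>t. cmod (g t))"
    by (intro absolutely_integrable_cmod f g)+
  note fi = integrable_if_absolutely[OF fc] and gi = integrable_if_absolutely[OF gc]
  have w: "L1 w"
    unfolding w_def by (intro set_integral_add fc gc rho_absolutely_integrable)
  have w_ge: "\<rho> t \<le> w t" "cmod (f t) \<le> w t" "cmod (g t) \<le> w t" "0 \<le> w t" if "t \<in> {0..L}" for t
    using rho_pos[OF that] by (auto simp: w_def)
  have L: "L \<in> {0..L}" using L_pos by simp
  define If where "If = integral {0..L} (\<lambda>t. cmod (f t))"
  define Ig where "Ig = integral {0..L} (\<lambda>t. cmod (g t))"
  have I0: "0 \<le> If" "0 \<le> Ig"
    unfolding If_def Ig_def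
    by (intro integral_nonneg integrable_if_absolutely fc gc norm_ge_zero)+
  define c1 where "c1 = exp (2 * r * \<mu> L) * (1 + 2 * r)"
  define c2 where "c2 = exp (2 * r * \<mu> L)"
  define C where "C = 2 * c1 + c2 * c1 * (3 * If + 1) + 2 * c2 * c1 + c2 * c1 * (Ig + 1)"
  have est: "defect f g lam \<le> C * (amplitude w g \<nu> + amplitude w f (- \<nu>))"
    if \<nu>: "Im \<nu> = 0" and lam: "cmod (lam - \<nu>) \<le> r" for lam \<nu>
  proof -
    have r: "0 \<le> r" using lam norm_ge_zero[of "lam - \<nu>"] by linarith
    have Im: "\<bar>Im lam\<bar> \<le> r" using abs_Im_le_cmod[of "lam - \<nu>"] lam \<nu> by simp
    have c: "0 \<le> c1" "0 \<le> c2" using r by (auto simp: c1_def c2_def)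
    define o1 o2 where "o1 = amplitude w g \<nu>" and "o2 = amplitude w f (- \<nu>)"
    have o: "0 \<le> o1" "0 \<le> o2" unfolding o1_def o2_def by (intro amplitude_nonneg w f g w_ge, assumption)+
    have G: "cmod (fourier g lam t) \<le> c1 * (cmod (fourier g \<nu> t) + o1)" if "t \<in> {0..L}" for t
      using fourier_shift[OF g lam that w w_ge(1), of \<nu>] by (simp add: c1_def o1_def)
    have F: "cmod (fourier f (- lam) t) \<le> c1 * (cmod (fourier f (- \<nu>) t) + o2)" if "t \<in> {0..L}" for t
      using fourier_shift[OF f _ that w w_ge(1), of "\<nu> - lam" r "- \<nu>"] lam
      by (simp add: c1_def o2_def norm_minus_commute)
    have Re: "\<bar>Re (- 2 * \<i> * lam)\<bar> \<le> 2 * r" "\<bar>Re (2 * \<i> * lam)\<bar> \<le> 2 * r" using Im by auto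
    have ends: "cmod (fourier g \<nu> L) \<le> o1" "cmod (fourier f (- \<nu>) L) \<le> o2"
    proof -
      have "cmod (fourier h \<nu>' L) \<le> amplitude w h \<nu>'" if "L1 h" for h \<nu>'
        unfolding amplitude_def
        using integral_nonneg[OF weighted_fourier_integrable[OF w that L, of \<nu>']] w_ge(4)
        by simp
      then show "cmod (fourier g \<nu> L) \<le> o1" "cmod (fourier f (- \<nu>) L) \<le> o2"
        unfolding o1_def o2_def using f g by blast+
    qed
    have GL: "cmod (fourier g lam L) \<le> c1 * (2 * o1)"
      using G[OF L] mult_left_mono[OF _ c(1), of "cmod (fourier g \<nu> L) + o1" "2 * o1"] ends(1) by linarith
    have FL: "cmod (fourier f (- lam) L) \<le> c1 * (2 * o2)"
      using F[OF L] mult_left_mono[OF _ c(1), of "cmod (fourier f (- \<nu>) L) + o2" "2 * o2"] ends(2) by linarith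
    have t3: "cmod (E (2 * \<i> * lam) L * fourier f (- lam) L) \<le> c2 * (c1 * (2 * o2))"
      unfolding norm_mult c2_def using c o by (intro mult_mono norm_E_le Re FL L) auto
    have t2: "integral {0..L} (\<lambda>t. cmod (f t) * cmod (E (- 2 * \<i> * lam) t * (fourier g lam L - fourier g lam t)))
      \<le> c2 * c1 * (3 * If + 1) * o1"
    proof -
      have "integral {0..L} (\<lambda>t. cmod (f t) * cmod (E (- 2 * \<i> * lam) t * (fourier g lam L - fourier g lam t)))
        \<le> integral {0..L} (\<lambda>t. c2 * c1 * (3 * o1) * cmod (f t) + c2 * c1 * (cmod (f t) * cmod (fourier g \<nu> t)))"
      proof (rule integral_le)
        show "(\<lambda>t. cmod (f t) * cmod (E (- 2 * \<i> * lam) t * (fourier g lam L - fourier g lam t))) integrable_on {0..L}"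
          by (intro integrable_mult_continuous fc continuous_intros E_continuous fourier_continuous g)
        show "(\<lambda>t. c2 * c1 * (3 * o1) * cmod (f t) + c2 * c1 * (cmod (f t) * cmod (fourier g \<nu> t))) integrable_on {0..L}"
          by (intro integrable_add integrable_on_mult_right weighted_fourier_integrable fc g L fi)
        fix t assume t: "t \<in> {0..L}"
        have "cmod (fourier g lam L - fourier g lam t) \<le> c1 * (2 * o1) + c1 * (cmod (fourier g \<nu> t) + o1)"
          using norm_triangle_ineq4[of "fourier g lam L" "fourier g lam t"] GL G[OF t] by linarith
        also have "\<dots> = c1 * (3 * o1 + cmod (fourier g \<nu> t))" by (simp add: algebra_simps)
        finally have "cmod (E (- 2 * \<i> * lam) t * (fourier g lam L - fourier g lam t)) \<le> c2 * (c1 * (3 * o1 + cmod (fourier g \<nu> t)))"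
          unfolding norm_mult c2_def using c o by (intro mult_mono norm_E_le Re t) auto
        from mult_left_mono[OF this norm_ge_zero[of "f t"]]
        show "cmod (f t) * cmod (E (- 2 * \<i> * lam) t * (fourier g lam L - fourier g lam t))
           \<le> c2 * c1 * (3 * o1) * cmod (f t) + c2 * c1 * (cmod (f t) * cmod (fourier g \<nu> t))"
          by (simp add: algebra_simps)
      qed
      also have "\<dots> = c2 * c1 * (3 * o1) * If + c2 * c1 * integral {0..L} (\<lambda>t. cmod (f t) * cmod (fourier g \<nu> t))"
        by (subst integral_add)
           (auto simp: If_def intro!: integrable_on_mult_right weighted_fourier_integrable fc g L fi)
      also have "\<dots> \<le> c2 * c1 * (3 * o1) * If + c2 * c1 * o1"
        unfolding o1_def using c
        by (intro add_left_mono mult_left_mono weighted_fourier_le_amplitude w g fc L w_ge) auto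
      finally show ?thesis by (simp add: algebra_simps)
    qed
    have t4: "integral {0..L} (\<lambda>t. cmod (g t) * cmod (E (2 * \<i> * lam) L * fourier f (- lam) t)) \<le> c2 * c1 * (Ig + 1) * o2"
    proof -
      have "integral {0..L} (\<lambda>t. cmod (g t) * cmod (E (2 * \<i> * lam) L * fourier f (- lam) t))
        \<le> integral {0..L} (\<lambda>t. c2 * c1 * o2 * cmod (g t) + c2 * c1 * (cmod (g t) * cmod (fourier f (- \<nu>) t)))"
      proof (rule integral_le)
        show "(\<lambda>t. cmod (g t) * cmod (E (2 * \<i> * lam) L * fourier f (- lam) t)) integrable_on {0..L}"
          by (intro integrable_mult_continuous gc continuous_intros fourier_continuous f)
        show "(\<lambda>t. c2 * c1 * o2 * cmod (g t) + c2 * c1 * (cmod (g t) * cmod (fourier f (- \<nu>) t))) integrable_on {0..L}"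
          by (intro integrable_add integrable_on_mult_right weighted_fourier_integrable gc f L gi)
        fix t assume t: "t \<in> {0..L}"
        have "cmod (E (2 * \<i> * lam) L * fourier f (- lam) t) \<le> c2 * (c1 * (cmod (fourier f (- \<nu>) t) + o2))"
          unfolding norm_mult c2_def using c o by (intro mult_mono norm_E_le Re L F t) auto
        from mult_left_mono[OF this norm_ge_zero[of "g t"]]
        show "cmod (g t) * cmod (E (2 * \<i> * lam) L * fourier f (- lam) t)
           \<le> c2 * c1 * o2 * cmod (g t) + c2 * c1 * (cmod (g t) * cmod (fourier f (- \<nu>) t))"
          by (simp add: algebra_simps)
      qed
      also have "\<dots> = c2 * c1 * o2 * Ig + c2 * c1 * integral {0..L} (\<lambda>t. cmod (g t) * cmod (fourier f (- \<nu>) t))"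
        by (subst integral_add)
           (auto simp: Ig_def intro!: integrable_on_mult_right weighted_fourier_integrable gc f L gi)
      also have "\<dots> \<le> c2 * c1 * o2 * Ig + c2 * c1 * o2"
        unfolding o2_def using c
        by (intro add_left_mono mult_left_mono weighted_fourier_le_amplitude w f gc L w_ge) auto
      finally show ?thesis by (simp add: algebra_simps)
    qed
    define X Y where "X = 2 * c1 + c2 * c1 * (3 * If + 1)" and "Y = 2 * c2 * c1 + c2 * c1 * (Ig + 1)"
    have XY: "0 \<le> X" "0 \<le> Y" using c I0 by (auto simp: X_def Y_def)
    have "defect f g lam \<le> X * o1 + Y * o2"
      unfolding defect_def X_def Y_def using GL t2 t3 t4 by (simp add: algebra_simps)
    also have "\<dots> \<le> (X + Y) * (o1 + o2)"
      using mult_nonneg_nonneg[OF XY(1) o(2)] mult_nonneg_nonneg[OF XY(2) o(1)] by (simp add: algebra_simps)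
    also have "X + Y = C" by (simp add: X_def Y_def C_def)
    finally show ?thesis by (simp add: o1_def o2_def)
  qed
  show ?thesis
  proof (rule that[of "\<bar>C\<bar> + 1"])
    fix lam \<nu> assume a: "Im \<nu> = 0" "cmod (lam - \<nu>) \<le> r"
    have "0 \<le> amplitude w g \<nu> + amplitude w f (- \<nu>)"
      using amplitude_nonneg[OF w g w_ge(4)] amplitude_nonneg[OF w f w_ge(4)] by (intro add_nonneg_nonneg) auto
    then have "C * (amplitude w g \<nu> + amplitude w f (- \<nu>)) \<le> (\<bar>C\<bar> + 1) * (amplitude w g \<nu> + amplitude w f (- \<nu>))"
      by (intro mult_right_mono) auto
    then show "defect f g lam \<le> (\<bar>C\<bar> + 1) * (amplitude w g \<nu> + amplitude w f (- \<nu>))" using est[OF a] by linarith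
  qed simp
qed

section \<open>Bessel's inequality and square summability\<close>

definition freq :: "real \<Rightarrow> int \<Rightarrow> real" where "freq t0 n = t0 + of_int n * pi / \<mu> L"

lemma E_integral_full:
  assumes "c \<noteq> 0" "E c L = 1"
  shows "((\<lambda>x. of_real (\<rho> x) * E c x) has_integral 0) {0..L}"
proof -
  have "integral {0..L} (\<lambda>x. c * of_real (\<rho> x) * E c x) = 0"
    using primitive_onD[OF primitive_on_E[of c], of L] L_pos assms(2) by simp
  moreover have "(\<lambda>x. c * of_real (\<rho> x) * E c x) integrable_on {0..L}"
    by (rule primitive_on_integrable(2)[OF primitive_on_E]) simp
  ultimately have "((\<lambda>x. c * of_real (\<rho> x) * E c x) has_integral 0) {0..L}"
    by (metis integrable_integral)
  from has_integral_mult_right[OF this, of "1 / c"] show ?thesis using assms(1) by simp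
qed

lemma E_orthogonal:
  "((\<lambda>x. of_real (\<rho> x) * E (2 * \<i> * (of_real (freq t0 n) - of_real (freq t0 k))) x) has_integral
      (if n = k then of_real (\<mu> L) else 0)) {0..L}"
proof (cases "n = k")
  case True
  have "((\<lambda>x. complex_of_real (\<rho> x)) has_integral of_real (\<mu> L)) {0..L}"
    using has_integral_linear[OF has_integral_rho[of 0 L] bounded_linear_of_real] L_pos mu_0 by (simp add: o_def)
  then show ?thesis using True by (simp add: E_def)
next
  case False
  define c where "c = 2 * \<i> * (of_real (freq t0 n) - of_real (freq t0 k))"
  have fd: "freq t0 n - freq t0 k = of_int (n - k) * pi / \<mu> L"
    by (simp add: freq_def diff_divide_distrib left_diff_distrib)
  then have c: "c = 2 * \<i> * of_real (of_int (n - k) * pi / \<mu> L)"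
    unfolding c_def by (metis of_real_diff)
  have "c \<noteq> 0" using False mu_L_pos by (simp add: c)
  moreover have "c * of_real (\<mu> L) = 2 * of_int (n - k) * of_real pi * \<i>"
    using mu_L_pos by (simp add: c)
  then have "E c L = 1"
    using exp_integer_2pi[OF Ints_of_int[of "n - k"]]
    by (simp only: E_def of_real_mult of_real_numeral of_real_of_int_eq)
  ultimately show ?thesis
    using E_integral_full[of c] False by (simp add: c_def)
qed

text \<open>The exponentials at the frequencies \<open>freq t0 n\<close> are orthogonal with respect to the weight \<open>\<rho>\<close>, since
  their phases at \<open>L\<close> differ by multiples of \<open>2 * pi\<close>.  The inequality follows by integrating
  \<open>2 * Re (h * P) \<le> \<bar>h\<bar>\<^sup>2 / \<rho>0 + \<rho> * \<bar>P\<bar>\<^sup>2\<close>, where the coefficients of the exponential sum \<open>P\<close>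
  are the conjugates of the Fourier integrals in question, divided by \<open>\<mu> L\<close>.  Truncation at \<open>t\<close> is harmless, because \<open>\<rho> * \<bar>P\<bar>\<^sup>2\<close> is nonnegative
  and may be integrated up to \<open>L\<close>.\<close>

lemma bessel:
  assumes h: "L2 h" and t: "t \<in> {0..L}" and A: "finite A"
  shows "(\<Sum>n\<in>A. (cmod (fourier h (of_real (freq t0 n)) t))\<^sup>2) \<le> \<mu> L / \<rho>0 * square_norm h"
proof -
  define T where "T n = complex_of_real (freq t0 n)" for n
  define F where "F n = fourier h (T n) t" for n
  define d where "d n = F n / of_real (\<mu> L)" for n
  \<comment> \<open>With respect to the weight \<open>\<rho>\<close>, the projection of \<open>cnj h / \<rho>\<close>, truncated at \<open>t\<close>, to the span of the exponentials.\<close>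
  define P where "P x = (\<Sum>n\<in>A. cnj (d n) * E (2 * \<i> * T n) x)" for x
  define Q where "Q = (\<Sum>n\<in>A. (cmod (F n))\<^sup>2)"
  have cont_P: "continuous_on {0..L} P"
    unfolding P_def by (intro continuous_intros E_continuous)
  have cnj_E: "cnj (E (2 * \<i> * T n) x) = E (- 2 * \<i> * T n) x" for n x
    by (simp add: E_def T_def exp_cnj)
  have sqF: "cnj (F n) * F n = of_real ((cmod (F n))\<^sup>2)" for n
    using complex_norm_square[of "F n"] by (simp add: mult.commute)
  have PP: "((\<lambda>x. \<rho> x * (cmod (P x))\<^sup>2) has_integral Q / \<mu> L) {0..L}"
  proof -
    have "((\<lambda>x. \<Sum>n\<in>A. \<Sum>k\<in>A. cnj (d n) * d k * (of_real (\<rho> x) * E (2 * \<i> * (T n - T k)) x)) has_integral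
       (\<Sum>n\<in>A. \<Sum>k\<in>A. cnj (d n) * d k * (if n = k then of_real (\<mu> L) else 0))) {0..L}"
      unfolding T_def by (intro has_integral_sum has_integral_mult_right E_orthogonal A)
    moreover have "(\<Sum>n\<in>A. \<Sum>k\<in>A. cnj (d n) * d k * (of_real (\<rho> x) * E (2 * \<i> * (T n - T k)) x))
       = of_real (\<rho> x * (cmod (P x))\<^sup>2)" for x
    proof -
      have "of_real (\<rho> x * (cmod (P x))\<^sup>2) = of_real (\<rho> x) * (P x * cnj (P x))"
        by (simp only: of_real_mult complex_norm_square)
      also have "P x * cnj (P x) = (\<Sum>n\<in>A. \<Sum>k\<in>A. (cnj (d n) * E (2 * \<i> * T n) x) * (d k * E (- 2 * \<i> * T k) x))"
        by (simp add: P_def cnj_E sum_product)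
      also have "of_real (\<rho> x) * \<dots> = (\<Sum>n\<in>A. \<Sum>k\<in>A. cnj (d n) * d k * (of_real (\<rho> x) * (E (2 * \<i> * T n) x * E (- 2 * \<i> * T k) x)))"
        by (simp add: sum_distrib_left mult_ac)
      also have "\<dots> = (\<Sum>n\<in>A. \<Sum>k\<in>A. cnj (d n) * d k * (of_real (\<rho> x) * E (2 * \<i> * (T n - T k)) x))"
        by (simp add: E_mult algebra_simps)
      finally show ?thesis by simp
    qed
    moreover have "(\<Sum>n\<in>A. \<Sum>k\<in>A. cnj (d n) * d k * (if n = k then of_real (\<mu> L) else 0)) = of_real (Q / \<mu> L)"
    proof -
      have "(\<Sum>n\<in>A. \<Sum>k\<in>A. cnj (d n) * d k * (if n = k then of_real (\<mu> L) else 0)) = (\<Sum>n\<in>A. cnj (d n) * d n * of_real (\<mu> L))"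
        using A by (intro sum.cong) (auto simp: if_distrib cong: if_cong)
      also have "\<dots> = (\<Sum>n\<in>A. of_real ((cmod (F n))\<^sup>2 / \<mu> L))"
        using mu_L_pos sqF by (intro sum.cong) (auto simp: d_def)
      finally show ?thesis by (simp add: Q_def sum_divide_distrib)
    qed
    ultimately have "((\<lambda>x. complex_of_real (\<rho> x * (cmod (P x))\<^sup>2)) has_integral of_real (Q / \<mu> L)) {0..L}"
      by simp
    from has_integral_linear[OF this bounded_linear_Re] show ?thesis by (simp add: o_def)
  qed
  have hP: "((\<lambda>x. Re (h x * P x)) has_integral Q / \<mu> L) {0..t}"
  proof -
    have "((\<lambda>x. h x * E (2 * \<i> * T n) x) has_integral F n) {0..t}" for n
      unfolding F_def fourier_def using t by (intro integrable_integral fourier_integrand L2D h) auto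
    then have "((\<lambda>x. \<Sum>n\<in>A. cnj (d n) * (h x * E (2 * \<i> * T n) x)) has_integral (\<Sum>n\<in>A. cnj (d n) * F n)) {0..t}"
      by (intro has_integral_sum has_integral_mult_right A)
    moreover have "(\<Sum>n\<in>A. cnj (d n) * (h x * E (2 * \<i> * T n) x)) = h x * P x" for x
      by (simp add: P_def sum_distrib_left mult_ac)
    moreover have "(\<Sum>n\<in>A. cnj (d n) * F n) = of_real (Q / \<mu> L)"
      by (simp add: d_def Q_def sqF sum_divide_distrib)
    ultimately have "((\<lambda>x. h x * P x) has_integral of_real (Q / \<mu> L)) {0..t}" by simp
    from has_integral_linear[OF this bounded_linear_Re] show ?thesis by (simp add: o_def)
  qed
  note PPi = has_integral_integrable[OF PP]
  have PPt: "(\<lambda>x. \<rho> x * (cmod (P x))\<^sup>2) integrable_on {0..t}"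
    by (rule integrable_subinterval_real[OF PPi]) (use t in auto)
  have "2 * (Q / \<mu> L) \<le> integral {0..t} (\<lambda>x. (cmod (h x))\<^sup>2) / \<rho>0 + integral {0..t} (\<lambda>x. \<rho> x * (cmod (P x))\<^sup>2)"
  proof (rule has_integral_le[OF has_integral_mult_right[OF hP, of 2]])
    show "((\<lambda>x. (cmod (h x))\<^sup>2 / \<rho>0 + \<rho> x * (cmod (P x))\<^sup>2) has_integral
        (integral {0..t} (\<lambda>x. (cmod (h x))\<^sup>2) / \<rho>0 + integral {0..t} (\<lambda>x. \<rho> x * (cmod (P x))\<^sup>2))) {0..t}"
      using t by (intro has_integral_add has_integral_divide integrable_integral square_norm_sub h PPt) auto
    fix x assume "x \<in> {0..t}"
    then have x: "x \<in> {0..L}" using t by auto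
    have "0 \<le> (cmod (h x) - \<rho>0 * cmod (P x))\<^sup>2" by simp
    then have "2 * \<rho>0 * (cmod (h x) * cmod (P x)) \<le> (cmod (h x))\<^sup>2 + \<rho>0\<^sup>2 * (cmod (P x))\<^sup>2"
      by (simp add: power2_eq_square algebra_simps)
    then have "2 * (cmod (h x) * cmod (P x)) \<le> (cmod (h x))\<^sup>2 / \<rho>0 + \<rho>0 * (cmod (P x))\<^sup>2"
      using rho0_pos by (simp add: field_simps power2_eq_square)
    moreover have "\<rho>0 * (cmod (P x))\<^sup>2 \<le> \<rho> x * (cmod (P x))\<^sup>2"
      by (intro mult_right_mono rho_ge x) auto
    moreover have "Re (h x * P x) \<le> cmod (h x) * cmod (P x)"
      using complex_Re_le_cmod[of "h x * P x"] by (simp add: norm_mult)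
    ultimately show "2 * Re (h x * P x) \<le> (cmod (h x))\<^sup>2 / \<rho>0 + \<rho> x * (cmod (P x))\<^sup>2" by linarith
  qed
  also have "integral {0..t} (\<lambda>x. \<rho> x * (cmod (P x))\<^sup>2) \<le> integral {0..L} (\<lambda>x. \<rho> x * (cmod (P x))\<^sup>2)"
    using t by (intro integral_subset_le PPi PPt) (auto intro!: mult_nonneg_nonneg less_imp_le[OF rho_pos])
  also have "integral {0..L} (\<lambda>x. \<rho> x * (cmod (P x))\<^sup>2) = Q / \<mu> L"
    by (rule integral_unique[OF PP])
  also have "integral {0..t} (\<lambda>x. (cmod (h x))\<^sup>2) / \<rho>0 \<le> square_norm h / \<rho>0"
    using t rho0_pos by (intro divide_right_mono square_norm_sub h) auto
  finally have "Q / \<mu> L \<le> square_norm h / \<rho>0" by simp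
  then have "Q \<le> \<mu> L / \<rho>0 * square_norm h"
    using mu_L_pos by (simp add: field_simps)
  then show ?thesis by (simp add: Q_def F_def T_def)
qed

text \<open>The bound in Bessel's inequality is the same for all truncation points, hence it survives taking
  weighted means.\<close>

lemma amplitude_square_sum_le:
  assumes h: "L2 h" and w: "L1 w" "\<And>t. t \<in> {0..L} \<Longrightarrow> 0 \<le> w t" and A: "finite A"
  shows "(\<Sum>n\<in>A. (amplitude w h (of_real (freq t0 n)))\<^sup>2) \<le> 2 * (1 + (integral {0..L} w)\<^sup>2) * (\<mu> L / \<rho>0 * square_norm h)"
proof -
  define B where "B = \<mu> L / \<rho>0 * square_norm h"
  define F where "F n = fourier h (of_real (freq t0 n))" for n
  define W where "W = integral {0..L} w"
  note ha = L2D(1)[OF h]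
  have L: "L \<in> {0..L}" using L_pos by simp
  have W0: "0 \<le> W"
    unfolding W_def using w by (intro integral_nonneg integrable_if_absolutely) auto
  have cont: "continuous_on {0..L} (F n)" for n
    unfolding F_def by (rule fourier_continuous[OF ha])
  have i2: "(\<lambda>t. w t * (cmod (F n t))\<^sup>2) integrable_on {0..L}" for n
    by (intro integrable_mult_continuous w continuous_intros cont)
  have "(\<Sum>n\<in>A. (amplitude w h (of_real (freq t0 n)))\<^sup>2)
     \<le> (\<Sum>n\<in>A. 2 * (cmod (F n L))\<^sup>2 + 2 * (W * integral {0..L} (\<lambda>t. w t * (cmod (F n t))\<^sup>2)))"
  proof (rule sum_mono)
    fix n
    have "(integral {0..L} (\<lambda>t. w t * cmod (F n t)))\<^sup>2 \<le> W * integral {0..L} (\<lambda>t. w t * (cmod (F n t))\<^sup>2)"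
      unfolding W_def by (intro cauchy_schwarz_weighted w continuous_intros cont)
    moreover have "(a + b)\<^sup>2 \<le> 2 * a\<^sup>2 + 2 * b\<^sup>2" for a b :: real
      using sum_squares_bound[of a b] by (simp add: power2_sum)
    ultimately show "(amplitude w h (of_real (freq t0 n)))\<^sup>2
       \<le> 2 * (cmod (F n L))\<^sup>2 + 2 * (W * integral {0..L} (\<lambda>t. w t * (cmod (F n t))\<^sup>2))"
      unfolding amplitude_def F_def[symmetric] by (smt (verit, best))
  qed
  also have "\<dots> = 2 * (\<Sum>n\<in>A. (cmod (F n L))\<^sup>2) + 2 * W * (\<Sum>n\<in>A. integral {0..L} (\<lambda>t. w t * (cmod (F n t))\<^sup>2))"
    by (simp add: sum.distrib sum_distrib_left mult.assoc)
  also have "(\<Sum>n\<in>A. (cmod (F n L))\<^sup>2) \<le> B"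
    unfolding F_def B_def by (rule bessel[OF h L A])
  also have "(\<Sum>n\<in>A. integral {0..L} (\<lambda>t. w t * (cmod (F n t))\<^sup>2)) = integral {0..L} (\<lambda>t. \<Sum>n\<in>A. w t * (cmod (F n t))\<^sup>2)"
    by (rule integral_sum[symmetric]) (auto intro: A i2)
  also have "\<dots> \<le> integral {0..L} (\<lambda>t. w t * B)"
  proof (rule integral_le)
    show "(\<lambda>t. \<Sum>n\<in>A. w t * (cmod (F n t))\<^sup>2) integrable_on {0..L}"
      by (intro integrable_sum A i2)
    show "(\<lambda>t. w t * B) integrable_on {0..L}"
      by (intro integrable_on_mult_left integrable_if_absolutely w)
    fix t assume t: "t \<in> {0..L}"
    show "(\<Sum>n\<in>A. w t * (cmod (F n t))\<^sup>2) \<le> w t * B"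
      unfolding sum_distrib_left[symmetric] F_def B_def by (intro mult_left_mono bessel h t A w)
  qed
  also have "integral {0..L} (\<lambda>t. w t * B) = W * B" by (simp add: W_def)
  finally have "(\<Sum>n\<in>A. (amplitude w h (of_real (freq t0 n)))\<^sup>2) \<le> 2 * B + 2 * W * (W * B)"
    using W0 by (simp add: mult_left_mono)
  then show ?thesis by (simp add: B_def W_def power2_eq_square algebra_simps)
qed

lemma amplitude_square_summable:
  assumes h: "L2 h" and w: "L1 w" "\<And>t. t \<in> {0..L} \<Longrightarrow> 0 \<le> w t"
  shows "(\<lambda>n. (amplitude w h (of_real (freq t0 n)))\<^sup>2) summable_on UNIV"
    and "(\<lambda>n. (amplitude w h (- of_real (freq t0 n)))\<^sup>2) summable_on UNIV"
proof -
  show *: "(\<lambda>n. (amplitude w h (of_real (freq t0 n)))\<^sup>2) summable_on UNIV" for t0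
    using amplitude_square_sum_le[OF h w]
    by (intro nonneg_bdd_above_summable_on bdd_aboveI2[where M = "2 * (1 + (integral {0..L} w)\<^sup>2) * (\<mu> L / \<rho>0 * square_norm h)"]) auto
  have neg: "- complex_of_real (freq t0 n) = of_real (freq (- t0) (- n))" for n
    by (simp add: freq_def)
  show "(\<lambda>n. (amplitude w h (- of_real (freq t0 n)))\<^sup>2) summable_on UNIV"
    unfolding neg using *[of "- t0"] summable_on_reindex_bij_betw[OF bij_uminus, of "\<lambda>n. (amplitude w h (of_real (freq (- t0) n)))\<^sup>2"]
    by simp
qed

lemma defect_square_summable:
  assumes f: "L2 f" and g: "L2 g"
  shows "(\<lambda>n. (defect f g (of_real (freq t0 n)))\<^sup>2) summable_on UNIV"
proof -
  note fa = L2D(1)[OF f] and ga = L2D(1)[OF g]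
  define w where "w = (\<lambda>t. cmod (f t) + cmod (g t) + \<rho> t)"
  have w: "L1 w"
    unfolding w_def by (intro set_integral_add absolutely_integrable_cmod fa ga rho_absolutely_integrable)
  have w0: "0 \<le> w t" if "t \<in> {0..L}" for t
    using rho_pos[OF that] by (simp add: w_def add_nonneg_nonneg)
  obtain C where C: "0 < C" "\<And>lam \<nu>. Im \<nu> = 0 \<Longrightarrow> cmod (lam - \<nu>) \<le> 0 \<Longrightarrow> defect f g lam \<le> C * (amplitude w g \<nu> + amplitude w f (- \<nu>))"
    using defect_strip[OF fa ga, of 0, folded w_def] by blast
  have nn: "0 \<le> defect f g lam" for lam
    unfolding defect_def using ga fa
    by (intro add_nonneg_nonneg integral_nonneg integrable_if_absolutely
        absolutely_integrable_mult_continuous(1) absolutely_integrable_cmod continuous_intros E_continuous fourier_continuous) auto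
  show ?thesis
  proof (rule summable_on_comparison_test)
    show "(\<lambda>n. C\<^sup>2 * (2 * ((amplitude w g (of_real (freq t0 n)))\<^sup>2 + (amplitude w f (- of_real (freq t0 n)))\<^sup>2))) summable_on UNIV"
      by (intro summable_on_cmult_right summable_on_add amplitude_square_summable f g w w0)
    fix n
    define a b where "a = amplitude w g (of_real (freq t0 n))" and "b = amplitude w f (- of_real (freq t0 n))"
    have "defect f g (of_real (freq t0 n)) \<le> C * (a + b)"
      unfolding a_def b_def by (rule C(2)) auto
    then have "(defect f g (of_real (freq t0 n)))\<^sup>2 \<le> (C * (a + b))\<^sup>2"
      using nn by (rule power_mono)
    also have "\<dots> = C\<^sup>2 * (a + b)\<^sup>2" by (simp add: power_mult_distrib)
    also have "\<dots> \<le> C\<^sup>2 * (2 * (a\<^sup>2 + b\<^sup>2))"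
      using sum_squares_bound[of a b] by (intro mult_left_mono) (auto simp: power2_sum)
    finally show "(defect f g (of_real (freq t0 n)))\<^sup>2 \<le> C\<^sup>2 * (2 * ((amplitude w g (of_real (freq t0 n)))\<^sup>2 + (amplitude w f (- of_real (freq t0 n)))\<^sup>2))"
      unfolding a_def b_def .
  qed simp
qed

lemma finite_above_threshold_if_summable:
  fixes a :: "int \<Rightarrow> real"
  assumes "a summable_on UNIV" "\<And>n. 0 \<le> a n" "0 < \<delta>"
  shows "finite {n. \<delta> \<le> a n}"
proof (rule ccontr)
  assume inf: "infinite {n. \<delta> \<le> a n}"
  \<comment> \<open>At most \<open>infsum a UNIV / \<delta>\<close> terms can reach the threshold \<open>\<delta>\<close>.\<close>
  obtain K :: nat where K: "infsum a UNIV / \<delta> < K" using reals_Archimedean2 by blast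
  obtain B where B: "finite B" "card B = K" "B \<subseteq> {n. \<delta> \<le> a n}"
    using infinite_arbitrarily_large[OF inf] by blast
  have "K * \<delta> = (\<Sum>n\<in>B. \<delta>)" using B by simp
  also have "\<dots> \<le> sum a B" using B by (intro sum_mono) auto
  also have "\<dots> \<le> infsum a UNIV" using assms B by (intro finite_sum_le_infsum) auto
  finally show False using K assms(3) by (simp add: field_simps)
qed

text \<open>A Riemann--Lebesgue lemma, uniform in the closed upper half-plane.  Above a horizontal line
  \<open>defect_high\<close> suffices.  In the strip below it, \<open>lam\<close> is within bounded distance of a real frequency
  \<open>freq 0 n\<close>, where the amplitudes tend to zero because their squares are summable.\<close>

lemma defect_vanishes:
  assumes f: "L2 f" and g: "L2 g" and \<delta>: "0 < \<delta>"
  obtains R where "\<And>lam. 0 \<le> Im lam \<Longrightarrow> R \<le> cmod lam \<Longrightarrow> defect f g lam \<le> \<delta>"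
proof -
  note fa = L2D(1)[OF f] and ga = L2D(1)[OF g]
  obtain C where C: "\<And>lam. 0 < Im lam \<Longrightarrow> defect f g lam \<le> C / sqrt (Im lam)"
    using defect_high[OF f g] by blast
  \<comment> \<open>Above height \<open>y\<close> the bound \<open>C / sqrt (Im lam)\<close> is at most \<open>\<delta>\<close>.\<close>
  define y where "y = (\<bar>C\<bar> / \<delta>)\<^sup>2 + 1"
  have high: "defect f g lam \<le> \<delta>" if "y \<le> Im lam" for lam
  proof -
    have pos: "0 < Im lam" using that by (smt (verit) y_def zero_le_power2)
    have "\<bar>C\<bar> / \<delta> \<le> sqrt (Im lam)"
      using that by (intro real_le_rsqrt) (simp add: y_def)
    then have "\<bar>C\<bar> \<le> \<delta> * sqrt (Im lam)" using \<delta> by (simp add: field_simps)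
    then have "C / sqrt (Im lam) \<le> \<delta>" using pos by (simp add: field_simps)
    then show ?thesis using C[OF pos] by linarith
  qed
  define w where "w = (\<lambda>t. cmod (f t) + cmod (g t) + \<rho> t)"
  have w: "L1 w"
    unfolding w_def by (intro set_integral_add absolutely_integrable_cmod fa ga rho_absolutely_integrable)
  have w0: "0 \<le> w t" if "t \<in> {0..L}" for t
    using rho_pos[OF that] by (simp add: w_def add_nonneg_nonneg)
  define r where "r = y + pi / \<mu> L"
  obtain C' where C': "0 < C'" "\<And>lam \<nu>. Im \<nu> = 0 \<Longrightarrow> cmod (lam - \<nu>) \<le> r \<Longrightarrow> defect f g lam \<le> C' * (amplitude w g \<nu> + amplitude w f (- \<nu>))"
    using defect_strip[OF fa ga, of r, folded w_def] by blast
  define \<delta>' where "\<delta>' = \<delta> / (2 * C')"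
  have \<delta>': "0 < \<delta>'" using \<delta> C' by (simp add: \<delta>'_def)
  \<comment> \<open>The frequencies at which an amplitude is not yet small.\<close>
  define Bad where "Bad = {n. \<delta>'\<^sup>2 \<le> (amplitude w g (of_real (freq 0 n)))\<^sup>2} \<union> {n. \<delta>'\<^sup>2 \<le> (amplitude w f (- of_real (freq 0 n)))\<^sup>2}"
  have "finite Bad"
    unfolding Bad_def using \<delta>' w0
    by (intro finite_UnI finite_above_threshold_if_summable amplitude_square_summable f g w) auto
  then obtain N where N: "\<bar>n\<bar> < N" if "n \<in> Bad" for n
    using that[of "Max (abs ` Bad) + 1"] by (simp add: Max_ge less_add_one le_less_trans)
  define R where "R = y + pi / \<mu> L + of_int \<bar>N\<bar> * pi / \<mu> L"
  have "defect f g lam \<le> \<delta>" if lam: "0 \<le> Im lam" "R \<le> cmod lam" for lam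
  proof (cases "y \<le> Im lam")
    case True
    then show ?thesis by (rule high)
  next
    case False
    define n where "n = \<lfloor>Re lam * \<mu> L / pi\<rfloor>"
    have "of_int n \<le> Re lam * \<mu> L / pi" "Re lam * \<mu> L / pi < of_int n + 1"
      by (simp_all add: n_def)
    then have Re: "freq 0 n \<le> Re lam" "Re lam \<le> freq 0 n + pi / \<mu> L"
      using mu_L_pos by (simp_all add: freq_def field_simps)
    have "cmod (lam - of_real (freq 0 n)) \<le> \<bar>Re lam - freq 0 n\<bar> + \<bar>Im lam\<bar>"
      using cmod_le[of "lam - of_real (freq 0 n)"] by simp
    also have "\<dots> \<le> r" using Re lam False by (simp add: r_def)
    finally have d: "defect f g lam \<le> C' * (amplitude w g (of_real (freq 0 n)) + amplitude w f (- of_real (freq 0 n)))"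
      by (intro C') auto
    have "R \<le> \<bar>Re lam\<bar> + \<bar>Im lam\<bar>" using lam cmod_le[of lam] by linarith
    also have "\<dots> \<le> \<bar>freq 0 n\<bar> + pi / \<mu> L + y" using Re lam False by linarith
    finally have "of_int \<bar>N\<bar> * (pi / \<mu> L) \<le> of_int \<bar>n\<bar> * (pi / \<mu> L)"
      using mu_L_pos by (simp add: R_def freq_def abs_mult)
    then have "real_of_int \<bar>N\<bar> \<le> of_int \<bar>n\<bar>" using mu_L_pos by (simp only: mult_le_cancel_right_pos divide_pos_pos pi_gt_zero)
    then have "\<bar>N\<bar> \<le> \<bar>n\<bar>" by linarith
    then have "n \<notin> Bad" using N[of n] by auto
    then have "amplitude w g (of_real (freq 0 n)) \<le> \<delta>'" "amplitude w f (- of_real (freq 0 n)) \<le> \<delta>'"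
      using \<delta>' unfolding Bad_def by (auto simp: not_le intro: less_imp_le power2_less_imp_less)
    then have "C' * (amplitude w g (of_real (freq 0 n)) + amplitude w f (- of_real (freq 0 n))) \<le> C' * (2 * \<delta>')"
      using C' by (intro mult_left_mono) auto
    also have "\<dots> = \<delta>" using C' by (simp add: \<delta>'_def)
    finally show ?thesis using d by linarith
  qed
  then show ?thesis using that by blast
qed

section \<open>Solutions at the right end of the interval\<close>

text \<open>Below the real axis the roles of \<open>u\<close> and \<open>v\<close> are exchanged.\<close>

definition full_defect :: "(real \<Rightarrow> complex) \<Rightarrow> (real \<Rightarrow> complex) \<Rightarrow> complex \<Rightarrow> real" where
  "full_defect f g lam = (if 0 \<le> Im lam then defect f g lam else defect g f (- lam))"

lemma end_values_upper:
  assumes sol: "dirac_pair f g lam u v" and lam: "0 \<le> Im lam"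
    and f: "L1 f" and g: "L1 g"
  defines "M \<equiv> (cmod (u 0) + cmod (v 0)) * exp (mass f g)"
  shows "cmod (u L - E (\<i> * lam) L * u 0) \<le> M * defect f g lam * exp (\<bar>Im lam\<bar> * \<mu> L)"
    and "cmod (v L - E (- \<i> * lam) L * v 0) \<le> M * defect f g lam * exp (\<bar>Im lam\<bar> * \<mu> L)"
proof -
  have M0: "0 \<le> M" by (simp add: M_def)
  have int: "(\<lambda>t. cmod (f t) * cmod (E (- 2 * \<i> * lam) t * (fourier g lam L - fourier g lam t))) integrable_on {0..L}"
    "(\<lambda>t. cmod (g t) * cmod (E (2 * \<i> * lam) L * fourier f (- lam) t)) integrable_on {0..L}"
    by (intro integrable_mult_continuous absolutely_integrable_cmod
        f g continuous_intros E_continuous fourier_continuous)+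
  have nn: "0 \<le> integral {0..L} (\<lambda>t. cmod (f t) * cmod (E (- 2 * \<i> * lam) t * (fourier g lam L - fourier g lam t)))"
    "0 \<le> integral {0..L} (\<lambda>t. cmod (g t) * cmod (E (2 * \<i> * lam) L * fourier f (- lam) t))"
    by (rule integral_nonneg[OF int(1)], simp)
       (rule integral_nonneg[OF int(2)], simp)
  have v: "cmod (E (\<i> * lam) L * v L - v 0) \<le> M * defect f g lam"
    by (rule order_trans[OF upper_half_plane_estimate(1)[OF sol lam f g, folded M_def] mult_left_mono[OF _ M0]])
       (use nn in \<open>simp add: defect_def\<close>)
  have u: "cmod (E (\<i> * lam) L * u L - E (2 * \<i> * lam) L * u 0) \<le> M * defect f g lam"
    by (rule order_trans[OF upper_half_plane_estimate(2)[OF sol lam f g, folded M_def] mult_left_mono[OF _ M0]])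
       (use nn in \<open>simp add: defect_def\<close>)
  have nE: "cmod (E (- \<i> * lam) L) = exp (\<bar>Im lam\<bar> * \<mu> L)"
    using lam by (simp add: norm_E)
  have EE: "E (- \<i> * lam) L * E (\<i> * lam) L = 1" "E (- \<i> * lam) L * E (2 * \<i> * lam) L = E (\<i> * lam) L"
    unfolding E_mult by (simp_all add: E_def)
  have "v L - E (- \<i> * lam) L * v 0 = E (- \<i> * lam) L * (E (\<i> * lam) L * v L - v 0)"
    unfolding right_diff_distrib mult.assoc[symmetric] EE by simp
  then have "cmod (v L - E (- \<i> * lam) L * v 0) = exp (\<bar>Im lam\<bar> * \<mu> L) * cmod (E (\<i> * lam) L * v L - v 0)"
    by (simp only: norm_mult nE)
  also have "\<dots> \<le> exp (\<bar>Im lam\<bar> * \<mu> L) * (M * defect f g lam)"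
    by (intro mult_left_mono v) simp
  finally show "cmod (v L - E (- \<i> * lam) L * v 0) \<le> M * defect f g lam * exp (\<bar>Im lam\<bar> * \<mu> L)"
    by (simp add: mult_ac)
  have "u L - E (\<i> * lam) L * u 0 = E (- \<i> * lam) L * (E (\<i> * lam) L * u L - E (2 * \<i> * lam) L * u 0)"
    unfolding right_diff_distrib mult.assoc[symmetric] EE by simp
  then have "cmod (u L - E (\<i> * lam) L * u 0)
      = exp (\<bar>Im lam\<bar> * \<mu> L) * cmod (E (\<i> * lam) L * u L - E (2 * \<i> * lam) L * u 0)"
    by (simp only: norm_mult nE)
  also have "\<dots> \<le> exp (\<bar>Im lam\<bar> * \<mu> L) * (M * defect f g lam)"
    by (intro mult_left_mono u) simp
  finally show "cmod (u L - E (\<i> * lam) L * u 0) \<le> M * defect f g lam * exp (\<bar>Im lam\<bar> * \<mu> L)"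
    by (simp add: mult_ac)
qed

lemma end_values:
  assumes sol: "dirac_pair f g lam u v"
    and f: "L1 f" and g: "L1 g"
  defines "M \<equiv> (cmod (u 0) + cmod (v 0)) * exp (mass f g)"
  shows "cmod (u L - E (\<i> * lam) L * u 0) \<le> M * full_defect f g lam * exp (\<bar>Im lam\<bar> * \<mu> L)"
    and "cmod (v L - E (- \<i> * lam) L * v 0) \<le> M * full_defect f g lam * exp (\<bar>Im lam\<bar> * \<mu> L)"
proof -
  have tot: "mass g f = mass f g" by (simp add: mass_def add.commute)
  have "cmod (u L - E (\<i> * lam) L * u 0) \<le> M * full_defect f g lam * exp (\<bar>Im lam\<bar> * \<mu> L) \<and>
     cmod (v L - E (- \<i> * lam) L * v 0) \<le> M * full_defect f g lam * exp (\<bar>Im lam\<bar> * \<mu> L)"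
  proof (cases "0 \<le> Im lam")
    case True
    then show ?thesis using end_values_upper[OF sol True f g] by (simp add: full_defect_def M_def)
  next
    case False
    then have "0 \<le> Im (- lam)" by simp
    from end_values_upper[OF dirac_pair_swap[OF sol] this g f] False
    show ?thesis by (simp add: full_defect_def M_def tot add.commute)
  qed
  then show "cmod (u L - E (\<i> * lam) L * u 0) \<le> M * full_defect f g lam * exp (\<bar>Im lam\<bar> * \<mu> L)"
    "cmod (v L - E (- \<i> * lam) L * v 0) \<le> M * full_defect f g lam * exp (\<bar>Im lam\<bar> * \<mu> L)" by blast+
qed

lemma full_defect_vanishes:
  assumes f: "L2 f" and g: "L2 g" and \<delta>: "0 < \<delta>"
  obtains R where "\<And>lam. R \<le> cmod lam \<Longrightarrow> full_defect f g lam \<le> \<delta>"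
proof -
  obtain R1 where R1: "\<And>lam. 0 \<le> Im lam \<Longrightarrow> R1 \<le> cmod lam \<Longrightarrow> defect f g lam \<le> \<delta>"
    using defect_vanishes[OF f g \<delta>] by blast
  obtain R2 where R2: "\<And>lam. 0 \<le> Im lam \<Longrightarrow> R2 \<le> cmod lam \<Longrightarrow> defect g f lam \<le> \<delta>"
    using defect_vanishes[OF g f \<delta>] by blast
  have "full_defect f g lam \<le> \<delta>" if "max R1 R2 \<le> cmod lam" for lam
    using R1[of lam] R2[of "- lam"] that by (auto simp: full_defect_def)
  then show ?thesis using that by blast
qed

lemma full_defect_square_summable:
  assumes "L2 f" "L2 g"
  shows "(\<lambda>n. (full_defect f g (of_real (freq t0 n)))\<^sup>2) summable_on UNIV"
  using defect_square_summable[OF assms] by (simp add: full_defect_def)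

lemma full_defect_nonneg:
  assumes f: "L1 f" and g: "L1 g"
  shows "0 \<le> full_defect f g lam"
proof -
  have "0 \<le> defect f g lam" if f: "L1 f" and g: "L1 g" for f g lam
    unfolding defect_def
    by (intro add_nonneg_nonneg integral_nonneg integrable_if_absolutely
        absolutely_integrable_mult_continuous(1) absolutely_integrable_cmod continuous_intros E_continuous fourier_continuous f g) auto
  then show ?thesis using f g by (simp add: full_defect_def)
qed

section \<open>Uniqueness of solutions and holomorphy in the spectral parameter\<close>

definition coeff_bound :: "(real \<Rightarrow> complex) \<Rightarrow> (real \<Rightarrow> complex) \<Rightarrow> real \<Rightarrow> real \<Rightarrow> real" where
  "coeff_bound f g R t = R * \<rho> t + cmod (f t) + cmod (g t)"

lemma coeff_bound:
  assumes "L1 f" "L1 g" "0 \<le> R"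
  shows "coeff_bound f g R absolutely_integrable_on {0..L}" "t \<in> {0..L} \<Longrightarrow> 0 \<le> coeff_bound f g R t"
proof -
  show "coeff_bound f g R absolutely_integrable_on {0..L}"
    unfolding coeff_bound_def[abs_def]
    by (intro set_integral_add absolutely_integrable_cmod assms absolutely_integrable_mult_continuous(2)
        rho_absolutely_integrable continuous_intros)
  show "0 \<le> coeff_bound f g R t" if "t \<in> {0..L}"
    using rho_pos[OF that] assms(3) by (simp add: coeff_bound_def)
qed

text \<open>With \<open>a = U\<close> and \<open>b = V\<close> this is the hypothesis of Gronwall's inequality; with \<open>a\<close> and \<open>b\<close> the errors of
  one Picard iterate and \<open>U\<close> and \<open>V\<close> those of the next it gives the convergence of the iteration.\<close>

lemma step_bound:
  assumes f: "L1 f" and g: "L1 g" and lam: "cmod lam \<le> R"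
    and a: "continuous_on {0..L} a" and b: "continuous_on {0..L} b"
    and U: "primitive_on L U (\<lambda>x. \<i> * lam * of_real (\<rho> x) * a x + f x * b x)"
    and V: "primitive_on L V (\<lambda>x. - \<i> * lam * of_real (\<rho> x) * b x + g x * a x)"
    and x: "x \<in> {0..L}"
  shows "cmod (U x) + cmod (V x) \<le> cmod (U 0) + cmod (V 0)
     + integral {0..x} (\<lambda>t. coeff_bound f g R t * (cmod (a t) + cmod (b t)))"
proof -
  have R: "0 \<le> R" using lam norm_ge_zero[of lam] by linarith
  have sub: "(\<lambda>t. h t * k t) integrable_on {0..x}"
    if "L1 h" "continuous_on {0..L} k" for h k :: "real \<Rightarrow> real"
    using absolutely_integrable_norm_sub(2)[OF absolutely_integrable_mult_continuous(1)[OF that], of 0 x] x by simp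
  have na: "continuous_on {0..L} (\<lambda>t. cmod (a t))" "continuous_on {0..L} (\<lambda>t. cmod (b t))"
    by (intro continuous_intros a b)+
  have i: "(\<lambda>t. R * (\<rho> t * cmod (a t)) + cmod (f t) * cmod (b t)) integrable_on {0..x}"
      "(\<lambda>t. R * (\<rho> t * cmod (b t)) + cmod (g t) * cmod (a t)) integrable_on {0..x}"
    by (intro integrable_add integrable_on_mult_right sub rho_absolutely_integrable absolutely_integrable_cmod f g na)+
  have "cmod (U x) \<le> cmod (U 0) + integral {0..x} (\<lambda>t. R * (\<rho> t * cmod (a t)) + cmod (f t) * cmod (b t))"
  proof (rule primitive_on_norm_le(1)[OF U x i(1)])
    fix t assume "t \<in> {0..x}"
    then have t: "t \<in> {0..L}" using x by auto
    have "cmod (\<i> * lam * of_real (\<rho> t) * a t + f t * b t) \<le> cmod lam * (\<rho> t * cmod (a t)) + cmod (f t) * cmod (b t)"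
      using norm_triangle_ineq[of "\<i> * lam * of_real (\<rho> t) * a t" "f t * b t"] rho_pos[OF t] by (simp add: norm_mult)
    also have "cmod lam * (\<rho> t * cmod (a t)) \<le> R * (\<rho> t * cmod (a t))"
      using rho_pos[OF t] by (intro mult_right_mono lam) auto
    finally show "cmod (\<i> * lam * of_real (\<rho> t) * a t + f t * b t) \<le> R * (\<rho> t * cmod (a t)) + cmod (f t) * cmod (b t)"
      by simp
  qed
  moreover have "cmod (V x) \<le> cmod (V 0) + integral {0..x} (\<lambda>t. R * (\<rho> t * cmod (b t)) + cmod (g t) * cmod (a t))"
  proof (rule primitive_on_norm_le(1)[OF V x i(2)])
    fix t assume "t \<in> {0..x}"
    then have t: "t \<in> {0..L}" using x by auto
    have "cmod (- \<i> * lam * of_real (\<rho> t) * b t + g t * a t) \<le> cmod lam * (\<rho> t * cmod (b t)) + cmod (g t) * cmod (a t)"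
      using norm_triangle_ineq[of "- \<i> * lam * of_real (\<rho> t) * b t" "g t * a t"] rho_pos[OF t] by (simp add: norm_mult)
    also have "cmod lam * (\<rho> t * cmod (b t)) \<le> R * (\<rho> t * cmod (b t))"
      using rho_pos[OF t] by (intro mult_right_mono lam) auto
    finally show "cmod (- \<i> * lam * of_real (\<rho> t) * b t + g t * a t) \<le> R * (\<rho> t * cmod (b t)) + cmod (g t) * cmod (a t)"
      by simp
  qed
  moreover have "integral {0..x} (\<lambda>t. R * (\<rho> t * cmod (a t)) + cmod (f t) * cmod (b t))
      + integral {0..x} (\<lambda>t. R * (\<rho> t * cmod (b t)) + cmod (g t) * cmod (a t))
      \<le> integral {0..x} (\<lambda>t. coeff_bound f g R t * (cmod (a t) + cmod (b t)))"
    unfolding integral_add[OF i, symmetric]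
  proof (rule integral_le[OF integrable_add[OF i]])
    show "(\<lambda>t. coeff_bound f g R t * (cmod (a t) + cmod (b t))) integrable_on {0..x}"
      by (rule sub[OF coeff_bound(1)[OF f g R] continuous_on_add[OF na]])
    fix t
    have "0 \<le> cmod (f t) * cmod (a t) + cmod (g t) * cmod (b t)" by simp
    then show "R * (\<rho> t * cmod (a t)) + cmod (f t) * cmod (b t) + (R * (\<rho> t * cmod (b t)) + cmod (g t) * cmod (a t))
       \<le> coeff_bound f g R t * (cmod (a t) + cmod (b t))"
      by (simp add: coeff_bound_def algebra_simps)
  qed
  ultimately show ?thesis by linarith
qed

lemma dirac_pair_growth:
  assumes f: "L1 f" and g: "L1 g" and lam: "cmod lam \<le> R"
    and sol: "dirac_pair f g lam u v" and x: "x \<in> {0..L}"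
  shows "cmod (u x) + cmod (v x) \<le> (cmod (u 0) + cmod (v 0)) * exp (integral {0..L} (coeff_bound f g R))"
proof -
  have R: "0 \<le> R" using lam norm_ge_zero[of lam] by linarith
  note c = dirac_pair_continuous[OF sol]
  show ?thesis
  proof (rule gronwall[OF coeff_bound[OF f g R] _ _ _ x])
    show "continuous_on {0..L} (\<lambda>x. cmod (u x) + cmod (v x))" by (intro continuous_intros c)
    show "cmod (u x) + cmod (v x) \<le> cmod (u 0) + cmod (v 0)
       + integral {0..x} (\<lambda>t. coeff_bound f g R t * (cmod (u t) + cmod (v t)))" if "x \<in> {0..L}" for x
      using sol step_bound[OF f g lam c _ _ that] by (simp add: dirac_pair_def)
  qed auto
qed

lemma dirac_pair_combination:
  assumes "dirac_pair f g lam u v" "dirac_pair f g lam u' v'"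
  shows "dirac_pair f g lam (\<lambda>x. u x - c * u' x) (\<lambda>x. v x - c * v' x)"
proof -
  have p: "primitive_on L u (\<lambda>x. \<i> * lam * of_real (\<rho> x) * u x + f x * v x)"
    "primitive_on L v (\<lambda>x. - \<i> * lam * of_real (\<rho> x) * v x + g x * u x)"
    "primitive_on L u' (\<lambda>x. \<i> * lam * of_real (\<rho> x) * u' x + f x * v' x)"
    "primitive_on L v' (\<lambda>x. - \<i> * lam * of_real (\<rho> x) * v' x + g x * u' x)"
    using assms by (simp_all add: dirac_pair_def)
  show ?thesis
    unfolding dirac_pair_def
  proof
    show "primitive_on L (\<lambda>x. u x - c * u' x) (\<lambda>x. \<i> * lam * of_real (\<rho> x) * (u x - c * u' x) + f x * (v x - c * v' x))"
      by (rule primitive_on_cong[OF primitive_on_diff[OF p(1) primitive_on_cmult[OF p(3), of c]]])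
         (use L_pos in \<open>auto simp: algebra_simps\<close>)
    show "primitive_on L (\<lambda>x. v x - c * v' x) (\<lambda>x. - \<i> * lam * of_real (\<rho> x) * (v x - c * v' x) + g x * (u x - c * u' x))"
      by (rule primitive_on_cong[OF primitive_on_diff[OF p(2) primitive_on_cmult[OF p(4), of c]]])
         (use L_pos in \<open>auto simp: algebra_simps\<close>)
  qed
qed

lemma dirac_pair_unique:
  assumes f: "L1 f" and g: "L1 g"
    and sol: "dirac_pair f g lam u v" "dirac_pair f g lam u' v'"
    and init: "u 0 = c * u' 0" "v 0 = c * v' 0" and x: "x \<in> {0..L}"
  shows "u x = c * u' x" "v x = c * v' x"
proof -
  have "cmod (u x - c * u' x) + cmod (v x - c * v' x) \<le> 0"
    using dirac_pair_growth[OF f g order_refl dirac_pair_combination[OF sol, of c] x] init by simp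
  then have "cmod (u x - c * u' x) \<le> 0" "cmod (v x - c * v' x) \<le> 0"
    using norm_ge_zero[of "u x - c * u' x"] norm_ge_zero[of "v x - c * v' x"] by linarith+
  then show "u x = c * u' x" "v x = c * v' x" by simp_all
qed

text \<open>The coefficient matrix of the system has trace zero.\<close>

lemma wronskian_constant:
  assumes "dirac_pair f g lam u v" "dirac_pair f g lam u' v'" and x: "x \<in> {0..L}"
  shows "u x * v' x - v x * u' x = u L * v' L - v L * u' L"
proof -
  have p: "primitive_on L u (\<lambda>x. \<i> * lam * of_real (\<rho> x) * u x + f x * v x)"
    "primitive_on L v (\<lambda>x. - \<i> * lam * of_real (\<rho> x) * v x + g x * u x)"
    "primitive_on L u' (\<lambda>x. \<i> * lam * of_real (\<rho> x) * u' x + f x * v' x)"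
    "primitive_on L v' (\<lambda>x. - \<i> * lam * of_real (\<rho> x) * v' x + g x * u' x)"
    using assms by (simp_all add: dirac_pair_def)
  have "primitive_on L (\<lambda>x. u x * v' x - v x * u' x) (\<lambda>x. 0)"
    by (rule primitive_on_cong[OF primitive_on_diff[OF primitive_on_mult[OF p(1,4)] primitive_on_mult[OF p(2,3)]]])
       (use L_pos in \<open>auto simp: algebra_simps\<close>)
  from primitive_onD[OF this x] primitive_onD[OF this, of L] L_pos show ?thesis by simp
qed

text \<open>Finite sums of products of an entire function of \<open>lam\<close> with a continuous function of \<open>x\<close>.  Picard's iterates
  have this form, which makes them entire in \<open>lam\<close> without differentiation under the integral sign.\<close>

inductive separable :: "(complex \<Rightarrow> real \<Rightarrow> complex) \<Rightarrow> bool" where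
  product: "a holomorphic_on UNIV \<Longrightarrow> continuous_on {0..L} c \<Longrightarrow> separable (\<lambda>lam x. a lam * c x)"
| add: "separable Y \<Longrightarrow> separable Z \<Longrightarrow> separable (\<lambda>lam x. Y lam x + Z lam x)"
| restrict: "separable Y \<Longrightarrow> (\<And>lam x. x \<in> {0..L} \<Longrightarrow> Y lam x = Z lam x) \<Longrightarrow> separable Z"

lemma separable_holomorphic: "separable Y \<Longrightarrow> x \<in> {0..L} \<Longrightarrow> (\<lambda>lam. Y lam x) holomorphic_on UNIV"
proof (induction rule: separable.induct)
  case (restrict Y Z)
  then show ?case by (metis (no_types, lifting) holomorphic_transform UNIV_I)
qed (auto intro!: holomorphic_intros)

lemma separable_continuous: "separable Y \<Longrightarrow> continuous_on {0..L} (Y lam)"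
proof (induction rule: separable.induct)
  case (restrict Y Z)
  then show ?case by (metis (no_types, lifting) continuous_on_eq)
qed (auto intro!: continuous_intros)

lemma separable_mult:
  assumes "a holomorphic_on UNIV"
  shows "separable Y \<Longrightarrow> separable (\<lambda>lam x. a lam * Y lam x)"
proof (induction rule: separable.induct)
  case (product b c)
  have "separable (\<lambda>lam x. (a lam * b lam) * c x)"
    by (intro separable.product holomorphic_intros assms product)
  then show ?case by (simp add: mult.assoc)
next
  case (add Y Z)
  have "separable (\<lambda>lam x. a lam * Y lam x + a lam * Z lam x)" by (intro separable.add add)
  then show ?case by (simp add: distrib_left)
next
  case (restrict Y Z)
  show ?case by (rule separable.restrict[OF restrict.IH]) (simp add: restrict)
qed

lemma separable_integral:
  assumes h: "L1 h"
  shows "separable Y \<Longrightarrow> separable (\<lambda>lam x. integral {0..x} (\<lambda>t. h t * Y lam t))"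
proof (induction rule: separable.induct)
  case (product a c)
  have "primitive_on L (\<lambda>x. integral {0..x} (\<lambda>t. h t * c t)) (\<lambda>t. h t * c t)"
    by (intro primitive_on_indefinite_integral absolutely_integrable_mult_continuous(1) h product)
  then have "separable (\<lambda>lam x. a lam * integral {0..x} (\<lambda>t. h t * c t))"
    by (intro separable.product product primitive_on_continuous)
  then show ?case
    by (rule separable.restrict) (simp add: mult.left_commute)
next
  case (add Y Z)
  have i: "(\<lambda>t. h t * W lam t) integrable_on {0..x}" if "separable W" "x \<in> {0..L}" for W lam x
    using absolutely_integrable_norm_sub(2)[OF absolutely_integrable_mult_continuous(1)[OF h separable_continuous[OF that(1)]], of 0 x]
      that(2) by simp
  show ?case
    by (rule separable.restrict[OF separable.add[OF add.IH]])
       (simp add: distrib_left integral_add i add.hyps)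
next
  case (restrict Y Z)
  show ?case
  proof (rule separable.restrict[OF restrict.IH])
    fix lam x assume "x \<in> {0..L}"
    then show "integral {0..x} (\<lambda>t. h t * Y lam t) = integral {0..x} (\<lambda>t. h t * Z lam t)"
      using restrict.hyps by (intro integral_cong) auto
  qed
qed

primrec picard :: "(real \<Rightarrow> complex) \<Rightarrow> (real \<Rightarrow> complex) \<Rightarrow> (complex \<Rightarrow> complex) \<Rightarrow> (complex \<Rightarrow> complex) \<Rightarrow> nat
    \<Rightarrow> (complex \<Rightarrow> real \<Rightarrow> complex) \<times> (complex \<Rightarrow> real \<Rightarrow> complex)" where
  "picard f g u0 v0 0 = (\<lambda>lam x. u0 lam, \<lambda>lam x. v0 lam)"
| "picard f g u0 v0 (Suc k) =
    (\<lambda>lam x. u0 lam + (\<i> * lam * integral {0..x} (\<lambda>t. of_real (\<rho> t) * fst (picard f g u0 v0 k) lam t)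
        + integral {0..x} (\<lambda>t. f t * snd (picard f g u0 v0 k) lam t)),
     \<lambda>lam x. v0 lam + (- \<i> * lam * integral {0..x} (\<lambda>t. of_real (\<rho> t) * snd (picard f g u0 v0 k) lam t)
        + integral {0..x} (\<lambda>t. g t * fst (picard f g u0 v0 k) lam t)))"

lemma rho_complex_integrable: "L1 (\<lambda>t. complex_of_real (\<rho> t))"
  using absolutely_integrable_linear[OF rho_absolutely_integrable bounded_linear_of_real] by (simp add: o_def)

lemma picard_separable:
  assumes f: "L1 f" and g: "L1 g"
    and "u0 holomorphic_on UNIV" "v0 holomorphic_on UNIV"
  shows "separable (fst (picard f g u0 v0 k)) \<and> separable (snd (picard f g u0 v0 k))"
proof (induction k)
  case 0
  then show ?case
    using separable.product[OF assms(3), of "\<lambda>_. 1"] separable.product[OF assms(4), of "\<lambda>_. 1"] by simp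
next
  case (Suc k)
  have c: "separable (\<lambda>lam x. u0 lam)" "separable (\<lambda>lam x. v0 lam)"
    using separable.product[OF assms(3), of "\<lambda>_. 1"] separable.product[OF assms(4), of "\<lambda>_. 1"] by simp_all
  show ?case
    unfolding picard.simps fst_conv snd_conv using Suc
    by (intro conjI separable.add separable_mult separable_integral c rho_complex_integrable f g holomorphic_intros) auto
qed

text \<open>Picard's iterates converge to the given solution with error \<open>C * W ^ k / k!\<close>.  Both constants can be
  chosen uniformly for \<open>lam\<close> in a disc, the first one because Gronwall's inequality bounds the solution.\<close>

lemma solution_holomorphic:
  assumes f: "L1 f" and g: "L1 g"
    and sol: "\<And>lam. dirac_pair f g lam (u lam) (v lam)"
    and hol: "(\<lambda>lam. u lam 0) holomorphic_on UNIV" "(\<lambda>lam. v lam 0) holomorphic_on UNIV"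
    and x: "x \<in> {0..L}"
  shows "(\<lambda>lam. u lam x) holomorphic_on UNIV" "(\<lambda>lam. v lam x) holomorphic_on UNIV"
proof -
  define P where "P k = picard f g (\<lambda>lam. u lam 0) (\<lambda>lam. v lam 0) k" for k
  have sep: "separable (fst (P k))" "separable (snd (P k))" for k
    using picard_separable[OF f g hol] by (simp_all add: P_def)
  note cont = sep[THEN separable_continuous]
  define e where "e k lam x = cmod (u lam x - fst (P k) lam x) + cmod (v lam x - snd (P k) lam x)" for k lam x
  have cont_diff: "continuous_on {0..L} (\<lambda>x. u lam x - fst (P k) lam x)" "continuous_on {0..L} (\<lambda>x. v lam x - snd (P k) lam x)" for k lam
    by (intro continuous_intros dirac_pair_continuous[OF sol] cont)+
  have eSuc: "e (Suc k) lam x \<le> integral {0..x} (\<lambda>t. coeff_bound f g R t * e k lam t)"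
    if lam: "cmod lam \<le> R" and x: "x \<in> {0..L}" for k lam x R
  proof -
    let ?a = "\<lambda>t. u lam t - fst (P k) lam t" and ?b = "\<lambda>t. v lam t - snd (P k) lam t"
    let ?U = "\<lambda>t. u lam t - fst (P (Suc k)) lam t" and ?V = "\<lambda>t. v lam t - snd (P (Suc k)) lam t"
    have p: "primitive_on L (u lam) (\<lambda>x. \<i> * lam * of_real (\<rho> x) * u lam x + f x * v lam x)"
      "primitive_on L (v lam) (\<lambda>x. - \<i> * lam * of_real (\<rho> x) * v lam x + g x * u lam x)"
      using sol[of lam] by (simp_all add: dirac_pair_def)
    have ind: "primitive_on L (\<lambda>x. integral {0..x} (\<lambda>t. h t * Y t)) (\<lambda>t. h t * Y t)"
      if "L1 h" "continuous_on {0..L} Y" for h Y :: "real \<Rightarrow> complex"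
      by (intro primitive_on_indefinite_integral absolutely_integrable_mult_continuous(1) that)
    have q: "primitive_on L (fst (P (Suc k)) lam) (\<lambda>t. 0 + (\<i> * lam * (of_real (\<rho> t) * fst (P k) lam t) + f t * snd (P k) lam t))"
      "primitive_on L (snd (P (Suc k)) lam) (\<lambda>t. 0 + (- \<i> * lam * (of_real (\<rho> t) * snd (P k) lam t) + g t * fst (P k) lam t))"
      unfolding P_def picard.simps fst_conv snd_conv
      by (intro primitive_on_add primitive_on_const primitive_on_cmult ind rho_complex_integrable f g cont[unfolded P_def])+
    have U: "primitive_on L ?U (\<lambda>x. \<i> * lam * of_real (\<rho> x) * ?a x + f x * ?b x)"
      by (rule primitive_on_cong[OF primitive_on_diff[OF p(1) q(1)]]) (use L_pos in \<open>auto simp: algebra_simps\<close>)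
    have V: "primitive_on L ?V (\<lambda>x. - \<i> * lam * of_real (\<rho> x) * ?b x + g x * ?a x)"
      by (rule primitive_on_cong[OF primitive_on_diff[OF p(2) q(2)]]) (use L_pos in \<open>auto simp: algebra_simps\<close>)
    have "?U 0 = 0" "?V 0 = 0" by (simp_all add: P_def)
    then show ?thesis
      using step_bound[OF f g lam cont_diff U V x] by (simp add: e_def)
  qed
  have lim: "\<exists>d>0. cball z d \<subseteq> UNIV \<and> uniform_limit (cball z d) (\<lambda>k lam. fst (P k) lam x) (\<lambda>lam. u lam x) sequentially
     \<and> uniform_limit (cball z d) (\<lambda>k lam. snd (P k) lam x) (\<lambda>lam. v lam x) sequentially" for z
  proof -
    define R where "R = cmod z + 1"
    have R: "0 \<le> R" "\<And>lam. lam \<in> cball z 1 \<Longrightarrow> cmod lam \<le> R"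
    proof -
      show "0 \<le> R" by (simp add: R_def)
      fix lam assume "lam \<in> cball z 1"
      then show "cmod lam \<le> R"
        using norm_triangle_sub[of lam z] by (simp add: R_def dist_norm norm_minus_commute)
    qed
    have "continuous_on (cball z 1) (\<lambda>lam. cmod (u lam 0) + cmod (v lam 0))"
      by (intro continuous_intros holomorphic_on_imp_continuous_on holomorphic_on_subset[OF hol(1)] holomorphic_on_subset[OF hol(2)]) auto
    then have "bounded ((\<lambda>lam. cmod (u lam 0) + cmod (v lam 0)) ` cball z 1)"
      by (intro compact_imp_bounded compact_continuous_image) auto
    then obtain B where B: "\<And>lam. lam \<in> cball z 1 \<Longrightarrow> cmod (u lam 0) + cmod (v lam 0) \<le> B"
      unfolding bounded_iff by fastforce
    define X where "X = exp (integral {0..L} (coeff_bound f g R))"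
    define C where "C = B * X + B"
    define W where "W = integral {0..x} (coeff_bound f g R)"
    have e_le: "e k lam x \<le> C * (W ^ k / fact k)" if lam: "lam \<in> cball z 1" for k lam
      unfolding W_def
    proof (rule iterated_integral_bound[OF coeff_bound[OF f g R(1)] _ _ _ x])
      show "continuous_on {0..L} (e k lam)" for k
        unfolding e_def by (intro continuous_intros cont_diff)
      show "e (Suc k) lam x \<le> integral {0..x} (\<lambda>t. coeff_bound f g R t * e k lam t)" if "x \<in> {0..L}" for k x
        by (rule eSuc[OF R(2)[OF lam] that])
      fix y assume y: "y \<in> {0..L}"
      have "e 0 lam y \<le> (cmod (u lam y) + cmod (v lam y)) + (cmod (u lam 0) + cmod (v lam 0))"
        using norm_triangle_ineq4[of "u lam y" "u lam 0"] norm_triangle_ineq4[of "v lam y" "v lam 0"] by (simp add: e_def P_def)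
      also have "cmod (u lam y) + cmod (v lam y) \<le> (cmod (u lam 0) + cmod (v lam 0)) * X"
        unfolding X_def by (rule dirac_pair_growth[OF f g R(2)[OF lam] sol y])
      also have "\<dots> \<le> B * X" by (intro mult_right_mono B lam) (simp add: X_def)
      finally show "e 0 lam y \<le> C" using B[OF lam] by (simp add: C_def)
    qed auto
    have conv: "\<forall>\<^sub>F k in sequentially. \<forall>lam\<in>cball z 1. e k lam x < \<epsilon>" if "0 < \<epsilon>" for \<epsilon>
    proof -
      have "\<forall>\<^sub>F k in sequentially. C * (W ^ k / fact k) < \<epsilon>"
        using order_tendstoD(2)[OF power_over_fact_tendsto_0 that] .
      then show ?thesis by eventually_elim (use e_le in \<open>meson le_less_trans\<close>)
    qed
    have "uniform_limit (cball z 1) (\<lambda>k lam. fst (P k) lam x) (\<lambda>lam. u lam x) sequentially"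
      "uniform_limit (cball z 1) (\<lambda>k lam. snd (P k) lam x) (\<lambda>lam. v lam x) sequentially"
    proof -
      have le: "dist (fst (P k) lam x) (u lam x) \<le> e k lam x" "dist (snd (P k) lam x) (v lam x) \<le> e k lam x" for k lam
        by (simp_all add: e_def dist_norm norm_minus_commute)
      show "uniform_limit (cball z 1) (\<lambda>k lam. fst (P k) lam x) (\<lambda>lam. u lam x) sequentially"
        unfolding uniform_limit_iff using conv le(1) by (smt (verit, best) eventually_mono)
      show "uniform_limit (cball z 1) (\<lambda>k lam. snd (P k) lam x) (\<lambda>lam. v lam x) sequentially"
        unfolding uniform_limit_iff using conv le(2) by (smt (verit, best) eventually_mono)
    qed
    then show ?thesis by (intro exI[of _ 1]) auto
  qed
  show "(\<lambda>lam. u lam x) holomorphic_on UNIV"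
    by (rule holomorphic_uniform_sequence[of _ "\<lambda>k lam. fst (P k) lam x"])
       (use lim in \<open>blast intro: separable_holomorphic sep x\<close>)+
  show "(\<lambda>lam. v lam x) holomorphic_on UNIV"
    by (rule holomorphic_uniform_sequence[of _ "\<lambda>k lam. snd (P k) lam x"])
       (use lim in \<open>blast intro: separable_holomorphic sep x\<close>)+
qed

section \<open>Asymptotics of the characteristic function\<close>

text \<open>The replacement of \<open>u\<close> and \<open>v\<close> at the right end by their unperturbed values costs a multiple of the
  defect, and dropping the terms of degree below two in the boundary polynomials costs \<open>1 / \<bar>lam\<bar>\<close>.\<close>

lemma characteristic_asymptotics:
  assumes f: "L2 f" and g: "L2 g"
    and sol: "\<And>lam. dirac_pair f g lam (u lam) (v lam)"
    and u0: "\<And>lam. u lam 0 = lam * A1 + A0" and v0: "\<And>lam. v lam 0 = lam * B1 + B0"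
  obtains C where "0 < C"
    "\<And>lam. 1 \<le> cmod lam \<Longrightarrow>
       cmod (u lam L * (lam * G1 + G0) - v lam L * (lam * H1 + H0)
         - lam\<^sup>2 * (A1 * G1 * E (\<i> * lam) L - B1 * H1 * E (- \<i> * lam) L))
       \<le> C * (cmod lam)\<^sup>2 * exp (\<mu> L * \<bar>Im lam\<bar>) * (full_defect f g lam + 1 / cmod lam)"
proof -
  note fa = L2D(1)[OF f] and ga = L2D(1)[OF g]
  define K where "K = cmod A1 + cmod A0 + cmod B1 + cmod B0 + cmod G1 + cmod G0 + cmod H1 + cmod H0 + 1"
  have K: "cmod A1 \<le> K" "cmod A0 \<le> K" "cmod B1 \<le> K" "cmod B0 \<le> K" "cmod G1 \<le> K" "cmod G0 \<le> K" "cmod H1 \<le> K" "cmod H0 \<le> K"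
    "cmod A1 + cmod A0 \<le> K" "cmod B1 + cmod B0 \<le> K" "cmod G1 + cmod G0 \<le> K" "cmod H1 + cmod H0 \<le> K" "0 < K"
    by (simp_all add: K_def add_nonneg_pos)
  define C where "C = 4 * K\<^sup>2 * exp (mass f g) + 6 * K\<^sup>2"
  show ?thesis
  proof (rule that[of C])
    show "0 < C" using K(13) by (simp add: C_def add_pos_pos)
    fix lam assume lam: "1 \<le> cmod lam"
    define l where "l = cmod lam"
    define e where "e = exp (\<mu> L * \<bar>Im lam\<bar>)"
    define \<eta> where "\<eta> = full_defect f g lam"
    have l: "1 \<le> l" and e: "0 < e" and \<eta>: "0 \<le> \<eta>"
      using lam by (simp_all add: l_def e_def \<eta>_def full_defect_nonneg fa ga)
    have lin: "cmod (lam * X + Y) \<le> K * l" if "cmod X + cmod Y \<le> K" for X Y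
    proof -
      have "cmod (lam * X + Y) \<le> l * cmod X + cmod Y" unfolding l_def by (metis norm_mult norm_triangle_ineq)
      also have "\<dots> \<le> l * cmod X + l * cmod Y" using l by (simp add: mult_le_cancel_right1)
      also have "\<dots> \<le> K * l" using mult_left_mono[OF that, of l] l by (simp add: algebra_simps)
      finally show ?thesis .
    qed
    define M where "M = (cmod (u lam 0) + cmod (v lam 0)) * exp (mass f g)"
    have M: "M \<le> 2 * K * l * exp (mass f g)"
      unfolding M_def u0 v0 using lin[OF K(9)] lin[OF K(10)] by (intro mult_right_mono) auto
    have M0: "0 \<le> M" by (simp add: M_def)
    have eu: "cmod (u lam L - E (\<i> * lam) L * u lam 0) \<le> M * \<eta> * e"
      and ev: "cmod (v lam L - E (- \<i> * lam) L * v lam 0) \<le> M * \<eta> * e"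
      using end_values[OF sol[of lam] fa ga] by (simp_all add: M_def \<eta>_def e_def mult.commute)
    have E_le: "cmod (E (\<i> * lam) L) \<le> e" "cmod (E (- \<i> * lam) L) \<le> e"
      using mult_left_mono[of "- Im lam" "\<bar>Im lam\<bar>" "\<mu> L"] mult_left_mono[of "Im lam" "\<bar>Im lam\<bar>" "\<mu> L"] mu_L_pos
      by (simp_all add: norm_E e_def mult.commute)
    have low: "cmod ((lam * X1 + X0) * (lam * Y1 + Y0) - lam\<^sup>2 * (X1 * Y1)) \<le> 3 * K\<^sup>2 * l"
      if "cmod X1 \<le> K" "cmod X0 \<le> K" "cmod Y1 \<le> K" "cmod Y0 \<le> K" for X1 X0 Y1 Y0
    proof -
      have p: "cmod (X1 * Y0) \<le> K\<^sup>2" "cmod (X0 * Y1) \<le> K\<^sup>2" "cmod (X0 * Y0) \<le> K\<^sup>2"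
        using that less_imp_le[OF K(13)] by (auto simp: norm_mult power2_eq_square intro!: mult_mono)
      have "(lam * X1 + X0) * (lam * Y1 + Y0) - lam\<^sup>2 * (X1 * Y1) = lam * (X1 * Y0) + lam * (X0 * Y1) + X0 * Y0"
        by (simp add: power2_eq_square algebra_simps)
      also have "cmod \<dots> \<le> l * cmod (X1 * Y0) + l * cmod (X0 * Y1) + cmod (X0 * Y0)"
        unfolding l_def by (metis (no_types) add_mono norm_mult norm_triangle_le norm_triangle_ineq order_refl)
      also have "\<dots> \<le> l * K\<^sup>2 + l * K\<^sup>2 + l * K\<^sup>2"
      proof (intro add_mono mult_left_mono p)
        show "cmod (X0 * Y0) \<le> l * K\<^sup>2"
          using p(3) mult_right_mono[OF l, of "K\<^sup>2"] by simp
      qed (use l in auto)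
      finally show ?thesis by (simp add: algebra_simps)
    qed
    \<comment> \<open>The deviation from the leading term splits into two contributions of the potential (\<open>a\<close>, \<open>b\<close>) and two of the lower coefficients (\<open>c\<close>, \<open>d\<close>).\<close>
    define a where "a = (u lam L - E (\<i> * lam) L * u lam 0) * (lam * G1 + G0)"
    define b where "b = (v lam L - E (- \<i> * lam) L * v lam 0) * (lam * H1 + H0)"
    define c where "c = E (\<i> * lam) L * ((lam * A1 + A0) * (lam * G1 + G0) - lam\<^sup>2 * (A1 * G1))"
    define d where "d = E (- \<i> * lam) L * ((lam * B1 + B0) * (lam * H1 + H0) - lam\<^sup>2 * (B1 * H1))"
    have dec: "u lam L * (lam * G1 + G0) - v lam L * (lam * H1 + H0)
         - lam\<^sup>2 * (A1 * G1 * E (\<i> * lam) L - B1 * H1 * E (- \<i> * lam) L) = a - b + c - d"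
      unfolding a_def b_def c_def d_def u0 v0 by (simp add: algebra_simps)
    have ab: "cmod a \<le> M * \<eta> * e * (K * l)" "cmod b \<le> M * \<eta> * e * (K * l)"
      unfolding a_def b_def norm_mult
      using eu ev lin[OF K(11)] lin[OF K(12)] M0 \<eta> e by (auto intro!: mult_mono)
    have cd: "cmod c \<le> e * (3 * K\<^sup>2 * l)" "cmod d \<le> e * (3 * K\<^sup>2 * l)"
      unfolding c_def d_def norm_mult
      by (rule mult_mono[OF E_le(1) low]; use K e in simp) (rule mult_mono[OF E_le(2) low]; use K e in simp)
    have "M * \<eta> * e * (K * l) \<le> (2 * K * l * exp (mass f g)) * \<eta> * e * (K * l)"
      using M \<eta> e K(13) l by (intro mult_right_mono) auto
    then have ab': "cmod a \<le> 2 * K\<^sup>2 * exp (mass f g) * l\<^sup>2 * e * \<eta>" "cmod b \<le> 2 * K\<^sup>2 * exp (mass f g) * l\<^sup>2 * e * \<eta>"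
      using ab by (simp_all add: power2_eq_square mult_ac)
    have "cmod (a - b + c - d) \<le> cmod a + cmod b + cmod c + cmod d"
      by (metis (no_types, opaque_lifting) add_mono norm_triangle_ineq norm_triangle_ineq4 norm_triangle_le norm_triangle_le_diff order_refl)
    also have "\<dots> \<le> 4 * K\<^sup>2 * exp (mass f g) * (l\<^sup>2 * e * \<eta>) + 6 * K\<^sup>2 * (l\<^sup>2 * e * (1 / l))"
    proof -
      have "l\<^sup>2 * e * (1 / l) = e * l" using l by (simp add: power2_eq_square)
      then show ?thesis using ab' cd by (simp add: algebra_simps)
    qed
    also have "\<dots> \<le> C * (l\<^sup>2 * e * \<eta>) + C * (l\<^sup>2 * e * (1 / l))"
      unfolding C_def using l e \<eta> by (intro add_mono mult_right_mono) auto
    also have "\<dots> = C * l\<^sup>2 * e * (\<eta> + 1 / l)" by (simp add: algebra_simps)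
    finally show "cmod (u lam L * (lam * G1 + G0) - v lam L * (lam * H1 + H0)
         - lam\<^sup>2 * (A1 * G1 * E (\<i> * lam) L - B1 * H1 * E (- \<i> * lam) L))
       \<le> C * (cmod lam)\<^sup>2 * exp (\<mu> L * \<bar>Im lam\<bar>) * (full_defect f g lam + 1 / cmod lam)"
      unfolding dec l_def e_def \<eta>_def .
  qed
qed

end

section \<open>Zeros of entire functions\<close>

text \<open>For \<open>\<bar>Im w\<bar> \<ge> 1\<close> one of the two exponentials dominates.  The strip \<open>\<bar>Im w\<bar> \<le> 1\<close> reduces, by periodicity,
  to a compact rectangle without a disc around 0, on which the sine does not vanish.\<close>

lemma sin_lower_bound:
  assumes "0 < d"
  obtains c where "0 < c"
    "\<And>w. (\<And>n::int. d \<le> cmod (w - of_real (of_int n * pi))) \<Longrightarrow> c * exp \<bar>Im w\<bar> \<le> cmod (sin w)"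
proof -
  define K where "K = cbox (Complex (- (pi / 2)) (- 1)) (Complex (pi / 2) 1) - ball 0 d"
  have "compact K" unfolding K_def by (intro compact_diff compact_cbox open_ball)
  have nz: "sin w \<noteq> 0" if w: "w \<in> K" for w
  proof
    assume "sin w = 0"
    then obtain n :: int where n: "w = of_real (of_int n * pi)" by (auto simp: sin_eq_0)
    have "- (pi / 2) \<le> Re w" "Re w \<le> pi / 2" "Re w = of_int n * pi"
      using w n by (simp_all add: K_def in_cbox_complex_iff)
    then have "\<bar>of_int n * pi\<bar> \<le> pi / 2" by linarith
    then have "\<bar>real_of_int n\<bar> * pi \<le> (1 / 2) * pi" by (simp add: abs_mult)
    then have "\<bar>real_of_int n\<bar> \<le> 1 / 2" by (simp only: mult_le_cancel_right_pos pi_gt_zero)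
    then have "n = 0" by linarith
    then show False using w n assms by (simp add: K_def)
  qed
  obtain c0 where c0: "0 < c0" "\<And>w. w \<in> K \<Longrightarrow> c0 \<le> cmod (sin w)"
  proof (cases "K = {}")
    case True
    then show ?thesis using that[of 1] by simp
  next
    case False
    have "continuous_on K (\<lambda>w. cmod (sin w))" by (intro continuous_intros)
    from continuous_attains_inf[OF \<open>compact K\<close> False this]
    obtain w0 where "w0 \<in> K" "\<And>w. w \<in> K \<Longrightarrow> cmod (sin w0) \<le> cmod (sin w)" by blast
    then show ?thesis using nz[of w0] that[of "cmod (sin w0)"] by simp
  qed
  define c where "c = min (1 / 4) (c0 / exp 1)"
  show ?thesis
  proof (rule that[of c])
    show "0 < c" using c0 by (simp add: c_def)
    fix w :: complex
    assume far: "\<And>n::int. d \<le> cmod (w - of_real (of_int n * pi))"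
    show "c * exp \<bar>Im w\<bar> \<le> cmod (sin w)"
    proof (cases "1 \<le> \<bar>Im w\<bar>")
      case True
      have e: "cmod (exp (\<i> * w)) = exp (- Im w)" "cmod (exp (- (\<i> * w))) = exp (Im w)"
        by (simp_all add: norm_exp_eq_Re)
      have "exp \<bar>Im w\<bar> - exp (- \<bar>Im w\<bar>) \<le> cmod (exp (\<i> * w) - exp (- (\<i> * w)))"
        using norm_triangle_ineq3[of "exp (\<i> * w)" "exp (- (\<i> * w))"] unfolding e by (auto simp: abs_if split: if_splits)
      also have "\<dots> = 2 * cmod (sin w)"
        by (simp add: sin_exp_eq norm_mult norm_divide)
      finally have 1: "exp \<bar>Im w\<bar> - exp (- \<bar>Im w\<bar>) \<le> 2 * cmod (sin w)" .
      have "2 * 1 \<le> exp \<bar>Im w\<bar>" "exp (- \<bar>Im w\<bar>) \<le> 1"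
        using exp_ge_add_one_self[of "\<bar>Im w\<bar>"] True by linarith simp
      then have "exp \<bar>Im w\<bar> / 2 \<le> 2 * cmod (sin w)" using 1 by linarith
      moreover have "c * exp \<bar>Im w\<bar> \<le> 1 / 4 * exp \<bar>Im w\<bar>"
        unfolding c_def by (intro mult_right_mono min.cobounded1) simp
      ultimately show ?thesis by linarith
    next
      case False
      define n where "n = \<lfloor>Re w / pi + 1 / 2\<rfloor>"
      have "of_int n \<le> Re w / pi + 1 / 2" "Re w / pi + 1 / 2 < of_int n + 1" by (simp_all add: n_def)
      then have "of_int n * pi \<le> Re w + pi / 2" "Re w + pi / 2 < of_int n * pi + pi"
        by (simp_all add: field_simps)
      then have "\<bar>Re w - of_int n * pi\<bar> \<le> pi / 2" by linarith
      define w' where "w' = w - of_real (of_int n * pi)"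
      have "- (pi / 2) \<le> Re w'" "Re w' \<le> pi / 2" "- 1 \<le> Im w'" "Im w' \<le> 1" "d \<le> cmod w'"
        using \<open>\<bar>Re w - of_int n * pi\<bar> \<le> pi / 2\<close> False far[of n]
        unfolding w'_def minus_complex.sel Re_complex_of_real Im_complex_of_real by linarith+
      then have "w' \<in> K" by (simp add: K_def in_cbox_complex_iff)
      have "sin (of_real (of_int n * pi) :: complex) = 0" by (auto simp: sin_eq_0)
      moreover have "sin w' = sin w * cos (of_real (of_int n * pi)) - cos w * sin (of_real (of_int n * pi))"
        unfolding w'_def by (rule sin_diff)
      moreover have "cmod (cos (of_real (of_int n * pi))) = 1"
      proof -
        have "\<bar>cos (of_int n * pi)\<bar> = 1" by (metis abs_square_eq_1 add.right_neutral cos_squared_eq sin_times_pi_eq_0 Ints_of_int diff_zero power_zero_numeral)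
        then show ?thesis by (metis cos_of_real norm_of_real)
      qed
      ultimately have "cmod (sin w') = cmod (sin w)" by (simp add: norm_mult)
      then have "c0 \<le> cmod (sin w)" using c0(2)[OF \<open>w' \<in> K\<close>] by simp
      moreover have "c * exp \<bar>Im w\<bar> \<le> c0 / exp 1 * exp 1"
        using False c0(1) by (intro mult_mono) (auto simp: c_def)
      ultimately show ?thesis by simp
    qed
  qed
qed

text \<open>Newton's method with the derivative frozen to \<open>s * m\<close>, for a sign \<open>s\<close>: a zero of \<open>G\<close> is a fixed
  point of \<open>z - s * G z / m\<close>, which contracts distances by the factor 2.  The resulting bound of the distance
  from \<open>c\<close> by the value \<open>G c\<close> is what later makes the displacements of the eigenvalues square summable.\<close>

lemma zero_by_contraction:
  fixes G :: "complex \<Rightarrow> complex"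
  assumes s: "s\<^sup>2 = 1" "cmod s = 1" and m: "0 < m" and r: "0 < r"
    and der: "\<And>z. z \<in> cball c r \<Longrightarrow> (G has_field_derivative G' z) (at z)"
    and close: "\<And>z. z \<in> cball c r \<Longrightarrow> cmod (G' z - s * of_real m) \<le> m / 2"
    and small: "cmod (G c) \<le> m * r / 2"
  obtains z where "z \<in> cball c r" "G z = 0" "cmod (z - c) \<le> 2 * cmod (G c) / m" "G' z \<noteq> 0"
    "\<And>w. w \<in> cball c r \<Longrightarrow> G w = 0 \<Longrightarrow> w = z"
proof -
  define h where "h z = z - s * G z / of_real m" for z
  have ss: "s * s = 1" using s by (simp add: power2_eq_square)
  have lip: "cmod (h x - h y) \<le> 1 / 2 * cmod (x - y)" if xy: "x \<in> cball c r" "y \<in> cball c r" for x y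
  proof (rule field_differentiable_bound[OF convex_cball _ _ xy(1) xy(2)])
    fix z assume z: "z \<in> cball c r"
    show "(h has_field_derivative (1 - s * G' z / of_real m)) (at z within cball c r)"
      unfolding h_def using m by (auto intro!: derivative_eq_intros has_field_derivative_at_within[OF der[OF z]])
    have "1 - s * G' z / of_real m = - s * (G' z - s * of_real m) / of_real m"
      using m ss by (simp add: field_simps flip: mult.assoc)
    then have "cmod (1 - s * G' z / of_real m) = cmod (G' z - s * of_real m) / m"
      using m s(2) by (simp add: norm_mult norm_divide)
    also have "\<dots> \<le> (m / 2) / m" using m by (intro divide_right_mono close z) auto
    finally show "cmod (1 - s * G' z / of_real m) \<le> 1 / 2" using m by simp
  qed
  have hc: "cmod (h c - c) = cmod (G c) / m"
    using m s(2) by (simp add: h_def norm_mult norm_divide)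
  have fix_iff: "h z = z \<longleftrightarrow> G z = 0" for z
    using m s(2) by (auto simp: h_def)
  have cc: "c \<in> cball c r" using r by simp
  have "\<exists>!z\<in>cball c r. h z = z"
  proof (rule Banach_fix)
    show "complete (cball c r)" by (simp add: complete_eq_closed)
    show "h ` cball c r \<subseteq> cball c r"
    proof clarify
      fix z assume z: "z \<in> cball c r"
      have "cmod (h z - c) \<le> cmod (h z - h c) + cmod (h c - c)"
        using norm_triangle_ineq[of "h z - h c" "h c - c"] by simp
      also have "\<dots> \<le> 1 / 2 * cmod (z - c) + (m * r / 2) / m"
        unfolding hc using m by (intro add_mono lip z cc divide_right_mono small) auto
      also have "\<dots> \<le> r" using z m by (simp add: dist_norm norm_minus_commute)
      finally show "h z \<in> cball c r" by (simp add: dist_norm norm_minus_commute)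
    qed
    show "\<And>x y. x \<in> cball c r \<Longrightarrow> y \<in> cball c r \<Longrightarrow> dist (h x) (h y) \<le> 1 / 2 * dist x y"
      unfolding dist_norm by (rule lip)
  qed (use r in auto)
  then obtain z where z: "z \<in> cball c r" "G z = 0" and uniq: "\<And>w. w \<in> cball c r \<Longrightarrow> G w = 0 \<Longrightarrow> w = z"
    unfolding fix_iff by blast
  have "cmod (z - c) \<le> cmod (h z - h c) + cmod (h c - c)"
    using norm_triangle_ineq[of "h z - h c" "h c - c"] fix_iff[of z] z by simp
  also have "\<dots> \<le> 1 / 2 * cmod (z - c) + cmod (G c) / m"
    unfolding hc by (intro add_mono lip z cc) simp
  finally have "cmod (z - c) \<le> 2 * cmod (G c) / m" by (simp add: field_simps)
  moreover have "G' z \<noteq> 0"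
  proof
    assume "G' z = 0"
    then show False using close[OF z(1)] m s(2) by (simp add: norm_mult)
  qed
  ultimately show ?thesis using that z uniq by blast
qed

text \<open>Embed the indices into the set of slots \<open>(z, j)\<close> with \<open>j < k z\<close> and forget \<open>j\<close>.\<close>

lemma assign_with_multiplicity:
  fixes E :: "'a set" and I :: "'b set" and k :: "'a \<Rightarrow> nat"
  assumes "finite E" "finite I" "card I \<le> (\<Sum>z\<in>E. k z)"
  obtains F where "F ` I \<subseteq> E" "\<And>z. z \<in> E \<Longrightarrow> card {i\<in>I. F i = z} \<le> k z"
proof -
  define P where "P = (SIGMA z:E. {..<k z})"
  have "finite P" "card P = (\<Sum>z\<in>E. k z)"
    using assms(1) by (auto simp: P_def)
  then obtain f where f: "f ` I \<subseteq> P" "inj_on f I"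
    using card_le_inj[of I P] assms by auto
  show ?thesis
  proof (rule that[of "fst \<circ> f"])
    show "(fst \<circ> f) ` I \<subseteq> E" using f(1) by (auto simp: P_def)
    fix z assume "z \<in> E"
    have "card {i \<in> I. (fst \<circ> f) i = z} = card (f ` {i \<in> I. (fst \<circ> f) i = z})"
      using f(2) by (intro card_image[symmetric]) (auto intro: inj_on_subset)
    also have "\<dots> \<le> card ({z} \<times> {..<k z})"
      using f(1) by (intro card_mono) (force simp: P_def)+
    also have "\<dots> = k z" by (simp add: card_cartesian_product)
    finally show "card {i \<in> I. (fst \<circ> f) i = z} \<le> k z" .
  qed
qed

lemma entire_zorder_pos:
  assumes "f holomorphic_on UNIV" "f z0 \<noteq> 0" "f p = 0"
  shows "0 < zorder f p"
proof -
  have "\<forall>\<^sub>F w in at p. f w \<noteq> 0"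
    using non_zero_neighbour_alt[OF assms(1) open_UNIV connected_UNIV UNIV_I UNIV_I assms(2), of p] by simp
  then have "\<exists>\<^sub>F w in at p. f w \<noteq> 0"
    by (intro eventually_frequently) auto
  then show ?thesis
    using zorder_pos_iff[OF assms(1) open_UNIV UNIV_I] assms(3) by blast
qed

lemma entire_finite_zeros:
  assumes "f holomorphic_on UNIV" "f z0 \<noteq> 0" "bounded A"
  shows "finite {z\<in>A. f z = 0}"
proof (cases "\<exists>p. f p = 0")
  case True
  then have nc: "\<not> f constant_on UNIV" using assms(2) unfolding constant_on_def by (metis UNIV_I)
  obtain B where "\<And>z. z \<in> A \<Longrightarrow> cmod z \<le> B" using assms(3) unfolding bounded_iff by blast
  then have "A \<subseteq> cball 0 B" by auto
  then have "{z\<in>A. f z = 0} \<subseteq> {z\<in>cball 0 B. f z = 0}" by auto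
  moreover have "finite {z\<in>cball 0 B. f z = 0}"
    using holomorphic_compact_finite_zeros[OF assms(1) open_UNIV connected_UNIV compact_cball subset_UNIV nc] .
  ultimately show ?thesis by (rule finite_subset)
qed simp

text \<open>Rouche's theorem with winding numbers evaluated: they are 1 inside the circle and 0 outside.\<close>

lemma zero_count_circle:
  assumes f: "f holomorphic_on UNIV" and D: "D holomorphic_on UNIV" and \<rho>: "0 < \<rho>"
    and less: "\<And>z. z \<in> sphere c \<rho> \<Longrightarrow> cmod (D z - f z) < cmod (f z)"
  shows "(\<Sum>p\<in>{p\<in>ball c \<rho>. D p = 0}. zorder D p) = (\<Sum>p\<in>{p\<in>ball c \<rho>. f p = 0}. zorder f p)"
proof -
  define s where "s = ball c (\<rho> + 1)"
  define z0 where "z0 = c + of_real \<rho>"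
  have z0: "z0 \<in> sphere c \<rho>" using \<rho> by (simp add: z0_def dist_norm)
  have fz0: "f z0 \<noteq> 0" using less[OF z0] by auto
  have Dz0: "D z0 \<noteq> 0" using less[OF z0] by auto
  have on: "f z \<noteq> 0" "D z \<noteq> 0" if "z \<in> sphere c \<rho>" for z
    using less[OF that] by auto
  have fin: "finite {p\<in>s. D p = 0}" "finite {p\<in>s. f p = 0}"
    unfolding s_def by (intro entire_finite_zeros[OF D Dz0] entire_finite_zeros[OF f fz0] bounded_ball)+
  have out: "winding_number (circlepath c \<rho>) z = 0" if "z \<notin> cball c \<rho>" for z
    using that \<rho> by (intro winding_number_zero_outside[of _ "cball c \<rho>"]) auto
  have "(\<Sum>p\<in>{p\<in>s. f p + (D p - f p) = 0}. winding_number (circlepath c \<rho>) p * zorder (\<lambda>p. f p + (D p - f p)) p)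
     = (\<Sum>p\<in>{p\<in>s. f p = 0}. winding_number (circlepath c \<rho>) p * zorder f p)"
  proof (rule Rouche_theorem)
    show "open s" "connected s" by (simp_all add: s_def)
    show "f holomorphic_on s" using f by (rule holomorphic_on_subset) simp
    show "(\<lambda>p. D p - f p) holomorphic_on s"
      by (intro holomorphic_on_diff holomorphic_on_subset[OF D] holomorphic_on_subset[OF f]) auto
    show "path_image (circlepath c \<rho>) \<subseteq> s" using \<rho> by (auto simp: s_def)
    show "\<forall>z\<in>path_image (circlepath c \<rho>). cmod (D z - f z) < cmod (f z)" using less \<rho> by simp
    show "\<forall>z. z \<notin> s \<longrightarrow> winding_number (circlepath c \<rho>) z = 0" using out by (auto simp: s_def)
  qed (use fin in auto)
  then have eq: "(\<Sum>p\<in>{p\<in>s. D p = 0}. winding_number (circlepath c \<rho>) p * zorder D p)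
     = (\<Sum>p\<in>{p\<in>s. f p = 0}. winding_number (circlepath c \<rho>) p * zorder f p)" by simp
  have inside: "(\<Sum>p\<in>{p\<in>s. h p = 0}. winding_number (circlepath c \<rho>) p * zorder h p)
      = of_int (\<Sum>p\<in>{p\<in>ball c \<rho>. h p = 0}. zorder h p)"
    if "finite {p\<in>s. h p = 0}" "\<And>z. z \<in> sphere c \<rho> \<Longrightarrow> h z \<noteq> 0" for h
  proof -
    have "(\<Sum>p\<in>{p\<in>s. h p = 0}. winding_number (circlepath c \<rho>) p * zorder h p)
       = (\<Sum>p\<in>{p\<in>ball c \<rho>. h p = 0}. winding_number (circlepath c \<rho>) p * zorder h p)"
    proof (rule sum.mono_neutral_right[OF that(1)])
      show "{p \<in> ball c \<rho>. h p = 0} \<subseteq> {p \<in> s. h p = 0}" by (auto simp: s_def)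
      show "\<forall>p\<in>{p \<in> s. h p = 0} - {p \<in> ball c \<rho>. h p = 0}. winding_number (circlepath c \<rho>) p * zorder h p = 0"
      proof
        fix p assume "p \<in> {p \<in> s. h p = 0} - {p \<in> ball c \<rho>. h p = 0}"
        then have "p \<notin> cball c \<rho>" using that(2)[of p] by (auto simp: sphere_def)
        then show "winding_number (circlepath c \<rho>) p * zorder h p = 0" using out by simp
      qed
    qed
    also have "\<dots> = (\<Sum>p\<in>{p\<in>ball c \<rho>. h p = 0}. of_int (zorder h p))"
      by (intro sum.cong refl) (simp add: winding_number_circlepath dist_norm norm_minus_commute)
    finally show ?thesis by simp
  qed
  show ?thesis using eq inside[OF fin(1) on(2)] inside[OF fin(2) on(1)] by (metis of_int_eq_iff)
qed

section \<open>Zeros of functions of sine type\<close>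

text \<open>An entire function that is asymptotic to \<open>\<kappa> * z\<^sup>2 * sin (m * (z - t0))\<close>, with an error that is small
  relative to the growth of the sine, and square summable, after division by \<open>z\<^sup>2\<close>, along the zeros of
  the sine.\<close>

locale sine_type =
  fixes D :: "complex \<Rightarrow> complex" and \<kappa> :: complex and m t0 :: real and b :: "int \<Rightarrow> real"
  assumes holo: "D holomorphic_on UNIV" and kappa: "\<kappa> \<noteq> 0" and m_pos: "0 < m"
    and near: "\<And>\<delta>. 0 < \<delta> \<Longrightarrow> \<exists>R. \<forall>z. R \<le> cmod z \<longrightarrow>
        cmod (D z - \<kappa> * z\<^sup>2 * sin (of_real m * (z - of_real t0))) \<le> \<delta> * (cmod z)\<^sup>2 * exp (m * \<bar>Im z\<bar>)"
    and at_nodes: "\<And>n. 1 \<le> \<bar>t0 + of_int n * pi / m\<bar> \<Longrightarrow>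
        cmod (D (of_real (t0 + of_int n * pi / m))) \<le> (t0 + of_int n * pi / m)\<^sup>2 * b n"
    and b_summable: "(\<lambda>n. (b n)\<^sup>2) summable_on UNIV"
begin

definition T :: "int \<Rightarrow> complex" where "T n = of_real (t0 + of_int n * pi / m)"

definition Sn :: "complex \<Rightarrow> complex" where "Sn z = sin (of_real m * (z - of_real t0))"

lemma phase_T: "of_real m * (z - of_real t0) = of_real m * (z - T n) + of_real (of_int n * pi)"
  using m_pos by (simp add: T_def field_simps)

lemma dist_T: "cmod (T n - T k) = of_int \<bar>n - k\<bar> * (pi / m)"
proof -
  have "T n - T k = of_real (of_int (n - k) * (pi / m))"
    by (simp add: T_def algebra_simps diff_divide_distrib)
  then show ?thesis using m_pos by (simp only: norm_of_real abs_mult) simp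
qed

lemma T_large: "\<exists>N. \<forall>n. N \<le> \<bar>n\<bar> \<longrightarrow> R \<le> cmod (T n)"
proof (intro exI allI impI)
  fix n assume n: "\<lceil>(R + \<bar>t0\<bar>) * m / pi\<rceil> \<le> \<bar>n\<bar>"
  then have "(R + \<bar>t0\<bar>) * m / pi \<le> of_int \<bar>n\<bar>" by linarith
  then have "R + \<bar>t0\<bar> \<le> of_int \<bar>n\<bar> * (pi / m)" using m_pos by (simp add: field_simps)
  also have "of_int \<bar>n\<bar> * (pi / m) = cmod (T n - of_real t0)"
    using dist_T[of n 0] by (simp add: T_def)
  also have "\<dots> \<le> cmod (T n) + \<bar>t0\<bar>"
    using norm_triangle_ineq4[of "T n" "of_real t0"] by simp
  finally show "R \<le> cmod (T n)" by simp
qed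

text \<open>Outside the discs of radius \<open>r\<close> around the nodes the sine has its full exponential size.\<close>

lemma sine_dominates:
  assumes r: "0 < r"
  obtains R where "0 < R"
    "\<And>z. R \<le> cmod z \<Longrightarrow> (\<And>n. r \<le> cmod (z - T n)) \<Longrightarrow> cmod (D z - \<kappa> * z\<^sup>2 * Sn z) < cmod (\<kappa> * z\<^sup>2 * Sn z)"
proof -
  have "0 < m * r" using m_pos r by simp
  then obtain c where c: "0 < c"
    "\<And>w. (\<And>n::int. m * r \<le> cmod (w - of_real (of_int n * pi))) \<Longrightarrow> c * exp \<bar>Im w\<bar> \<le> cmod (sin w)"
    using sin_lower_bound by blast
  have "0 < cmod \<kappa> * c / 2" using c kappa by simp
  from near[OF this] obtain R where R: "\<And>z. R \<le> cmod z \<Longrightarrow>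
      cmod (D z - \<kappa> * z\<^sup>2 * Sn z) \<le> cmod \<kappa> * c / 2 * (cmod z)\<^sup>2 * exp (m * \<bar>Im z\<bar>)"
    unfolding Sn_def by blast
  show ?thesis
  proof (rule that[of "max R 1"])
    fix z assume z: "max R 1 \<le> cmod z" and far: "\<And>n. r \<le> cmod (z - T n)"
    have "m * r \<le> cmod (of_real m * (z - of_real t0) - of_real (of_int n * pi))" for n
      unfolding phase_T[of z n] using far[of n] m_pos by (simp add: norm_mult)
    from c(2)[OF this] have "c * exp (m * \<bar>Im z\<bar>) \<le> cmod (Sn z)"
      using m_pos by (simp add: Sn_def abs_mult)
    then have "cmod \<kappa> * (cmod z)\<^sup>2 * (c * exp (m * \<bar>Im z\<bar>)) \<le> cmod \<kappa> * (cmod z)\<^sup>2 * cmod (Sn z)"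
      by (rule mult_left_mono) simp
    moreover have "0 < cmod \<kappa> * (cmod z)\<^sup>2 * (c * exp (m * \<bar>Im z\<bar>))"
      using c kappa z by (intro mult_pos_pos zero_less_power) auto
    ultimately show "cmod (D z - \<kappa> * z\<^sup>2 * Sn z) < cmod (\<kappa> * z\<^sup>2 * Sn z)"
      using R[of z] z by (simp add: norm_mult norm_power mult_ac)
  qed simp
qed

text \<open>Near the node \<open>T n\<close> the function \<open>D z / (\<kappa> * z\<^sup>2)\<close> is the sine plus an error which is small on a
  disc of radius \<open>2 * r\<close>.  By Cauchy's inequality the derivative of the error is small on the disc of radius \<open>r\<close>,
  so the derivative of the sum is close to \<open>\<plusminus> m\<close> there: the contraction argument gives a unique zero, and
  this zero is simple.\<close>

lemma local_zeros:
  obtains r N0 Z where "0 < r" "r < pi / (4 * m)" "(1::int) \<le> N0"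
    "\<And>n. N0 \<le> \<bar>n\<bar> \<Longrightarrow> Z n \<in> cball (T n) r" "\<And>n. N0 \<le> \<bar>n\<bar> \<Longrightarrow> D (Z n) = 0"
    "\<And>n. N0 \<le> \<bar>n\<bar> \<Longrightarrow> zorder D (Z n) = 1"
    "\<And>n. N0 \<le> \<bar>n\<bar> \<Longrightarrow> cmod (Z n - T n) \<le> 2 / (m * cmod \<kappa>) * b n"
    "\<And>n w. N0 \<le> \<bar>n\<bar> \<Longrightarrow> w \<in> cball (T n) r \<Longrightarrow> D w = 0 \<Longrightarrow> w = Z n"
proof -
  have "isCont (cos :: complex \<Rightarrow> complex) 0" by simp
  then obtain d where d: "0 < d" "\<And>w :: complex. cmod w < d \<Longrightarrow> cmod (cos w - 1) < 1 / 4"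
    unfolding continuous_at_eps_delta dist_norm by (metis cos_zero diff_zero zero_less_divide_1_iff zero_less_numeral)
  \<comment> \<open>Small enough for the cosine to stay within \<open>1 / 4\<close> of 1, and for the discs around the nodes to be disjoint.\<close>
  define r where "r = min (d / (2 * m)) (pi / (8 * m))"
  have r: "0 < r" "r < pi / (4 * m)" "m * r < d"
  proof -
    show "0 < r" using d m_pos by (simp add: r_def)
    have "r \<le> pi / (8 * m)" by (simp add: r_def)
    also have "\<dots> < pi / (4 * m)" using m_pos by (intro divide_strict_left_mono) auto
    finally show "r < pi / (4 * m)" .
    have "m * r \<le> m * (d / (2 * m))" using m_pos by (intro mult_left_mono) (auto simp: r_def)
    then show "m * r < d" using m_pos d by simp
  qed
  \<comment> \<open>An error of size \<open>\<eta>\<close> on discs of radius \<open>2 * r\<close> has derivative at most \<open>m / 4\<close> on those of radius \<open>r\<close>.\<close>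
  define \<eta> where "\<eta> = m * r / 4"
  have \<eta>: "0 < \<eta>" using m_pos r by (simp add: \<eta>_def)
  define \<delta> where "\<delta> = cmod \<kappa> * \<eta> * exp (- (m * (2 * r)))"
  have "0 < \<delta>" using kappa \<eta> by (simp add: \<delta>_def)
  from near[OF this] obtain R where R: "\<And>z. R \<le> cmod z \<Longrightarrow>
      cmod (D z - \<kappa> * z\<^sup>2 * Sn z) \<le> \<delta> * (cmod z)\<^sup>2 * exp (m * \<bar>Im z\<bar>)"
    unfolding Sn_def by blast
  define R' where "R' = max R 1 + 2 * r"
  obtain N where N: "\<And>n. N \<le> \<bar>n\<bar> \<Longrightarrow> R' \<le> cmod (T n)" using T_large[of R'] by blast
  define G where "G z = D z / (\<kappa> * z\<^sup>2)" for z
  define err where "err z = G z - Sn z" for z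
  have holG: "G holomorphic_on - {0}"
    unfolding G_def using kappa
    by (intro holomorphic_intros holomorphic_on_subset[OF holo]) auto
  have holerr: "err holomorphic_on - {0}"
    unfolding err_def Sn_def by (intro holomorphic_intros holG)
  have ex: "\<exists>Z. Z \<in> cball (T n) r \<and> D Z = 0 \<and> zorder D Z = 1 \<and> cmod (Z - T n) \<le> 2 / (m * cmod \<kappa>) * b n \<and>
     (\<forall>w\<in>cball (T n) r. D w = 0 \<longrightarrow> w = Z)" if n: "max 1 N \<le> \<bar>n\<bar>" for n
  proof -
    have TR: "R' \<le> cmod (T n)" using N[of n] n by simp
    have large: "max R 1 \<le> cmod z" if "z \<in> cball (T n) (2 * r)" for z
    proof -
      have "cmod (T n - z) \<le> 2 * r" using that by (simp add: dist_norm)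
      then show ?thesis using norm_triangle_sub[of "T n" z] TR unfolding R'_def by linarith
    qed
    then have nz: "z \<noteq> 0" if "z \<in> cball (T n) (2 * r)" for z using that by fastforce
    have err_le: "cmod (err z) \<le> \<eta>" if z: "z \<in> cball (T n) (2 * r)" for z
    proof -
      have "\<bar>Im z\<bar> \<le> cmod (z - T n)" using abs_Im_le_cmod[of "z - T n"] by (simp add: T_def)
      also have "\<dots> \<le> 2 * r" using z by (simp add: dist_norm norm_minus_commute)
      finally have e: "exp (m * \<bar>Im z\<bar>) \<le> exp (m * (2 * r))" using m_pos by simp
      have "err z = (D z - \<kappa> * z\<^sup>2 * Sn z) / (\<kappa> * z\<^sup>2)"
        using kappa nz[OF z] by (simp add: err_def G_def field_simps)
      then have "cmod (err z) = cmod (D z - \<kappa> * z\<^sup>2 * Sn z) / (cmod \<kappa> * (cmod z)\<^sup>2)"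
        by (simp add: norm_divide norm_mult norm_power)
      also have "\<dots> \<le> (\<delta> * (cmod z)\<^sup>2 * exp (m * \<bar>Im z\<bar>)) / (cmod \<kappa> * (cmod z)\<^sup>2)"
        using R[of z] large[OF z] by (intro divide_right_mono) auto
      also have "\<dots> = \<delta> * exp (m * \<bar>Im z\<bar>) / cmod \<kappa>" using nz[OF z] by simp
      also have "\<dots> \<le> \<delta> * exp (m * (2 * r)) / cmod \<kappa>"
        using \<open>0 < \<delta>\<close> e by (intro divide_right_mono mult_left_mono) auto
      also have "\<dots> = \<eta>" using kappa by (simp add: \<delta>_def exp_minus)
      finally show ?thesis .
    qed
    \<comment> \<open>The sign of the derivative of the sine at \<open>T n\<close>.\<close>
    define s where "s = cos (of_real (of_int n * pi) :: complex)"
    have sin0: "sin (of_real (of_int n * pi) :: complex) = 0" by (auto simp: sin_eq_0)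
    have s2: "s\<^sup>2 = 1"
      using sin_cos_squared_add[of "of_real (of_int n * pi) :: complex"]
      unfolding sin0 s_def[symmetric] by simp
    have "cmod s = 1 \<or> cmod s = - 1"
      using arg_cong[OF s2, of cmod] by (simp add: norm_power power2_eq_1_iff)
    then have s1: "cmod s = 1" using norm_ge_zero[of s] by auto
    define G' where "G' z = of_real m * cos (of_real m * (z - of_real t0)) + deriv err z" for z
    have der: "(G has_field_derivative G' z) (at z)" if z: "z \<in> cball (T n) r" for z
    proof -
      have "z \<noteq> 0" using nz[of z] z r by auto
      then have "(err has_field_derivative deriv err z) (at z)"
        using holomorphic_derivI[OF holerr open_Compl[OF closed_singleton], of z] by simp
      moreover have "(Sn has_field_derivative of_real m * cos (of_real m * (z - of_real t0))) (at z)"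
        unfolding Sn_def by (auto intro!: derivative_eq_intros)
      ultimately have "((\<lambda>z. Sn z + err z) has_field_derivative G' z) (at z)"
        unfolding G'_def by (rule DERIV_add[rotated])
      then show ?thesis by (simp add: err_def)
    qed
    have close: "cmod (G' z - s * of_real m) \<le> m / 2" if z: "z \<in> cball (T n) r" for z
    proof -
      have sub: "cball z r \<subseteq> cball (T n) (2 * r)"
        using cball_trans[OF z] unfolding mult_2 by blast
      have "cmod ((deriv ^^ 1) err z) \<le> fact 1 * \<eta> / r ^ 1"
      proof (rule Cauchy_inequality)
        have "cball z r \<subseteq> - {0}" using sub nz by blast
        from holomorphic_on_subset[OF holerr this]
        show "err holomorphic_on ball z r" "continuous_on (cball z r) err"
          by (auto intro: holomorphic_on_subset holomorphic_on_imp_continuous_on ball_subset_cball)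
        show "cmod (err x) \<le> \<eta>" if "cmod (z - x) = r" for x
          using sub that by (intro err_le) (auto simp: dist_norm)
      qed (rule r)
      then have 1: "cmod (deriv err z) \<le> m / 4" using r by (simp add: \<eta>_def)
      have "cos (of_real m * (z - of_real t0)) = cos (of_real m * (z - T n)) * s"
        unfolding phase_T[of z n] cos_add s_def sin0 by simp
      then have "G' z - s * of_real m = of_real m * s * (cos (of_real m * (z - T n)) - 1) + deriv err z"
        by (simp add: G'_def algebra_simps)
      then have "cmod (G' z - s * of_real m) \<le> m * cmod (cos (of_real m * (z - T n)) - 1) + cmod (deriv err z)"
        using norm_triangle_ineq[of "of_real m * s * (cos (of_real m * (z - T n)) - 1)" "deriv err z"] s1 m_pos
        by (simp add: norm_mult)
      moreover have "cmod (cos (of_real m * (z - T n)) - 1) \<le> 1 / 4"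
      proof -
        have "m * cmod (z - T n) \<le> m * r" using z m_pos by (intro mult_left_mono) (auto simp: dist_norm norm_minus_commute)
        then have "m * cmod (z - T n) < d" using r(3) by linarith
        then have "cmod (of_real m * (z - T n)) < d" using m_pos by (simp add: norm_mult)
        then show ?thesis by (intro less_imp_le d(2))
      qed
      then have "m * cmod (cos (of_real m * (z - T n)) - 1) \<le> m * (1 / 4)"
        using m_pos by (intro mult_left_mono) auto
      ultimately show ?thesis using 1 by linarith
    qed
    have "Sn (T n) = 0"
      unfolding Sn_def phase_T[of "T n" n] using sin0 by simp
    then have "G (T n) = err (T n)" by (simp add: err_def)
    then have "cmod (G (T n)) \<le> \<eta>" using err_le[of "T n"] r by simp
    also have "\<eta> \<le> m * r / 2" using m_pos r by (simp add: \<eta>_def)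
    finally obtain z where z: "z \<in> cball (T n) r" "G z = 0" "cmod (z - T n) \<le> 2 * cmod (G (T n)) / m" "G' z \<noteq> 0"
      "\<And>w. w \<in> cball (T n) r \<Longrightarrow> G w = 0 \<Longrightarrow> w = z"
      using zero_by_contraction[OF s2 s1 m_pos r(1) der close] by blast
    have Tnz: "T n \<noteq> 0" using nz[of "T n"] r by simp
    have GT: "cmod (G (T n)) \<le> b n / cmod \<kappa>"
    proof -
      have "1 \<le> cmod (T n)" using TR r by (simp add: R'_def)
      then have "cmod (D (T n)) \<le> (cmod (T n))\<^sup>2 * b n"
        using at_nodes[of n] unfolding T_def norm_of_real power2_abs by blast
      then have "cmod (D (T n)) / (cmod \<kappa> * (cmod (T n))\<^sup>2) \<le> ((cmod (T n))\<^sup>2 * b n) / (cmod \<kappa> * (cmod (T n))\<^sup>2)"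
        by (rule divide_right_mono) simp
      then show ?thesis using Tnz by (simp add: G_def norm_divide norm_mult norm_power)
    qed
    have "2 * cmod (G (T n)) / m \<le> 2 * (b n / cmod \<kappa>) / m"
      using m_pos by (intro divide_right_mono mult_left_mono GT) auto
    then have bound: "cmod (z - T n) \<le> 2 / (m * cmod \<kappa>) * b n"
      using z(3) by (simp add: field_simps)
    have zero_iff: "G w = 0 \<longleftrightarrow> D w = 0" if "w \<in> cball (T n) r" for w
      using nz[of w] that r kappa by (auto simp: G_def)
    have znz: "z \<noteq> 0" using nz[of z] z(1) r by auto
    have "zorder D z = 1"
    proof (rule zorder_zero_eqI'[of D z 1])
      show "D analytic_on {z}" unfolding analytic_at using holo by blast
      show "(deriv ^^ i) D z = 0" if "i < nat 1" for i using that zero_iff[OF z(1)] z(2) by simp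
      show "(deriv ^^ nat 1) D z \<noteq> 0"
      proof
        assume "(deriv ^^ nat 1) D z = 0"
        then have d0: "(D has_field_derivative 0) (at z)"
          using holomorphic_derivI[OF holo open_UNIV UNIV_I, of z] by simp
        have "D z = 0" using zero_iff[OF z(1)] z(2) by simp
        then have "(G has_field_derivative 0) (at z)"
          unfolding G_def using znz kappa by (auto intro!: derivative_eq_intros d0)
        then show False using DERIV_unique[OF der[OF z(1)]] z(4) by simp
      qed
    qed simp
    then show ?thesis
      using z(1,2,5) bound zero_iff by blast
  qed
  define Z where "Z n = (SOME Z. Z \<in> cball (T n) r \<and> D Z = 0 \<and> zorder D Z = 1 \<and> cmod (Z - T n) \<le> 2 / (m * cmod \<kappa>) * b n \<and>
     (\<forall>w\<in>cball (T n) r. D w = 0 \<longrightarrow> w = Z))" for n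
  have Z: "Z n \<in> cball (T n) r \<and> D (Z n) = 0 \<and> zorder D (Z n) = 1 \<and> cmod (Z n - T n) \<le> 2 / (m * cmod \<kappa>) * b n \<and>
     (\<forall>w\<in>cball (T n) r. D w = 0 \<longrightarrow> w = Z n)" if "max 1 N \<le> \<bar>n\<bar>" for n
    unfolding Z_def by (rule someI_ex[OF ex[OF that]])
  show ?thesis
  proof (rule that[OF r(1,2)])
    show "1 \<le> max 1 N" by simp
    fix n assume n: "max 1 N \<le> \<bar>n\<bar>"
    show "Z n \<in> cball (T n) r" "D (Z n) = 0" "zorder D (Z n) = 1" "cmod (Z n - T n) \<le> 2 / (m * cmod \<kappa>) * b n"
      using Z[OF n] by blast+
    show "w = Z n" if "w \<in> cball (T n) r" "D w = 0" for w
      using Z[OF n] that by blast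
  qed
qed

text \<open>All but finitely many zeros of \<open>D\<close> are the zeros \<open>Z n\<close> near the nodes with \<open>\<bar>n\<bar> \<ge> N0\<close>.  The remaining
  finite set \<open>E\<close> has to supply the indices \<open>\<bar>n\<bar> < N0\<close>, so it must contain at least \<open>2 * N0 - 1\<close> zeros, counted
  with multiplicity.  Rouche's theorem on a large circle that crosses the real axis halfway between nodes shows
  this: inside it the comparison function has the distinct zeros \<open>T n\<close> with \<open>\<bar>n\<bar> \<le> N\<close>, while the
  zeros \<open>Z n\<close> use up only the indices with \<open>N0 \<le> \<bar>n\<bar> \<le> N\<close>.\<close>

lemma zeros_listed:
  obtains lam \<epsilon> where "lists_almost_all_eigenvalues (\<lambda>z. D z = 0) D lam" "\<And>n. lam n = T n + \<epsilon> n"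
    "(\<lambda>n. (cmod (\<epsilon> n))\<^sup>2) summable_on UNIV" "\<exists>N. \<forall>n. N \<le> \<bar>n\<bar> \<longrightarrow> simple_zero D (lam n)"
proof -
  obtain r N0 Z where r: "0 < r" "r < pi / (4 * m)" and N0: "(1::int) \<le> N0"
    and Z: "\<And>n. N0 \<le> \<bar>n\<bar> \<Longrightarrow> Z n \<in> cball (T n) r" "\<And>n. N0 \<le> \<bar>n\<bar> \<Longrightarrow> D (Z n) = 0"
    "\<And>n. N0 \<le> \<bar>n\<bar> \<Longrightarrow> zorder D (Z n) = 1"
    "\<And>n. N0 \<le> \<bar>n\<bar> \<Longrightarrow> cmod (Z n - T n) \<le> 2 / (m * cmod \<kappa>) * b n"
    "\<And>n w. N0 \<le> \<bar>n\<bar> \<Longrightarrow> w \<in> cball (T n) r \<Longrightarrow> D w = 0 \<Longrightarrow> w = Z n"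
    using local_zeros by blast
  obtain R where R: "0 < R"
    "\<And>z. R \<le> cmod z \<Longrightarrow> (\<And>n. r \<le> cmod (z - T n)) \<Longrightarrow> cmod (D z - \<kappa> * z\<^sup>2 * Sn z) < cmod (\<kappa> * z\<^sup>2 * Sn z)"
    using sine_dominates[OF r(1)] by blast
  have gap: "2 * r < pi / m"
  proof -
    have "2 * r < 2 * (pi / (4 * m))" using r by simp
    also have "\<dots> \<le> pi / m" using m_pos by (simp add: field_simps)
    finally show ?thesis .
  qed
  have ZT: "cmod (Z n - T n) \<le> r" if "N0 \<le> \<bar>n\<bar>" for n
    using Z(1)[OF that] by (simp add: dist_norm norm_minus_commute)
  have Z_inj: "n = k" if "N0 \<le> \<bar>n\<bar>" "N0 \<le> \<bar>k\<bar>" "Z n = Z k" for n k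
  proof (rule ccontr)
    assume "n \<noteq> k"
    then have "1 \<le> real_of_int \<bar>n - k\<bar>" by linarith
    then have "1 * (pi / m) \<le> of_int \<bar>n - k\<bar> * (pi / m)" using m_pos by (intro mult_right_mono) auto
    also have "\<dots> = cmod (T n - T k)" by (rule dist_T[symmetric])
    also have "\<dots> \<le> cmod (Z n - T n) + cmod (Z k - T k)"
      using norm_triangle_ineq4[of "Z k - T k" "Z n - T n"] that(3) by (simp add: algebra_simps)
    also have "\<dots> \<le> 2 * r" using ZT[OF that(1)] ZT[OF that(2)] by simp
    finally show False using gap by simp
  qed
  \<comment> \<open>The zeros that are not attached to a node.\<close>
  define E where "E = {z. D z = 0} - Z ` {n. N0 \<le> \<bar>n\<bar>}"
  obtain N1 where N1: "\<And>n. N1 \<le> \<bar>n\<bar> \<Longrightarrow> R + r \<le> cmod (T n)" using T_large[of "R + r"] by blast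
  define f where "f z = \<kappa> * z\<^sup>2 * Sn z" for z
  have f: "f holomorphic_on UNIV" unfolding f_def Sn_def by (intro holomorphic_intros)
  \<comment> \<open>Circles with these radii around \<open>t0\<close> stay away from all nodes by at least half their distance.\<close>
  define \<rho> where "\<rho> N = (real N + 1 / 2) * (pi / m)" for N :: nat
  have T0: "cmod (T n - of_real t0) = of_int \<bar>n\<bar> * (pi / m)" for n
    using dist_T[of n 0] by (simp add: T_def)
  have circle: "cmod (D z - f z) < cmod (f z)"
    if z: "z \<in> sphere (of_real t0) (\<rho> N)" and N: "R + \<bar>t0\<bar> \<le> \<rho> N" for z N
    unfolding f_def
  proof (rule R(2))
    have zt: "cmod (z - of_real t0) = \<rho> N" using z by (simp add: dist_norm norm_minus_commute)
    have "\<rho> N \<le> cmod z + \<bar>t0\<bar>" using norm_triangle_ineq4[of z "of_real t0"] zt by simp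
    then show "R \<le> cmod z" using N by simp
    fix n
    have "1 / 2 \<le> \<bar>real N + 1 / 2 - of_int \<bar>n\<bar>\<bar>"
    proof (cases "\<bar>n\<bar> \<le> int N")
      case True
      then have "real_of_int \<bar>n\<bar> \<le> real N" by linarith
      then show ?thesis by linarith
    next
      case False
      then have "real N + 1 \<le> real_of_int \<bar>n\<bar>" by linarith
      then show ?thesis by linarith
    qed
    then have "1 / 2 * (pi / m) \<le> \<bar>real N + 1 / 2 - of_int \<bar>n\<bar>\<bar> * (pi / m)"
      using m_pos by (intro mult_right_mono) auto
    also have "\<dots> = \<bar>(real N + 1 / 2 - of_int \<bar>n\<bar>) * (pi / m)\<bar>"
      using m_pos by (simp only: abs_mult) simp
    also have "\<dots> = \<bar>cmod (z - of_real t0) - cmod (T n - of_real t0)\<bar>"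
      by (simp only: zt T0 \<rho>_def left_diff_distrib)
    also have "\<dots> \<le> cmod (z - T n)"
      using norm_triangle_ineq3[of "z - of_real t0" "T n - of_real t0"] by simp
    finally show "r \<le> cmod (z - T n)" using gap by simp
  qed
  have rho_large: "\<exists>N. n \<le> N \<and> B \<le> \<rho> N" for n B
  proof -
    obtain k :: nat where k: "B * m / pi < k" using reals_Archimedean2 by blast
    have "B \<le> real k * (pi / m)" using k m_pos by (simp add: field_simps)
    also have "\<dots> \<le> \<rho> (max n k)"
      unfolding \<rho>_def using m_pos by (intro mult_right_mono) auto
    finally show ?thesis by (intro exI[of _ "max n k"]) simp
  qed
  \<comment> \<open>Neither function vanishes identically, so their zeros are isolated and of positive order.\<close>
  obtain z0 where z0: "D z0 \<noteq> 0" "f z0 \<noteq> 0"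
  proof -
    obtain N where N: "R + \<bar>t0\<bar> \<le> \<rho> N" using rho_large[of 0 "R + \<bar>t0\<bar>"] by blast
    have "0 < \<rho> N" using N R(1) by linarith
    then have "of_real t0 + of_real (\<rho> N) \<in> sphere (of_real t0 :: complex) (\<rho> N)" by (simp add: dist_norm)
    from circle[OF this N] show ?thesis using that[of "of_real t0 + of_real (\<rho> N)"] by fastforce
  qed
  have E_bounded: "E \<subseteq> {z\<in>cball 0 (max R (of_int \<bar>N0\<bar> * (pi / m) + \<bar>t0\<bar> + r)). D z = 0}"
  proof
    fix z assume z: "z \<in> E"
    have "z \<in> cball 0 (max R (of_int \<bar>N0\<bar> * (pi / m) + \<bar>t0\<bar> + r))"
    proof (rule ccontr)
      assume out: "z \<notin> cball 0 (max R (of_int \<bar>N0\<bar> * (pi / m) + \<bar>t0\<bar> + r))"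
      have "\<exists>n. cmod (z - T n) < r"
      proof (rule ccontr)
        assume "\<not> ?thesis"
        then have "cmod (D z - \<kappa> * z\<^sup>2 * Sn z) < cmod (\<kappa> * z\<^sup>2 * Sn z)"
          using out by (intro R(2)) (auto simp: not_less)
        then show False using z by (simp add: E_def)
      qed
      then obtain n where n: "cmod (z - T n) < r" by blast
      have "of_int \<bar>N0\<bar> * (pi / m) + \<bar>t0\<bar> + r < cmod z" using out by simp
      also have "\<dots> \<le> cmod (z - T n) + cmod (T n - of_real t0) + \<bar>t0\<bar>"
        using norm_triangle_ineq[of "z - T n" "T n"] norm_triangle_ineq[of "T n - of_real t0" "of_real t0"] by simp
      also have "\<dots> \<le> r + of_int \<bar>n\<bar> * (pi / m) + \<bar>t0\<bar>" using n T0[of n] by simp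
      finally have "of_int \<bar>N0\<bar> * (pi / m) < of_int \<bar>n\<bar> * (pi / m)" by simp
      then have "real_of_int \<bar>N0\<bar> < of_int \<bar>n\<bar>"
        using m_pos by (simp only: mult_less_cancel_right_pos divide_pos_pos pi_gt_zero)
      then have "N0 \<le> \<bar>n\<bar>" by linarith
      then have "z = Z n" using n z by (intro Z(5)) (auto simp: E_def dist_norm norm_minus_commute)
      then show False using z \<open>N0 \<le> \<bar>n\<bar>\<close> by (auto simp: E_def)
    qed
    then show "z \<in> {z\<in>cball 0 (max R (of_int \<bar>N0\<bar> * (pi / m) + \<bar>t0\<bar> + r)). D z = 0}"
      using z by (simp add: E_def)
  qed
  have fin_E: "finite E"
    by (rule finite_subset[OF E_bounded entire_finite_zeros[OF holo z0(1) bounded_cball]])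
  have zpos: "0 < zorder D z" if "D z = 0" for z
    by (rule entire_zorder_pos[OF holo z0(1) that])
  have fin_small: "finite {n. \<bar>n\<bar> < N0}" by (rule finite_subset[of _ "{- N0..N0}"]) auto
  have count: "int (card {n. \<bar>n\<bar> < N0}) \<le> (\<Sum>z\<in>E. zorder D z)"
  proof -
    define B where "B = max R (of_int \<bar>N0\<bar> * (pi / m) + \<bar>t0\<bar> + r) + \<bar>t0\<bar> + 1"
    obtain N where N: "nat N0 \<le> N" "B \<le> \<rho> N" using rho_large by blast
    have \<rho>0: "0 < \<rho> N" using m_pos by (simp add: \<rho>_def add_pos_pos)
    have EN: "E \<subseteq> ball (of_real t0) (\<rho> N)"
    proof
      fix z assume "z \<in> E"
      then have "cmod z + \<bar>t0\<bar> < B" using E_bounded by (auto simp: B_def)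
      then have "cmod (z - of_real t0) < \<rho> N" using norm_triangle_ineq4[of z "of_real t0"] N by simp
      then show "z \<in> ball (of_real t0) (\<rho> N)" by (simp add: dist_norm norm_minus_commute)
    qed
    \<comment> \<open>The large circle contains all of \<open>E\<close>, and of the zeros \<open>Z n\<close> precisely those with \<open>n \<in> J\<close>.\<close>
    define J where "J = {n. N0 \<le> \<bar>n\<bar> \<and> \<bar>n\<bar> \<le> int N}"
    have finJ: "finite J" by (rule finite_subset[of _ "{- int N..int N}"]) (auto simp: J_def)
    have split: "{p\<in>ball (of_real t0) (\<rho> N). D p = 0} = E \<union> Z ` J"
    proof (intro equalityI subsetI)
      fix p assume p: "p \<in> {p\<in>ball (of_real t0) (\<rho> N). D p = 0}"
      show "p \<in> E \<union> Z ` J"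
      proof (cases "p \<in> E")
        case False
        then obtain n where n: "N0 \<le> \<bar>n\<bar>" "p = Z n" using p by (auto simp: E_def)
        have "of_int \<bar>n\<bar> * (pi / m) \<le> cmod (p - of_real t0) + cmod (Z n - T n)"
          unfolding T0[symmetric] using norm_triangle_ineq4[of "p - of_real t0" "Z n - T n"] n(2) by simp
        also have "\<dots> < \<rho> N + 1 / 2 * (pi / m)"
          using p ZT[OF n(1)] gap by (simp add: dist_norm norm_minus_commute)
        also have "\<dots> = (real N + 1) * (pi / m)" by (simp add: \<rho>_def algebra_simps add_divide_distrib)
        finally have "real_of_int \<bar>n\<bar> < real N + 1"
          using m_pos by (simp only: mult_less_cancel_right_pos divide_pos_pos pi_gt_zero)
        then have "n \<in> J" using n by (simp add: J_def)
        then show ?thesis using n by blast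
      qed simp
    next
      fix p assume "p \<in> E \<union> Z ` J"
      then consider "p \<in> E" | n where "n \<in> J" "p = Z n" by blast
      then show "p \<in> {p\<in>ball (of_real t0) (\<rho> N). D p = 0}"
      proof cases
        case 1
        then show ?thesis using EN by (auto simp: E_def)
      next
        case 2
        then have n: "N0 \<le> \<bar>n\<bar>" "\<bar>n\<bar> \<le> int N" by (auto simp: J_def)
        have "cmod (p - of_real t0) \<le> cmod (Z n - T n) + cmod (T n - of_real t0)"
          using norm_triangle_ineq[of "Z n - T n" "T n - of_real t0"] 2 by simp
        also have "\<dots> < 1 / 2 * (pi / m) + of_int \<bar>n\<bar> * (pi / m)" using ZT[OF n(1)] gap T0[of n] by simp
        also have "\<dots> \<le> 1 / 2 * (pi / m) + real N * (pi / m)"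
        proof -
          have "real_of_int \<bar>n\<bar> \<le> real N" using n(2) by linarith
          then show ?thesis using m_pos by (intro add_left_mono mult_right_mono) auto
        qed
        also have "\<dots> = \<rho> N" by (simp add: \<rho>_def algebra_simps)
        finally show ?thesis using Z(2)[OF n(1)] 2 by (simp add: dist_norm norm_minus_commute)
      qed
    qed
    have disj: "E \<inter> Z ` J = {}" by (auto simp: E_def J_def)
    have injJ: "inj_on Z J" using Z_inj by (auto simp: inj_on_def J_def)
    have "(\<Sum>p\<in>{p\<in>ball (of_real t0) (\<rho> N). D p = 0}. zorder D p) = (\<Sum>z\<in>E. zorder D z) + (\<Sum>n\<in>J. zorder D (Z n))"
      unfolding split using fin_E finJ disj injJ by (simp add: sum.union_disjoint sum.reindex)
    also have "(\<Sum>n\<in>J. zorder D (Z n)) = int (card J)"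
      using Z(3) by (simp add: J_def)
    finally have lhs: "(\<Sum>p\<in>{p\<in>ball (of_real t0) (\<rho> N). D p = 0}. zorder D p) = (\<Sum>z\<in>E. zorder D z) + int (card J)" .
    have "(\<Sum>p\<in>{p\<in>ball (of_real t0) (\<rho> N). D p = 0}. zorder D p)
        = (\<Sum>p\<in>{p\<in>ball (of_real t0) (\<rho> N). f p = 0}. zorder f p)"
    proof (rule zero_count_circle[OF f holo \<rho>0])
      have "R + \<bar>t0\<bar> \<le> \<rho> N" using N(2) unfolding B_def by linarith
      then show "cmod (D z - f z) < cmod (f z)" if "z \<in> sphere (of_real t0) (\<rho> N)" for z
        using circle[OF that] by blast
    qed
    also have "\<dots> \<ge> int (card (T ` {- int N..int N}))"
    proof -
      have fin: "finite {p\<in>ball (of_real t0) (\<rho> N). f p = 0}"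
        by (rule entire_finite_zeros[OF f z0(2) bounded_ball])
      have sub: "T ` {- int N..int N} \<subseteq> {p\<in>ball (of_real t0) (\<rho> N). f p = 0}"
      proof clarify
        fix n assume n: "n \<in> {- int N..int N}"
        have "sin (of_real (of_int n * pi) :: complex) = 0" by (auto simp: sin_eq_0)
        then have "f (T n) = 0"
          unfolding f_def Sn_def phase_T[of "T n" n] by simp
        moreover have "real_of_int \<bar>n\<bar> < real N + 1 / 2" using n by (simp add: abs_le_iff) linarith
        then have "of_int \<bar>n\<bar> * (pi / m) < \<rho> N"
          unfolding \<rho>_def using m_pos by (intro mult_strict_right_mono) auto
        then have "T n \<in> ball (of_real t0) (\<rho> N)"
          using T0[of n] by (simp add: dist_norm norm_minus_commute)
        ultimately show "T n \<in> ball (of_real t0) (\<rho> N) \<and> f (T n) = 0" by blast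
      qed
      have pos: "1 \<le> zorder f p" if "p \<in> {p\<in>ball (of_real t0) (\<rho> N). f p = 0}" for p
        using entire_zorder_pos[OF f z0(2), of p] that by simp
      have "int (card (T ` {- int N..int N})) \<le> int (card {p\<in>ball (of_real t0) (\<rho> N). f p = 0})"
        using card_mono[OF fin sub] by simp
      also have "\<dots> = (\<Sum>p\<in>{p\<in>ball (of_real t0) (\<rho> N). f p = 0}. 1)" by simp
      also have "\<dots> \<le> (\<Sum>p\<in>{p\<in>ball (of_real t0) (\<rho> N). f p = 0}. zorder f p)"
        by (rule sum_mono) (rule pos)
      finally show ?thesis .
    qed
    finally have le: "int (card (T ` {- int N..int N})) \<le> (\<Sum>z\<in>E. zorder D z) + int (card J)"
      unfolding lhs .
    have "inj T" using m_pos by (auto simp: inj_def T_def)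
    then have c1: "card (T ` {- int N..int N}) = card {- int N..int N}"
      by (intro card_image) (auto intro: inj_on_subset)
    have set_eq: "{- int N..int N} = {n. \<bar>n\<bar> < N0} \<union> J"
      using N(1) N0 by (auto simp: J_def)
    have c2: "card ({n. \<bar>n\<bar> < N0} \<union> J) = card {n. \<bar>n\<bar> < N0} + card J"
      by (rule card_Un_disjoint[OF fin_small finJ]) (auto simp: J_def)
    show ?thesis using le unfolding c1 unfolding set_eq c2 by simp
  qed
  define I where "I = {n. \<bar>n\<bar> < N0}"
  have fin_I: "finite I" unfolding I_def by (rule fin_small)
  have E_zero: "D z = 0" if "z \<in> E" for z using that by (simp add: E_def)
  have "int (card I) \<le> int (\<Sum>z\<in>E. nat (zorder D z))"
    using count zpos[OF E_zero] by (simp add: I_def less_imp_le)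
  then have "card I \<le> (\<Sum>z\<in>E. nat (zorder D z))" by linarith
  from assign_with_multiplicity[OF fin_E fin_I this]
  obtain F where F: "F ` I \<subseteq> E" "\<And>z. z \<in> E \<Longrightarrow> card {i\<in>I. F i = z} \<le> nat (zorder D z)" by blast
  have F_in: "F n \<in> E" if "\<bar>n\<bar> < N0" for n
    using F(1) that by (simp add: image_subset_iff I_def)
  define lam where "lam n = (if \<bar>n\<bar> < N0 then F n else Z n)" for n
  \<comment> \<open>Values of \<open>lam\<close> at large indices are never in \<open>E\<close>, and those at small indices always are.\<close>
  have fiber_E: "{n. lam n = z} = {i\<in>I. F i = z}" if "z \<in> E" for z
  proof -
    have "Z n \<noteq> z" if "N0 \<le> \<bar>n\<bar>" for n
      using \<open>z \<in> E\<close> that unfolding E_def by blast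
    then show ?thesis by (auto simp: lam_def I_def not_less)
  qed
  have fiber_Z: "{n. lam n = Z k} = {k}" if "N0 \<le> \<bar>k\<bar>" for k
  proof -
    have "Z k \<notin> E" using that unfolding E_def by blast
    then have F_ne: "F n \<noteq> Z k" if "\<bar>n\<bar> < N0" for n
      using F_in[OF that] by metis
    have "n = k" if n: "lam n = Z k" for n
    proof (cases "\<bar>n\<bar> < N0")
      case True
      then show ?thesis using F_ne[of n] n by (simp add: lam_def)
    next
      case False
      then show ?thesis using n \<open>N0 \<le> \<bar>k\<bar>\<close> by (intro Z_inj) (simp_all add: lam_def)
    qed
    moreover have "lam k = Z k" using that by (simp add: lam_def)
    ultimately show ?thesis by (intro equalityI subsetI) simp_all
  qed
  have lam_zero: "D (lam n) = 0" for n
  proof (cases "\<bar>n\<bar> < N0")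
    case True
    then have "F n \<in> E" by (rule F_in)
    then show ?thesis using True E_zero by (simp add: lam_def)
  next
    case False
    then show ?thesis using Z(2) by (simp add: lam_def)
  qed
  have zeros: "z \<in> E \<or> (\<exists>k. N0 \<le> \<bar>k\<bar> \<and> z = Z k)" if "D z = 0" for z
    using that by (auto simp: E_def)
  have "lists_almost_all_eigenvalues (\<lambda>z. D z = 0) D lam"
    unfolding lists_almost_all_eigenvalues_def
  proof (intro conjI allI impI)
    fix z assume z: "D z = 0"
    from zeros[OF z] show "finite {n. lam n = z}"
      using fiber_E fiber_Z fin_I by auto
    from zeros[OF z] show "int (card {n. lam n = z}) \<le> zorder D z"
    proof
      assume zE: "z \<in> E"
      show ?thesis unfolding fiber_E[OF zE] using F(2)[OF zE] zpos[OF z] by simp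
    next
      assume "\<exists>k. N0 \<le> \<bar>k\<bar> \<and> z = Z k"
      then obtain k where k: "N0 \<le> \<bar>k\<bar>" "z = Z k" by blast
      show ?thesis unfolding k(2) fiber_Z[OF k(1)] using Z(3)[OF k(1)] by simp
    qed
  next
    have "{z. D z = 0 \<and> int (card {n. lam n = z}) < zorder D z} \<subseteq> E"
    proof clarify
      fix z assume z: "D z = 0" "int (card {n. lam n = z}) < zorder D z"
      show "z \<in> E"
      proof (rule ccontr)
        assume "z \<notin> E"
        then obtain k where k: "N0 \<le> \<bar>k\<bar>" "z = Z k" using zeros[OF z(1)] by blast
        show False using z(2) unfolding k(2) fiber_Z[OF k(1)] using Z(3)[OF k(1)] by simp
      qed
    qed
    then show "finite {z. D z = 0 \<and> int (card {n. lam n = z}) < zorder D z}"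
      using fin_E by (rule finite_subset)
  qed (rule lam_zero)
  moreover have "lam n = T n + (lam n - T n)" for n by simp
  moreover have "(\<lambda>n. (cmod (lam n - T n))\<^sup>2) summable_on UNIV"
  proof (rule summable_on_comparison_test)
    define C where "C = 2 / (m * cmod \<kappa>)"
    have "(\<lambda>n. if n \<in> I then (cmod (lam n - T n))\<^sup>2 else 0) summable_on UNIV"
    proof -
      have "(\<lambda>n. (cmod (lam n - T n))\<^sup>2) summable_on I" using fin_I by (rule summable_on_finite)
      moreover have "(\<lambda>n. (cmod (lam n - T n))\<^sup>2) summable_on I
          \<longleftrightarrow> (\<lambda>n. if n \<in> I then (cmod (lam n - T n))\<^sup>2 else 0) summable_on UNIV"
        by (rule summable_on_cong_neutral) auto
      ultimately show ?thesis by blast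
    qed
    then show "(\<lambda>n. C\<^sup>2 * (b n)\<^sup>2 + (if n \<in> I then (cmod (lam n - T n))\<^sup>2 else 0)) summable_on UNIV"
      by (intro summable_on_add summable_on_cmult_right b_summable)
    fix n
    show "(cmod (lam n - T n))\<^sup>2 \<le> C\<^sup>2 * (b n)\<^sup>2 + (if n \<in> I then (cmod (lam n - T n))\<^sup>2 else 0)"
    proof (cases "n \<in> I")
      case False
      then have n: "N0 \<le> \<bar>n\<bar>" by (simp add: I_def)
      have "(cmod (Z n - T n))\<^sup>2 \<le> (C * b n)\<^sup>2"
        unfolding C_def by (intro power_mono Z(4) n) simp
      then show ?thesis using False n by (simp add: lam_def power_mult_distrib)
    qed simp
  qed simp
  moreover have "\<exists>N. \<forall>n. N \<le> \<bar>n\<bar> \<longrightarrow> simple_zero D (lam n)"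
    by (rule exI[of _ N0]) (simp add: simple_zero_def lam_def Z)
  ultimately show ?thesis using that[of lam "\<lambda>n. lam n - T n"] by blast
qed

end

section \<open>The boundary value problem\<close>

lemma phase_rho_mu:
  assumes "0 < a" "a < pi" "0 < \<alpha>"
  shows "phase pi (rho a \<alpha>) (mu a \<alpha>) {a} (min 1 \<alpha>)"
proof
  have eq: "mu a \<alpha> = (\<lambda>x. x + (\<alpha> - 1) * max (x - a) 0)"
    by (auto simp: mu_def fun_eq_iff max_def algebra_simps)
  show "continuous_on {0..pi} (mu a \<alpha>)" unfolding eq by (intro continuous_intros)
  fix x assume x: "x \<in> {0<..<pi} - {a}"
  show "(mu a \<alpha> has_real_derivative rho a \<alpha> x) (at x)"
  proof (cases "x < a")
    case True
    have "((\<lambda>x. x) has_real_derivative 1) (at x)" by (auto intro!: derivative_eq_intros)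
    then have "(mu a \<alpha> has_real_derivative 1) (at x)"
      by (rule has_field_derivative_transform_within_open[of _ _ _ "{..<a}"]) (use True in \<open>auto simp: mu_def\<close>)
    then show ?thesis using True by (simp add: rho_def)
  next
    case False
    have "((\<lambda>x. \<alpha> * x - \<alpha> * a + a) has_real_derivative \<alpha>) (at x)" by (auto intro!: derivative_eq_intros)
    then have "(mu a \<alpha> has_real_derivative \<alpha>) (at x)"
      by (rule has_field_derivative_transform_within_open[of _ _ _ "{a<..}"]) (use False x in \<open>auto simp: mu_def\<close>)
    then show ?thesis using False x by (simp add: rho_def)
  qed
qed (use assms in \<open>auto simp: rho_def mu_def\<close>)

lemma square_integrable_on_imp_absolutely_integrable:
  assumes "square_integrable_on p {0<..<b}"
  shows "p absolutely_integrable_on {0..b}" "(\<lambda>x. (p x)\<^sup>2) absolutely_integrable_on {0..b}"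
proof -
  have m: "p \<in> borel_measurable (lebesgue_on {0<..<b})" and i: "integrable (lebesgue_on {0<..<b}) (\<lambda>x. (p x)\<^sup>2)"
    using assms by (auto simp: square_integrable_on_def)
  have i2: "(\<lambda>x. (p x)\<^sup>2) integrable_on {0<..<b}" by (rule integrable_on_lebesgue_on[OF i]) simp
  have "p absolutely_integrable_on {0<..<b}"
  proof (rule measurable_bounded_by_integrable_imp_absolutely_integrable[OF m])
    show "(\<lambda>x. 1 + (p x)\<^sup>2) integrable_on {0<..<b}"
      using i2 by (intro integrable_add) (auto simp: integrable_on_open_interval_real integrable_on_Icc_iff_Ioo[symmetric])
    show "norm (p x) \<le> 1 + (p x)\<^sup>2" for x
      using zero_le_power2[of "\<bar>p x\<bar> - 1"] by (simp add: power2_diff)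
  qed simp
  then show "p absolutely_integrable_on {0..b}" by (simp add: absolutely_integrable_on_Icc_iff_Ioo)
  have "(\<lambda>x. (p x)\<^sup>2) absolutely_integrable_on {0<..<b}"
    using i2 by (intro nonnegative_absolutely_integrable_1) auto
  then show "(\<lambda>x. (p x)\<^sup>2) absolutely_integrable_on {0..b}" by (simp add: absolutely_integrable_on_Icc_iff_Ioo)
qed

text \<open>The null set on which the system may fail, together with the two end points, is absorbed by
  \<open>primitive_on_spike\<close>.\<close>

lemma dirac_solution_imp_pair:
  fixes y :: "real \<Rightarrow> complex^2"
  assumes ph: "phase pi (rho a \<alpha>) (mu a \<alpha>) {a} \<rho>0" and sol: "dirac_solution a \<alpha> p q lam y"
  shows "phase.dirac_pair pi (rho a \<alpha>) (\<lambda>x. Complex (q x) (- p x)) (\<lambda>x. Complex (q x) (p x)) lam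
           (\<lambda>x. y x $ 1 + \<i> * y x $ 2) (\<lambda>x. y x $ 1 - \<i> * y x $ 2)"
proof -
  interpret phase pi "rho a \<alpha>" "mu a \<alpha>" "{a}" \<rho>0 by (rule ph)
  from sol obtain y' where y': "y' absolutely_integrable_on {0..pi}" "\<And>x. x \<in> {0..pi} \<Longrightarrow> y x = y 0 + integral {0..x} y'"
    and ae: "AE x in lebesgue_on {0<..<pi}. matB *v y' x + Omega p q x *v y x = (lam * of_real (rho a \<alpha> x)) *s y x"
    unfolding dirac_solution_def by blast
  have P: "primitive_on pi y y'" unfolding primitive_on_def using y' by blast
  from ae have "AE x in lebesgue. x \<in> {0<..<pi} \<longrightarrow>
      matB *v y' x + Omega p q x *v y x = (lam * of_real (rho a \<alpha> x)) *s y x"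
    by (subst (asm) AE_restrict_space_iff) auto
  then obtain N where N: "N \<in> null_sets lebesgue"
    "{x \<in> space lebesgue. \<not> (x \<in> {0<..<pi} \<longrightarrow> matB *v y' x + Omega p q x *v y x = (lam * of_real (rho a \<alpha> x)) *s y x)} \<subseteq> N"
    unfolding eventually_ae_filter by blast
  define N' where "N' = N \<union> {0, pi}"
  have negl: "negligible N'"
    using N(1) by (auto simp: N'_def negligible_iff_null_sets[symmetric] intro!: negligible_Un)
  have eqs: "y' x $ 2 + of_real (p x) * y x $ 1 + of_real (q x) * y x $ 2 = lam * of_real (rho a \<alpha> x) * y x $ 1"
    "- y' x $ 1 + of_real (q x) * y x $ 1 - of_real (p x) * y x $ 2 = lam * of_real (rho a \<alpha> x) * y x $ 2"
    if x: "x \<in> {0..pi} - N'" for x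
  proof -
    have "x \<in> {0<..<pi}" using x by (auto simp: N'_def less_le)
    then have e: "matB *v y' x + Omega p q x *v y x = (lam * of_real (rho a \<alpha> x)) *s y x"
      using N(2) x by (auto simp: N'_def)
    from arg_cong[OF e, of "\<lambda>v :: complex^2. v $ 1"] arg_cong[OF e, of "\<lambda>v :: complex^2. v $ 2"]
    show "y' x $ 2 + of_real (p x) * y x $ 1 + of_real (q x) * y x $ 2 = lam * of_real (rho a \<alpha> x) * y x $ 1"
      "- y' x $ 1 + of_real (q x) * y x $ 1 - of_real (p x) * y x $ 2 = lam * of_real (rho a \<alpha> x) * y x $ 2"
      by (simp_all add: matB_def Omega_def matrix_vector_mult_def sum_2 algebra_simps)
  qed
  have bl: "bounded_linear (\<lambda>z :: complex^2. z $ 1 + c * z $ 2)" for c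
    by (intro bounded_linear_add bounded_linear_vec_nth bounded_linear_const_mult)
  have cq: "Complex (q x) (- p x) = of_real (q x) - \<i> * of_real (p x)" "Complex (q x) (p x) = of_real (q x) + \<i> * of_real (p x)" for x
    by (simp_all add: complex_eq_iff)
  show ?thesis
    unfolding dirac_pair_def
  proof
    show "primitive_on pi (\<lambda>x. y x $ 1 + \<i> * y x $ 2) (\<lambda>x. \<i> * lam * of_real (rho a \<alpha> x) * (y x $ 1 + \<i> * y x $ 2)
        + Complex (q x) (- p x) * (y x $ 1 - \<i> * y x $ 2))"
    proof (rule primitive_on_spike[OF primitive_on_bounded_linear[OF P bl[of \<i>]] negl])
      fix x assume x: "x \<in> {0..pi} - N'"
      have d: "y' x $ 2 = lam * of_real (rho a \<alpha> x) * y x $ 1 - of_real (p x) * y x $ 1 - of_real (q x) * y x $ 2"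
        "y' x $ 1 = of_real (q x) * y x $ 1 - of_real (p x) * y x $ 2 - lam * of_real (rho a \<alpha> x) * y x $ 2"
        using eqs[OF x] by (simp_all add: algebra_simps)
      show "\<i> * lam * of_real (rho a \<alpha> x) * (y x $ 1 + \<i> * y x $ 2) + Complex (q x) (- p x) * (y x $ 1 - \<i> * y x $ 2)
        = y' x $ 1 + \<i> * y' x $ 2"
        unfolding cq d by (simp add: algebra_simps)
    qed
    show "primitive_on pi (\<lambda>x. y x $ 1 - \<i> * y x $ 2) (\<lambda>x. - \<i> * lam * of_real (rho a \<alpha> x) * (y x $ 1 - \<i> * y x $ 2)
        + Complex (q x) (p x) * (y x $ 1 + \<i> * y x $ 2))"
    proof (rule primitive_on_spike[OF _ negl])
      show "primitive_on pi (\<lambda>x. y x $ 1 - \<i> * y x $ 2) (\<lambda>x. y' x $ 1 - \<i> * y' x $ 2)"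
        using primitive_on_bounded_linear[OF P bl[of "- \<i>"]] by simp
      fix x assume x: "x \<in> {0..pi} - N'"
      have d: "y' x $ 2 = lam * of_real (rho a \<alpha> x) * y x $ 1 - of_real (p x) * y x $ 1 - of_real (q x) * y x $ 2"
        "y' x $ 1 = of_real (q x) * y x $ 1 - of_real (p x) * y x $ 2 - lam * of_real (rho a \<alpha> x) * y x $ 2"
        using eqs[OF x] by (simp_all add: algebra_simps)
      show "- \<i> * lam * of_real (rho a \<alpha> x) * (y x $ 1 - \<i> * y x $ 2) + Complex (q x) (p x) * (y x $ 1 + \<i> * y x $ 2)
        = y' x $ 1 - \<i> * y' x $ 2"
        unfolding cq d by (simp add: algebra_simps)
    qed
  qed
qed

lemma summable_inverse_square_int: "(\<lambda>n :: int. (K / (1 + \<bar>real_of_int n\<bar>))\<^sup>2) summable_on UNIV"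
proof -
  have nat: "(\<lambda>k :: nat. (K / (1 + real k))\<^sup>2) summable_on UNIV"
  proof (rule norm_summable_imp_summable_on)
    have "summable (\<lambda>k. 1 / real k ^ 2)"
      using inverse_power_summable[of 2, where 'a = real] by (simp add: inverse_eq_divide)
    then have "summable (\<lambda>k. 1 / real (Suc k) ^ 2)"
      by (subst summable_Suc_iff)
    then have "summable (\<lambda>k. K\<^sup>2 * (1 / real (Suc k) ^ 2))"
      by (rule summable_mult)
    then show "summable (\<lambda>k. norm ((K / (1 + real k))\<^sup>2))" by (simp add: power_divide)
  qed
  have "(\<lambda>n :: int. (K / (1 + \<bar>real_of_int n\<bar>))\<^sup>2) summable_on range int"
    using nat by (subst summable_on_reindex) (auto simp: o_def)
  moreover have "(\<lambda>n :: int. (K / (1 + \<bar>real_of_int n\<bar>))\<^sup>2) summable_on range (\<lambda>k. - int k)"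
    using nat by (subst summable_on_reindex) (auto simp: o_def inj_def)
  moreover have "(UNIV :: int set) = range int \<union> range (\<lambda>k. - int k)"
    by (auto simp: image_iff) (metis int_cases)
  ultimately show ?thesis by (metis summable_on_union)
qed

theorem lemma5:
  fixes a \<alpha> b1 b2 b3 b4 c1 c2 c3 c4 x :: real
    and p q :: "real \<Rightarrow> real"
    and \<phi> \<psi> :: "real \<Rightarrow> complex \<Rightarrow> complex^2"
  assumes "0 < a" and "a < pi" and "\<alpha> > 0" and "\<alpha> \<noteq> 1"
    and "square_integrable_on p {0<..<pi}" and "square_integrable_on q {0<..<pi}"
    and "b1 * b4 - b2 * b3 > 0" and "c1 * c4 - c2 * c3 > 0"
    and "b3 * c3 + b4 * c4 \<noteq> 0"
    and "is_phi a \<alpha> p q b1 b2 b3 b4 \<phi>"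
    and "is_psi a \<alpha> p q c1 c2 c3 c4 \<psi>"
    and "x \<in> {0..pi}"
  shows "\<exists>(lam :: int \<Rightarrow> complex) (\<epsilon> :: int \<Rightarrow> complex).
    lists_almost_all_eigenvalues
      (is_eigenvalue a \<alpha> p q b1 b2 b3 b4 c1 c2 c3 c4) (char_fun \<phi> \<psi> x) lam \<and>
    (\<forall>n. lam n = of_real (lambda_tilde a \<alpha> b3 b4 c3 c4 n) + \<epsilon> n) \<and>
    (\<lambda>n. (cmod (\<epsilon> n))\<^sup>2) summable_on UNIV \<and>
    (\<exists>N. \<forall>n. \<bar>n\<bar> \<ge> N \<longrightarrow> simple_zero (char_fun \<phi> \<psi> x) (lam n))"
proof -
  have ph: "phase pi (rho a \<alpha>) (mu a \<alpha>) {a} (min 1 \<alpha>)"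
    by (rule phase_rho_mu) (use assms in auto)
  interpret phase pi "rho a \<alpha>" "mu a \<alpha>" "{a}" "min 1 \<alpha>" by (rule ph)
  define f where "f = (\<lambda>x. Complex (q x) (- p x))"
  define g where "g = (\<lambda>x. Complex (q x) (p x))"
  note sp = square_integrable_on_imp_absolutely_integrable[OF assms(5)] and sq = square_integrable_on_imp_absolutely_integrable[OF assms(6)]
  have L2c: "L2 (\<lambda>x. Complex (q x) (s * p x))" if "s\<^sup>2 = 1" for s
    unfolding L2_def
  proof
    have "(\<lambda>x. complex_of_real (q x) + \<i> * of_real s * complex_of_real (p x)) absolutely_integrable_on {0..pi}"
      using absolutely_integrable_linear[OF sp(1) bounded_linear_of_real] absolutely_integrable_linear[OF sq(1) bounded_linear_of_real]
      by (intro set_integral_add absolutely_integrable_mult_continuous(2) continuous_intros) (simp_all add: o_def)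
    moreover have "complex_of_real (q x) + \<i> * of_real s * complex_of_real (p x) = Complex (q x) (s * p x)" for x
      by (simp add: complex_eq_iff)
    ultimately show "(\<lambda>x. Complex (q x) (s * p x)) absolutely_integrable_on {0..pi}" by simp
    have "(cmod (Complex (q x) (s * p x)))\<^sup>2 = (q x)\<^sup>2 + (p x)\<^sup>2" for x
      using that by (simp add: cmod_power2 power_mult_distrib)
    then show "(\<lambda>x. (cmod (Complex (q x) (s * p x)))\<^sup>2) integrable_on {0..pi}"
      using sp(2) sq(2) by (simp add: integrable_add integrable_if_absolutely)
  qed
  have f: "L2 f" and g: "L2 g"
    using L2c[of "-1"] L2c[of 1] by (simp_all add: f_def g_def)
  note fa = L2D(1)[OF f] and ga = L2D(1)[OF g]
  have pair: "dirac_pair f g lam (\<lambda>x. y x $ 1 + \<i> * y x $ 2) (\<lambda>x. y x $ 1 - \<i> * y x $ 2)"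
    if "dirac_solution a \<alpha> p q lam y" for lam and y :: "real \<Rightarrow> complex^2"
    unfolding f_def g_def by (rule dirac_solution_imp_pair[OF ph that])
  have phi: "dirac_solution a \<alpha> p q lam (\<lambda>x. \<phi> x lam)" "\<phi> 0 lam = vector [lam * b3 - b1, b2 - lam * b4]" for lam :: complex
    using assms(10) by (simp_all add: is_phi_def)
  have psi: "dirac_solution a \<alpha> p q lam (\<lambda>x. \<psi> x lam)" "\<psi> pi lam = vector [- c1 - lam * c3, c2 + lam * c4]" for lam :: complex
    using assms(11) by (simp_all add: is_psi_def)
  define u v where "u = (\<lambda>lam x. \<phi> x lam $ 1 + \<i> * \<phi> x lam $ 2)" and "v = (\<lambda>lam x. \<phi> x lam $ 1 - \<i> * \<phi> x lam $ 2)"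
  have uv: "dirac_pair f g lam (u lam) (v lam)" for lam
    using pair[OF phi(1)[of lam]] by (simp add: u_def v_def)
  define A1 A0 B1 B0 where "A1 = b3 - \<i> * b4" and "A0 = - b1 + \<i> * b2" and "B1 = b3 + \<i> * b4" and "B0 = - b1 - \<i> * b2"
  have uv0: "u lam 0 = lam * A1 + A0" "v lam 0 = lam * B1 + B0" for lam
    by (simp_all add: u_def v_def phi(2) A1_def A0_def B1_def B0_def algebra_simps)
  define G1 G0 H1 H0 where "G1 = - c3 - \<i> * c4" and "G0 = - c1 - \<i> * c2" and "H1 = - c3 + \<i> * c4" and "H0 = - c1 + \<i> * c2"
  define D where "D lam = (u lam pi * (lam * G1 + G0) - v lam pi * (lam * H1 + H0)) / (2 * \<i>)" for lam
  have char: "char_fun \<phi> \<psi> x = D"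
  proof
    fix lam
    have "u lam x * (\<psi> x lam $ 1 - \<i> * \<psi> x lam $ 2) - v lam x * (\<psi> x lam $ 1 + \<i> * \<psi> x lam $ 2)
       = u lam pi * (\<psi> pi lam $ 1 - \<i> * \<psi> pi lam $ 2) - v lam pi * (\<psi> pi lam $ 1 + \<i> * \<psi> pi lam $ 2)"
      by (rule wronskian_constant[OF uv pair[OF psi(1)] assms(12)])
    also have "\<dots> = u lam pi * (lam * G1 + G0) - v lam pi * (lam * H1 + H0)"
      by (simp add: psi(2) G1_def G0_def H1_def H0_def algebra_simps)
    also have "\<dots> = 2 * \<i> * D lam" by (simp add: D_def)
    finally have "2 * \<i> * char_fun \<phi> \<psi> x lam = 2 * \<i> * D lam"
      by (simp add: char_fun_def u_def v_def algebra_simps)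
    then show "char_fun \<phi> \<psi> x lam = D lam" by simp
  qed
  \<comment> \<open>The second boundary condition for \<open>\<phi>\<close> is the equation \<open>D lam = 0\<close>; the first one holds for all \<open>lam\<close>.\<close>
  have D_U2: "D lam = - U2 c1 c2 c3 c4 lam (\<lambda>x. \<phi> x lam)" for lam
    by (simp add: D_def U2_def u_def v_def G1_def G0_def H1_def H0_def field_simps)
  \<comment> \<open>This uses \<open>b1 * b4 - b2 * b3 \<noteq> 0\<close>: the two components cannot vanish for the same \<open>lam\<close>.\<close>
  have nz: "\<phi> 0 lam $ 1 \<noteq> 0 \<or> \<phi> 0 lam $ 2 \<noteq> 0" for lam
  proof (rule ccontr)
    assume "\<not> ?thesis"
    then have e: "lam * b3 = b1" "lam * b4 = b2" by (simp_all add: phi(2))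
    have "complex_of_real (b1 * b4 - b2 * b3) = (lam * b3) * b4 - (lam * b4) * b3"
      unfolding e by simp
    also have "\<dots> = 0" by simp
    finally show False using assms(7) by (simp only: of_real_eq_0_iff)
  qed
  have ev: "is_eigenvalue a \<alpha> p q b1 b2 b3 b4 c1 c2 c3 c4 lam \<longleftrightarrow> D lam = 0" for lam
  proof
    assume D0: "D lam = 0"
    have "U1 b1 b2 b3 b4 lam (\<lambda>x. \<phi> x lam) = 0"
      by (simp add: U1_def phi(2) algebra_simps)
    moreover have "\<phi> 0 lam \<noteq> 0" using nz[of lam] by auto
    ultimately show "is_eigenvalue a \<alpha> p q b1 b2 b3 b4 c1 c2 c3 c4 lam"
      unfolding is_eigenvalue_def using D0 D_U2[of lam] phi(1)[of lam]
      by (intro exI[of _ "\<lambda>x. \<phi> x lam"]) auto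
  next
    assume "is_eigenvalue a \<alpha> p q b1 b2 b3 b4 c1 c2 c3 c4 lam"
    then obtain y t where y: "dirac_solution a \<alpha> p q lam y" and t: "t \<in> {0..pi}" "y t \<noteq> 0"
      and U: "U1 b1 b2 b3 b4 lam y = 0" "U2 c1 c2 c3 c4 lam y = 0"
      unfolding is_eigenvalue_def by blast
    \<comment> \<open>An eigenfunction satisfies the first boundary condition, so its initial value is a multiple of that of \<open>\<phi>\<close>.\<close>
    have par: "y 0 $ 1 * \<phi> 0 lam $ 2 = y 0 $ 2 * \<phi> 0 lam $ 1"
      using U(1) by (simp add: U1_def phi(2) algebra_simps)
    obtain k where k: "y 0 $ 1 = k * \<phi> 0 lam $ 1" "y 0 $ 2 = k * \<phi> 0 lam $ 2"
    proof (cases "\<phi> 0 lam $ 1 = 0")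
      case True
      then show ?thesis using nz[of lam] par that[of "y 0 $ 2 / \<phi> 0 lam $ 2"] by auto
    next
      case False
      then show ?thesis using par that[of "y 0 $ 1 / \<phi> 0 lam $ 1"] by (auto simp: field_simps)
    qed
    have eq: "y s $ 1 = k * \<phi> s lam $ 1" "y s $ 2 = k * \<phi> s lam $ 2" if s: "s \<in> {0..pi}" for s
    proof -
      have e: "y s $ 1 + \<i> * y s $ 2 = k * u lam s" "y s $ 1 - \<i> * y s $ 2 = k * v lam s"
        by (rule dirac_pair_unique[OF fa ga pair[OF y] uv _ _ s]; simp add: u_def v_def k algebra_simps)+
      have "2 * y s $ 1 = 2 * (k * \<phi> s lam $ 1)" "2 * \<i> * y s $ 2 = 2 * \<i> * (k * \<phi> s lam $ 2)"
        using arg_cong2[OF e, of "(+)"] arg_cong2[OF e, of "(-)"] by (simp_all add: u_def v_def algebra_simps)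
      then show "y s $ 1 = k * \<phi> s lam $ 1" "y s $ 2 = k * \<phi> s lam $ 2" by simp_all
    qed
    have "k \<noteq> 0"
    proof
      assume "k = 0"
      then have "y t = 0" using eq[OF t(1)] by (simp add: vec_eq_iff forall_2)
      then show False using t(2) by simp
    qed
    moreover have "U2 c1 c2 c3 c4 lam y = k * U2 c1 c2 c3 c4 lam (\<lambda>x. \<phi> x lam)"
      using eq[of pi] by (simp add: U2_def algebra_simps)
    ultimately show "D lam = 0" using U(2) D_U2[of lam] by simp
  qed
  have hol: "D holomorphic_on UNIV"
  proof -
    have "(\<lambda>lam. u lam 0) holomorphic_on UNIV" "(\<lambda>lam. v lam 0) holomorphic_on UNIV"
      unfolding uv0 by (intro holomorphic_intros)+
    from solution_holomorphic[OF fa ga uv this, of pi]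
    show ?thesis unfolding D_def by (intro holomorphic_intros) auto
  qed
  define m where "m = mu a \<alpha> pi"
  have m: "0 < m" using mu_L_pos by (simp add: m_def)
  define P Q where "P = b3 * c3 + b4 * c4" and "Q = c3 * b4 - c4 * b3"
  \<comment> \<open>The phase shift: the leading term is \<open>Q * cos w - P * sin w\<close> with \<open>w = m * lam\<close>, a sine of \<open>w - \<theta>\<close>.\<close>
  define \<theta> where "\<theta> = arctan (Q / P)"
  define t0 where "t0 = \<theta> / m"
  define \<kappa> where "\<kappa> = - complex_of_real (P / cos \<theta>)"
  have P: "P \<noteq> 0" using assms(9) by (simp add: P_def)
  have cos: "cos \<theta> \<noteq> 0" unfolding \<theta>_def by (rule cos_arctan_not_zero)
  have QP: "Q = P * sin \<theta> / cos \<theta>"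
    using tan_arctan[of "Q / P"] P by (simp add: \<theta>_def[symmetric] tan_def field_simps)
  have main: "(A1 * G1 * E (\<i> * lam) pi - B1 * H1 * E (- \<i> * lam) pi) / (2 * \<i>)
      = \<kappa> * sin (of_real m * (lam - of_real t0))" for lam
  proof -
    define w where "w = of_real m * lam"
    have E: "E (\<i> * lam) pi = exp (\<i> * w)" "E (- \<i> * lam) pi = exp (- (\<i> * w))"
      by (simp_all add: E_def m_def w_def mult_ac)
    have AG: "A1 * G1 = - of_real P + \<i> * of_real Q" "B1 * H1 = - of_real P - \<i> * of_real Q"
      by (simp_all add: A1_def G1_def B1_def H1_def P_def Q_def algebra_simps)
    have "(A1 * G1 * E (\<i> * lam) pi - B1 * H1 * E (- \<i> * lam) pi) / (2 * \<i>)
      = - of_real P * ((exp (\<i> * w) - exp (- (\<i> * w))) / (2 * \<i>)) + of_real Q * ((exp (\<i> * w) + exp (- (\<i> * w))) / 2)"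
      unfolding E AG by (simp add: field_simps)
    also have "\<dots> = - of_real P * sin w + of_real Q * cos w"
      by (simp add: sin_exp_eq cos_exp_eq)
    also have "\<dots> = \<kappa> * (sin w * cos (of_real \<theta>) - cos w * sin (of_real \<theta>))"
      unfolding \<kappa>_def QP using cos by (simp add: field_simps cos_of_real sin_of_real)
    also have "\<dots> = \<kappa> * sin (w - of_real \<theta>)" by (simp add: sin_diff)
    also have "w - of_real \<theta> = of_real m * (lam - of_real t0)"
      using m by (simp add: w_def t0_def algebra_simps)
    finally show ?thesis .
  qed
  obtain C where C: "0 < C"
    "\<And>lam. 1 \<le> cmod lam \<Longrightarrow>
       cmod (u lam pi * (lam * G1 + G0) - v lam pi * (lam * H1 + H0)
         - lam\<^sup>2 * (A1 * G1 * E (\<i> * lam) pi - B1 * H1 * E (- \<i> * lam) pi))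
       \<le> C * (cmod lam)\<^sup>2 * exp (mu a \<alpha> pi * \<bar>Im lam\<bar>) * (full_defect f g lam + 1 / cmod lam)"
    using characteristic_asymptotics[OF f g uv uv0] by blast
  have asym: "cmod (D lam - \<kappa> * lam\<^sup>2 * sin (of_real m * (lam - of_real t0)))
      \<le> C * (cmod lam)\<^sup>2 * exp (m * \<bar>Im lam\<bar>) * (full_defect f g lam + 1 / cmod lam)" if "1 \<le> cmod lam" for lam
  proof -
    have "D lam - \<kappa> * lam\<^sup>2 * sin (of_real m * (lam - of_real t0))
      = (u lam pi * (lam * G1 + G0) - v lam pi * (lam * H1 + H0)
         - lam\<^sup>2 * (A1 * G1 * E (\<i> * lam) pi - B1 * H1 * E (- \<i> * lam) pi)) / (2 * \<i>)"
    proof -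
      have common: "X / w - l * (Y / w) = (X - l * Y) / w" for X Y l w :: complex
        by (simp add: diff_divide_distrib)
      have eq: "\<kappa> * lam\<^sup>2 * sin (of_real m * (lam - of_real t0))
          = lam\<^sup>2 * ((A1 * G1 * E (\<i> * lam) pi - B1 * H1 * E (- \<i> * lam) pi) / (2 * \<i>))"
        unfolding main by simp
      show ?thesis unfolding D_def eq by (rule common)
    qed
    then have "cmod (D lam - \<kappa> * lam\<^sup>2 * sin (of_real m * (lam - of_real t0)))
      = cmod (u lam pi * (lam * G1 + G0) - v lam pi * (lam * H1 + H0)
         - lam\<^sup>2 * (A1 * G1 * E (\<i> * lam) pi - B1 * H1 * E (- \<i> * lam) pi)) / 2"
      by (simp add: norm_divide norm_mult)
    also have "\<dots> \<le> cmod (u lam pi * (lam * G1 + G0) - v lam pi * (lam * H1 + H0)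
         - lam\<^sup>2 * (A1 * G1 * E (\<i> * lam) pi - B1 * H1 * E (- \<i> * lam) pi))"
      using norm_ge_zero[of "u lam pi * (lam * G1 + G0) - v lam pi * (lam * H1 + H0)
         - lam\<^sup>2 * (A1 * G1 * E (\<i> * lam) pi - B1 * H1 * E (- \<i> * lam) pi)"] by linarith
    also note C(2)[OF that]
    finally show ?thesis by (simp add: m_def)
  qed
  \<comment> \<open>Chosen so that \<open>1 + \<bar>n\<bar> \<le> K * \<bar>T\<bar>\<close> for every node \<open>T\<close> with \<open>\<bar>T\<bar> \<ge> 1\<close>.\<close>
  define K where "K = 1 + (1 + \<bar>t0\<bar>) * m / pi"
  define b where "b n = C * (full_defect f g (of_real (freq t0 n)) + K / (1 + \<bar>real_of_int n\<bar>))" for n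
  have frq: "freq t0 n = t0 + of_int n * pi / m" for n by (simp add: freq_def m_def)
  interpret sine_type D \<kappa> m t0 b
  proof
    show "D holomorphic_on UNIV" by (rule hol)
    show "\<kappa> \<noteq> 0" using P cos by (simp add: \<kappa>_def)
    show "0 < m" by (rule m)
    show "\<exists>R. \<forall>z. R \<le> cmod z \<longrightarrow>
        cmod (D z - \<kappa> * z\<^sup>2 * sin (of_real m * (z - of_real t0))) \<le> \<delta> * (cmod z)\<^sup>2 * exp (m * \<bar>Im z\<bar>)" if \<delta>: "0 < \<delta>" for \<delta>
    proof -
      have "0 < \<delta> / (2 * C)" using \<delta> C(1) by simp
      then obtain R where R: "\<And>lam. R \<le> cmod lam \<Longrightarrow> full_defect f g lam \<le> \<delta> / (2 * C)"
        using full_defect_vanishes[OF f g] by blast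
      show ?thesis
      proof (intro exI[of _ "max (max 1 R) (2 * C / \<delta>)"] allI impI)
        fix z assume z: "max (max 1 R) (2 * C / \<delta>) \<le> cmod z"
        have "1 \<le> cmod z" "2 * C / \<delta> \<le> cmod z" using z by simp_all
        moreover from this have "0 < cmod z" by linarith
        ultimately have "1 / cmod z \<le> \<delta> / (2 * C)" using \<delta> C(1) by (simp add: field_simps)
        moreover have "full_defect f g z \<le> \<delta> / (2 * C)" using z by (intro R) simp
        ultimately have "full_defect f g z + 1 / cmod z \<le> \<delta> / C" by (simp add: field_simps)
        then have "C * (cmod z)\<^sup>2 * exp (m * \<bar>Im z\<bar>) * (full_defect f g z + 1 / cmod z) \<le> C * (cmod z)\<^sup>2 * exp (m * \<bar>Im z\<bar>) * (\<delta> / C)"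
          using C(1) by (intro mult_left_mono) auto
        also have "\<dots> = \<delta> * (cmod z)\<^sup>2 * exp (m * \<bar>Im z\<bar>)" using C(1) by simp
        finally show "cmod (D z - \<kappa> * z\<^sup>2 * sin (of_real m * (z - of_real t0))) \<le> \<delta> * (cmod z)\<^sup>2 * exp (m * \<bar>Im z\<bar>)"
          using asym[of z] z by simp
      qed
    qed
    show "cmod (D (of_real (t0 + of_int n * pi / m))) \<le> (t0 + of_int n * pi / m)\<^sup>2 * b n"
      if n: "1 \<le> \<bar>t0 + of_int n * pi / m\<bar>" for n
    proof -
      define T where "T = t0 + of_int n * pi / m"
      have nT: "1 \<le> \<bar>T\<bar>" using n by (simp only: T_def)
      have "of_real m * (complex_of_real T - of_real t0) = of_real (of_int n * pi)"
        using m by (simp add: T_def)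
      then have "sin (of_real m * (complex_of_real T - of_real t0)) = 0" by (auto simp: sin_eq_0)
      then have "cmod (D (of_real T)) \<le> C * T\<^sup>2 * (full_defect f g (of_real T) + 1 / \<bar>T\<bar>)"
        using asym[of "of_real T"] nT by simp
      also have "1 / \<bar>T\<bar> \<le> K / (1 + \<bar>real_of_int n\<bar>)"
      proof -
        have "of_int n * (pi / m) = T - t0" by (simp add: T_def)
        then have "\<bar>real_of_int n\<bar> * (pi / m) = \<bar>T - t0\<bar>" using m by (metis abs_mult abs_of_pos divide_pos_pos pi_gt_zero)
        also have "\<dots> \<le> \<bar>T\<bar> + \<bar>t0\<bar> * \<bar>T\<bar>"
          using mult_left_mono[OF nT, of "\<bar>t0\<bar>"] by simp
        finally have "\<bar>real_of_int n\<bar> \<le> (1 + \<bar>t0\<bar>) * m / pi * \<bar>T\<bar>" using m by (simp add: field_simps)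
        then have "1 + \<bar>real_of_int n\<bar> \<le> K * \<bar>T\<bar>" using nT by (simp add: K_def distrib_right)
        moreover have "0 < \<bar>T\<bar>" using nT by linarith
        ultimately show ?thesis by (simp add: field_simps)
      qed
      finally have "cmod (D (of_real T)) \<le> C * T\<^sup>2 * (full_defect f g (of_real T) + K / (1 + \<bar>real_of_int n\<bar>))"
        using C(1) by (simp add: mult_left_mono)
      then show ?thesis by (simp add: b_def frq T_def mult_ac)
    qed
    show "(\<lambda>n. (b n)\<^sup>2) summable_on UNIV"
    proof (rule summable_on_comparison_test)
      show "(\<lambda>n. C\<^sup>2 * (2 * ((full_defect f g (of_real (freq t0 n)))\<^sup>2 + (K / (1 + \<bar>real_of_int n\<bar>))\<^sup>2))) summable_on UNIV"
        by (intro summable_on_cmult_right summable_on_add full_defect_square_summable f g summable_inverse_square_int)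
      fix n
      have "(X + Y)\<^sup>2 \<le> 2 * (X\<^sup>2 + Y\<^sup>2)" for X Y :: real
        using sum_squares_bound[of X Y] by (simp add: power2_sum)
      from mult_left_mono[OF this, of "C\<^sup>2" "full_defect f g (of_real (freq t0 n))" "K / (1 + \<bar>real_of_int n\<bar>)"]
      show "(b n)\<^sup>2 \<le> C\<^sup>2 * (2 * ((full_defect f g (of_real (freq t0 n)))\<^sup>2 + (K / (1 + \<bar>real_of_int n\<bar>))\<^sup>2))"
        unfolding b_def power_mult_distrib by simp
    qed simp
  qed
  obtain lam \<epsilon> where le: "lists_almost_all_eigenvalues (\<lambda>z. D z = 0) D lam" "\<And>n. lam n = T n + \<epsilon> n"
    "(\<lambda>n. (cmod (\<epsilon> n))\<^sup>2) summable_on UNIV" "\<exists>N. \<forall>n. N \<le> \<bar>n\<bar> \<longrightarrow> simple_zero D (lam n)"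
    using zeros_listed by blast
  have "t0 + of_int n * pi / m = lambda_tilde a \<alpha> b3 b4 c3 c4 n" for n
    using m unfolding lambda_tilde_def t0_def \<theta>_def P_def Q_def m_def[symmetric]
    by (simp add: field_simps)
  then have "T n = of_real (lambda_tilde a \<alpha> b3 b4 c3 c4 n)" for n
    by (simp only: T_def)
  then show ?thesis
    using le unfolding char ev by (intro exI[of _ lam] exI[of _ \<epsilon>]) auto
qed

end
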